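(* Let $H$ be a separable Hilbert space, let $\phi=\{\phi_t\}_{t\ge 0}$ and $\theta=\{\theta_t\}_{t\ge0}$ be strongly commuting CP$_0$-semigroups on $B(H)$, and let $\alpha,\beta$ be the commuting E$_0$-semigroups on $B(K)$, $K\supseteq H$, which form the product-system E$_0$-dilation of $(\phi,\theta)$ described in the context. If $\phi$ is a semigroup of automorphisms (i.e. every $\phi_t$ is a $*$-automorphism of $B(H)$), then $\alpha$ is a semigroup of automorphisms (i.e. every $\alpha_t$ is a $*$-automorphism of $B(K)$).
   Context: **Semigroups.** A CP$_0$-semigroup on $B(H)$ is a family $\phi=\{\phi_t\}_{t\ge0}$ of contractive, normal, unital, completely positive maps on $B(H)$ with $\phi_0=\mathrm{id}$, $\phi_{s+t}=\phi_s\circ\phi_t$, and $t\mapsto\langle\phi_t(A)h,g\rangle$ continuous for all $A\in B(H)$, $h,g\in H$. It is an E$_0$-semigroup if each $\phi_t$ is a $*$-endomorphism. **Strong commutation.** For normal unital CP maps $\Phi,\Theta$ on $B(H)$ let $B(H)\otimes_\Phi B(H)\otimes_\Theta H$ be the Hausdorff completion of the algebraic tensor product with respect to $\langle a\otimes b\otimes h,\,c\otimes d\otimes k\rangle=\langle h,\Theta(b^*\Phi(a^*c)d)k\rangle$. $\Phi$ and $\Theta$ commute strongly if they commute and there is a unitary $u:B(H)\otimes_\Phi B(H)\otimes_\Theta H\to B(H)\otimes_\Theta B(H)\otimes_\Phi H$ with $u(a\otimes I\otimes h)=a\otimes I\otimes h$ and $u(ca\otimes b\otimes h)=(c\otimes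 I\otimes I)u(a\otimes b\otimes h)$ for all $a,b,c\in B(H)$, $h\in H$. Semigroups $\phi,\theta$ commute strongly if $\phi_s$ and $\theta_t$ commute strongly for all $s,t\ge 0$. **Product systems of Hilbert spaces and representations.** A product system over a commutative additive semigroup $\mathcal S$ with unit $0$ is a family $X=\{X(s)\}_{s\in\mathcal S}$ of Hilbert spaces with $X(0)=\mathbb C$ and unitaries $X(s)\otimes X(t)\to X(s+t)$ that are associative and are given by scalar multiplication when $s=0$ or $t=0$; one identifies $X(s)\otimes X(t)$ with $X(s+t)$. A (completely contractive) representation $T$ of $X$ on a Hilbert space $H$ is a family of completely contractive linear maps $T_s:X(s)\to B(H)$ with $T_0(c)=cI$ and $T_{s+t}(x\otimes y)=T_s(x)T_t(y)$. Write $\widetilde T_s:X(s)\otimes H\to H$ for the contraction $\widetilde T_s(x\otimes h)=T_s(x)h$. $T$ is isometric (resp. fully-coisometric) if all $\widetilde T_s$ are isometries (resp. coisometries). An isometric dilation of $T$ is an isometric representation $V$ of $X$ on some $K\supseteq H$ with $P_HV_s(x)|_H=T_s(x)$ and $P_HV_s(x)|_{K\ominus H}=0$ for all $s$, $x\in X(s)$. It is minimal if $K=\bigvee_{s}V_s(X(s))H$. **The Muhly–Solel product system of a CP$_0$-semigroup $\phi$ on $B(H)$.** For $t>0$ and a partition $P=\{0=t_0<t_1<\dots<t_n=t\}$, with $\tau_i=t_i-t_{i-1}$, let $H_P$ be the Hausdorff completion of $B(H)^{\otimes n}\otimes H$ for $\langle a_1\otimes\cdots\otimes a_n\otimes h,\,b_1\otimes\cdots\otimes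 b_n\otimes k\rangle=\langle h,\phi_{\tau_n}(a_n^*\phi_{\tau_{n-1}}(\cdots\phi_{\tau_1}(a_1^*b_1)\cdots)b_n)k\rangle$. $B(H)$ acts on $H_P$ by left multiplication on the first factor. Subdividing the $i$-th interval gives an isometric embedding of $H_P$ into the space of the refined partition by inserting $I$ right after $a_i$. Let $H_t$ be the Hilbert space direct limit over partitions, and $\iota_t:H\to H_t$ the isometry $h\mapsto I\otimes\cdots\otimes I\otimes h$. Put $E(t)=\{X\in B(H,H_t): XA=A\cdot X\ \ \forall A\in B(H)\}$, a Hilbert space with $\langle X,Y\rangle I=X^*Y$, $E(0)=\mathbb C$, with multiplication $E(t)\otimes E(s)\to E(t+s)$, $X\otimes Y\mapsto(I\otimes X)Y$, where $I\otimes X:H_s\to H_{s+t}$ maps $a_1\otimes\cdots\otimes a_n\otimes h$ to $a_1\otimes\cdots\otimes a_n\otimes Xh$. Let $T^E_t(X)=\iota_t^*X$ and $T^E_0(c)=cI$. Then $T^E$ is a fully-coisometric representation of $E$ on $H$ and $\phi_t(A)=\widetilde{T^E_t}(I\otimes A)\widetilde{T^E_t}^{*}$. **The product-system E$_0$-dilation of $(\phi,\theta)$.** Let $(E,T^E)$ and $(F,T^F)$ be the Muhly–Solel product systems and representations of $\phi$ and $\theta$. By strong commutation (known result of Shalit) there is a product system $X$ over $\mathbb R_+^2$ with $X(s,t)=E(s)\otimes F(t)$, whose multiplication restricts to those of $E=\{X(s,0)\}$ and $F=\{X(0,t)\}$, with $X(s,0)\otimes X(0,t)\to X(s,t)$ the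 identity map, and with $X(0,t)\otimes X(s,0)\to X(s,t)$ given by unitaries $F(t)\otimes E(s)\to E(s)\otimes F(t)$ arising from the strong-commutation unitaries, such that $T_{(s,t)}(x\otimes y)=T^E_s(x)T^F_t(y)$ is a fully-coisometric representation of $X$ on $H$. There are also a separable Hilbert space $K\supseteq H$ and an isometric and fully-coisometric representation $V$ of $X$ on $K$ which is a minimal isometric dilation of $T$, such that, with $V^E_t(x)=V_{(t,0)}(x\otimes1)$ for $x\in E(t)$ and $V^F_t(y)=V_{(0,t)}(1\otimes y)$ for $y\in F(t)$, the formulas $$\alpha_t(A)=\widetilde{V^E_t}(I\otimes A)\widetilde{V^E_t}^{*},\qquad \beta_t(A)=\widetilde{V^F_t}(I\otimes A)\widetilde{V^F_t}^{*}\qquad(A\in B(K))$$ define commuting E$_0$-semigroups on $B(K)$ satisfying $\phi_s\circ\theta_t(P_HAP_H)=P_H\,\alpha_s\circ\beta_t(A)\,P_H$ for all $s,t\ge0$, $A\in B(K)$. Fix such $X,V,K$; $\alpha$ and $\beta$ always denote the resulting semigroups. *)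

theory Defs
  imports
    "HOL-Analysis.Analysis"
    "HOL-Library.Function_Algebras"
    "HOL-Library.Poly_Mapping"
begin

section \<open>Complex Hilbert spaces with explicit carriers\<close>

class complex_vector = ab_group_add +
  fixes scaleC :: "complex \<Rightarrow> 'a \<Rightarrow> 'a" (infixr "*\<^sub>C" 75)
  assumes scaleC_add_right: "c *\<^sub>C (x + y) = c *\<^sub>C x + c *\<^sub>C y"
    and scaleC_add_left: "(c + d) *\<^sub>C x = c *\<^sub>C x + d *\<^sub>C x"
    and scaleC_scaleC: "c *\<^sub>C d *\<^sub>C x = (c * d) *\<^sub>C x"
    and scaleC_one: "1 *\<^sub>C x = x"

instantiation complex :: complex_vector
begin
definition "scaleC c (x::complex) = c * x"
instance by standard (simp_all add: scaleC_complex_def algebra_simps)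
end

instantiation "fun" :: (type, complex_vector) complex_vector
begin
definition "scaleC c (f :: 'a \<Rightarrow> 'b) = (\<lambda>x. c *\<^sub>C f x)"
instance
  by standard (simp_all add: scaleC_fun_def fun_eq_iff scaleC_add_right scaleC_add_left
      scaleC_scaleC scaleC_one)
end

text \<open>
  A Hilbert space is a subspace of a complex vector space type with its own inner product, so that
  families of Hilbert spaces can be indexed by elements of a type. Inner products are linear in the
  second variable.
\<close>

record 'a hspace =
  hcarrier :: "'a set"
  hinner :: "'a \<Rightarrow> 'a \<Rightarrow> complex"

definition hnorm :: "'a hspace \<Rightarrow> 'a \<Rightarrow> real" where
  "hnorm H x = sqrt (Re (hinner H x x))"

text \<open>The guard makes \<^const>\<open>Metric_space\<close> applicable: it requires
  non-negativity and symmetry also outside the carrier.\<close>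

definition hdist :: "'a::complex_vector hspace \<Rightarrow> 'a \<Rightarrow> 'a \<Rightarrow> real" where
  "hdist H x y = (if x \<in> hcarrier H \<and> y \<in> hcarrier H then hnorm H (x - y) else 0)"

definition htopology :: "'a::complex_vector hspace \<Rightarrow> 'a topology" where
  "htopology H = Metric_space.mtopology (hcarrier H) (hdist H)"

definition hilbert_space :: "'a::complex_vector hspace \<Rightarrow> bool" where
  "hilbert_space H \<longleftrightarrow>
     module.subspace scaleC (hcarrier H) \<and>
     (\<forall>x\<in>hcarrier H. \<forall>y\<in>hcarrier H. hinner H x y = cnj (hinner H y x)) \<and>
     (\<forall>x\<in>hcarrier H. \<forall>y\<in>hcarrier H. \<forall>z\<in>hcarrier H.
        hinner H x (y + z) = hinner H x y + hinner H x z) \<and>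
     (\<forall>c. \<forall>x\<in>hcarrier H. \<forall>y\<in>hcarrier H. hinner H x (c *\<^sub>C y) = c * hinner H x y) \<and>
     (\<forall>x\<in>hcarrier H. hinner H x x \<in> \<real>\<^sub>\<ge>\<^sub>0) \<and>
     (\<forall>x\<in>hcarrier H. hinner H x x = 0 \<longrightarrow> x = 0) \<and>
     Metric_space.mcomplete (hcarrier H) (hdist H)"

text \<open>
  Operators between carriers are represented by functions that vanish off the domain; these are
  closed under the pointwise vector space operations and under composition.
\<close>

definition bop :: "'a::complex_vector hspace \<Rightarrow> 'b::complex_vector hspace \<Rightarrow> ('a \<Rightarrow> 'b) set" where
  "bop G K = {A.
     A ` hcarrier G \<subseteq> hcarrier K \<and>
     (\<forall>x. x \<notin> hcarrier G \<longrightarrow> A x = 0) \<and>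
     (\<forall>x\<in>hcarrier G. \<forall>y\<in>hcarrier G. A (x + y) = A x + A y) \<and>
     (\<forall>c. \<forall>x\<in>hcarrier G. A (c *\<^sub>C x) = c *\<^sub>C A x) \<and>
     (\<exists>C. \<forall>x\<in>hcarrier G. hnorm K (A x) \<le> C * hnorm G x)}"

abbreviation bops :: "'a::complex_vector hspace \<Rightarrow> ('a \<Rightarrow> 'a) set" where
  "bops H \<equiv> bop H H"

definition op_norm :: "'a::complex_vector hspace \<Rightarrow> 'b::complex_vector hspace \<Rightarrow> ('a \<Rightarrow> 'b) \<Rightarrow> real" where
  "op_norm G K A = Inf {C. 0 \<le> C \<and> (\<forall>x\<in>hcarrier G. hnorm K (A x) \<le> C * hnorm G x)}"

definition hid :: "'a::complex_vector hspace \<Rightarrow> 'a \<Rightarrow> 'a" where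
  "hid H x = (if x \<in> hcarrier H then x else 0)"

definition adj :: "'a::complex_vector hspace \<Rightarrow> 'b::complex_vector hspace \<Rightarrow> ('a \<Rightarrow> 'b) \<Rightarrow> 'b \<Rightarrow> 'a" where
  "adj G K A = (THE B. B \<in> bop K G \<and>
     (\<forall>x\<in>hcarrier G. \<forall>y\<in>hcarrier K. hinner K (A x) y = hinner G x (B y)))"

abbreviation star :: "'a::complex_vector hspace \<Rightarrow> ('a \<Rightarrow> 'a) \<Rightarrow> 'a \<Rightarrow> 'a" where
  "star H \<equiv> adj H H"

definition isometry_op :: "'a::complex_vector hspace \<Rightarrow> 'b::complex_vector hspace \<Rightarrow> ('a \<Rightarrow> 'b) \<Rightarrow> bool" where
  "isometry_op G K A \<longleftrightarrow> A \<in> bop G K \<and> adj G K A \<circ> A = hid G"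

definition coisometry_op :: "'a::complex_vector hspace \<Rightarrow> 'b::complex_vector hspace \<Rightarrow> ('a \<Rightarrow> 'b) \<Rightarrow> bool" where
  "coisometry_op G K A \<longleftrightarrow> A \<in> bop G K \<and> A \<circ> adj G K A = hid K"

definition unitary_op :: "'a::complex_vector hspace \<Rightarrow> 'b::complex_vector hspace \<Rightarrow> ('a \<Rightarrow> 'b) \<Rightarrow> bool" where
  "unitary_op G K A \<longleftrightarrow> isometry_op G K A \<and> coisometry_op G K A"

text \<open>The bounded operator with prescribed values \<open>f i\<close> on a total family of vectors \<open>e i\<close>,
  \<open>i \<in> I\<close>.\<close>

definition extend_op :: "'a::complex_vector hspace \<Rightarrow> 'b::complex_vector hspace \<Rightarrow>
    'i set \<Rightarrow> ('i \<Rightarrow> 'a) \<Rightarrow> ('i \<Rightarrow> 'b) \<Rightarrow> 'a \<Rightarrow> 'b" where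
  "extend_op G K I e f = (THE A. A \<in> bop G K \<and> (\<forall>i\<in>I. A (e i) = f i))"

section \<open>Hausdorff completions\<close>

text \<open>
  Let \<open>k\<close> be a positive semidefinite kernel on \<open>I\<close>. It induces a semi-inner product on the free
  vector space over \<open>I\<close>. If \<open>I\<close> consists of tuples and \<open>k\<close> is multilinear (conjugate multilinear in
  the first tuple), the defining relations of the algebraic tensor product are null vectors, so the
  Hausdorff completion of the free vector space is that of the algebraic tensor product.

  Two Cauchy sequences \<open>s\<close>, \<open>s'\<close> in a semi-inner product space differ by a null sequence iff
  they have the same limits \<open>lim\<^sub>n \<langle>i, s n\<rangle>\<close> for all generators \<open>i\<close>; the class of \<open>s\<close> is therefore
  represented by the function \<open>i \<mapsto> lim\<^sub>n \<langle>i, s n\<rangle>\<close>. This is compatible with the pointwise vector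
  space operations.
\<close>

definition gram :: "('i \<Rightarrow> 'i \<Rightarrow> complex) \<Rightarrow> ('i \<Rightarrow>\<^sub>0 complex) \<Rightarrow> ('i \<Rightarrow>\<^sub>0 complex) \<Rightarrow> complex" where
  "gram k c d = (\<Sum>i\<in>Poly_Mapping.keys c. \<Sum>j\<in>Poly_Mapping.keys d.
      cnj (Poly_Mapping.lookup c i) * Poly_Mapping.lookup d j * k i j)"

definition gram_cauchy :: "'i set \<Rightarrow> ('i \<Rightarrow> 'i \<Rightarrow> complex) \<Rightarrow> (nat \<Rightarrow> 'i \<Rightarrow>\<^sub>0 complex) \<Rightarrow> bool" where
  "gram_cauchy I k s \<longleftrightarrow> (\<forall>n. Poly_Mapping.keys (s n) \<subseteq> I) \<and>
     (\<forall>\<epsilon>>0. \<exists>N. \<forall>m\<ge>N. \<forall>n\<ge>N. sqrt (Re (gram k (s m - s n) (s m - s n))) < \<epsilon>)"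

definition cauchy_class :: "'i set \<Rightarrow> ('i \<Rightarrow> 'i \<Rightarrow> complex) \<Rightarrow> (nat \<Rightarrow> 'i \<Rightarrow>\<^sub>0 complex) \<Rightarrow> 'i \<Rightarrow> complex" where
  "cauchy_class I k s =
     (\<lambda>i. if i \<in> I then lim (\<lambda>n. gram k (Poly_Mapping.single i 1) (s n)) else 0)"

definition cauchy_rep :: "'i set \<Rightarrow> ('i \<Rightarrow> 'i \<Rightarrow> complex) \<Rightarrow> ('i \<Rightarrow> complex) \<Rightarrow> nat \<Rightarrow> 'i \<Rightarrow>\<^sub>0 complex" where
  "cauchy_rep I k f = (SOME s. gram_cauchy I k s \<and> cauchy_class I k s = f)"

definition completion :: "'i set \<Rightarrow> ('i \<Rightarrow> 'i \<Rightarrow> complex) \<Rightarrow> ('i \<Rightarrow> complex) hspace" where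
  "completion I k =
     \<lparr>hcarrier = cauchy_class I k ` {s. gram_cauchy I k s},
      hinner = (\<lambda>f g. lim (\<lambda>n. gram k (cauchy_rep I k f n) (cauchy_rep I k g n)))\<rparr>"

definition gen :: "'i set \<Rightarrow> ('i \<Rightarrow> 'i \<Rightarrow> complex) \<Rightarrow> 'i \<Rightarrow> 'i \<Rightarrow> complex" where
  "gen I k i = cauchy_class I k (\<lambda>_. Poly_Mapping.single i 1)"

definition tensor_kernel :: "'a hspace \<Rightarrow> 'b hspace \<Rightarrow> 'a \<times> 'b \<Rightarrow> 'a \<times> 'b \<Rightarrow> complex" where
  "tensor_kernel G K = (\<lambda>(x, y) (x', y'). hinner G x x' * hinner K y y')"

definition tensor :: "'a hspace \<Rightarrow> 'b hspace \<Rightarrow> ('a \<times> 'b \<Rightarrow> complex) hspace" where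
  "tensor G K = completion (hcarrier G \<times> hcarrier K) (tensor_kernel G K)"

definition tens :: "'a hspace \<Rightarrow> 'b hspace \<Rightarrow> 'a \<Rightarrow> 'b \<Rightarrow> 'a \<times> 'b \<Rightarrow> complex" where
  "tens G K x y = gen (hcarrier G \<times> hcarrier K) (tensor_kernel G K) (x, y)"

section \<open>Maps and semigroups on \<open>B(H)\<close>\<close>

definition linear_on_bops :: "'a::complex_vector hspace \<Rightarrow> (('a \<Rightarrow> 'a) \<Rightarrow> 'a \<Rightarrow> 'a) \<Rightarrow> bool" where
  "linear_on_bops H \<Phi> \<longleftrightarrow> \<Phi> ` bops H \<subseteq> bops H \<and>
     (\<forall>A\<in>bops H. \<forall>B\<in>bops H. \<Phi> (A + B) = \<Phi> A + \<Phi> B) \<and>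
     (\<forall>c. \<forall>A\<in>bops H. \<Phi> (c *\<^sub>C A) = c *\<^sub>C \<Phi> A)"

definition positive_matrix :: "'a::complex_vector hspace \<Rightarrow> nat \<Rightarrow> (nat \<Rightarrow> nat \<Rightarrow> 'a \<Rightarrow> 'a) \<Rightarrow> bool" where
  "positive_matrix H n A \<longleftrightarrow>
     (\<forall>i<n. \<forall>j<n. A i j \<in> bops H) \<and>
     (\<forall>h. (\<forall>i<n. h i \<in> hcarrier H) \<longrightarrow>
        (\<Sum>i<n. \<Sum>j<n. hinner H (h i) (A i j (h j))) \<in> \<real>\<^sub>\<ge>\<^sub>0)"

definition completely_positive :: "'a::complex_vector hspace \<Rightarrow> (('a \<Rightarrow> 'a) \<Rightarrow> 'a \<Rightarrow> 'a) \<Rightarrow> bool" where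
  "completely_positive H \<Phi> \<longleftrightarrow>
     (\<forall>n A. positive_matrix H n A \<longrightarrow> positive_matrix H n (\<lambda>i j. \<Phi> (A i j)))"

definition self_adjoint :: "'a::complex_vector hspace \<Rightarrow> ('a \<Rightarrow> 'a) \<Rightarrow> bool" where
  "self_adjoint H A \<longleftrightarrow> A \<in> bops H \<and> star H A = A"

definition op_le :: "'a::complex_vector hspace \<Rightarrow> ('a \<Rightarrow> 'a) \<Rightarrow> ('a \<Rightarrow> 'a) \<Rightarrow> bool" where
  "op_le H A B \<longleftrightarrow> (\<forall>x\<in>hcarrier H. hinner H x ((B - A) x) \<in> \<real>\<^sub>\<ge>\<^sub>0)"

definition op_lub :: "'a::complex_vector hspace \<Rightarrow> ('a \<Rightarrow> 'a) set \<Rightarrow> ('a \<Rightarrow> 'a) \<Rightarrow> bool" where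
  "op_lub H D S \<longleftrightarrow> self_adjoint H S \<and> (\<forall>A\<in>D. op_le H A S) \<and>
     (\<forall>B. self_adjoint H B \<and> (\<forall>A\<in>D. op_le H A B) \<longrightarrow> op_le H S B)"

definition normal_map :: "'a::complex_vector hspace \<Rightarrow> (('a \<Rightarrow> 'a) \<Rightarrow> 'a \<Rightarrow> 'a) \<Rightarrow> bool" where
  "normal_map H \<Phi> \<longleftrightarrow>
     (\<forall>D S. D \<noteq> {} \<and> D \<subseteq> Collect (self_adjoint H) \<and>
        (\<forall>A\<in>D. \<forall>B\<in>D. \<exists>C\<in>D. op_le H A C \<and> op_le H B C) \<and> op_lub H D S
        \<longrightarrow> op_lub H (\<Phi> ` D) (\<Phi> S))"

definition cp_map :: "'a::complex_vector hspace \<Rightarrow> (('a \<Rightarrow> 'a) \<Rightarrow> 'a \<Rightarrow> 'a) \<Rightarrow> bool" where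
  "cp_map H \<Phi> \<longleftrightarrow> linear_on_bops H \<Phi> \<and> completely_positive H \<Phi> \<and> normal_map H \<Phi> \<and>
     \<Phi> (hid H) = hid H"

definition contractive_map :: "'a::complex_vector hspace \<Rightarrow> (('a \<Rightarrow> 'a) \<Rightarrow> 'a \<Rightarrow> 'a) \<Rightarrow> bool" where
  "contractive_map H \<Phi> \<longleftrightarrow> (\<forall>A\<in>bops H. op_norm H H (\<Phi> A) \<le> op_norm H H A)"

definition cp0_semigroup :: "'a::complex_vector hspace \<Rightarrow> (real \<Rightarrow> ('a \<Rightarrow> 'a) \<Rightarrow> 'a \<Rightarrow> 'a) \<Rightarrow> bool" where
  "cp0_semigroup H \<phi> \<longleftrightarrow>
     (\<forall>t\<ge>0. cp_map H (\<phi> t) \<and> contractive_map H (\<phi> t)) \<and>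
     (\<forall>A\<in>bops H. \<phi> 0 A = A) \<and>
     (\<forall>s\<ge>0. \<forall>t\<ge>0. \<forall>A\<in>bops H. \<phi> (s + t) A = \<phi> s (\<phi> t A)) \<and>
     (\<forall>A\<in>bops H. \<forall>h\<in>hcarrier H. \<forall>g\<in>hcarrier H.
        continuous_on {0..} (\<lambda>t. hinner H (\<phi> t A h) g))"

definition star_endomorphism :: "'a::complex_vector hspace \<Rightarrow> (('a \<Rightarrow> 'a) \<Rightarrow> 'a \<Rightarrow> 'a) \<Rightarrow> bool" where
  "star_endomorphism H \<Phi> \<longleftrightarrow> linear_on_bops H \<Phi> \<and>
     (\<forall>A\<in>bops H. \<forall>B\<in>bops H. \<Phi> (A \<circ> B) = \<Phi> A \<circ> \<Phi> B) \<and>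
     (\<forall>A\<in>bops H. \<Phi> (star H A) = star H (\<Phi> A))"

definition star_automorphism :: "'a::complex_vector hspace \<Rightarrow> (('a \<Rightarrow> 'a) \<Rightarrow> 'a \<Rightarrow> 'a) \<Rightarrow> bool" where
  "star_automorphism H \<Phi> \<longleftrightarrow> star_endomorphism H \<Phi> \<and> bij_betw \<Phi> (bops H) (bops H)"

definition e0_semigroup :: "'a::complex_vector hspace \<Rightarrow> (real \<Rightarrow> ('a \<Rightarrow> 'a) \<Rightarrow> 'a \<Rightarrow> 'a) \<Rightarrow> bool" where
  "e0_semigroup H \<phi> \<longleftrightarrow> cp0_semigroup H \<phi> \<and> (\<forall>t\<ge>0. star_endomorphism H (\<phi> t))"

section \<open>Strong commutation\<close>

text \<open>\<open>tens2 H \<Phi>\<close> is \<open>B(H) \<otimes>\<^sub>\<Phi> H\<close> and \<open>tens3 H \<Phi> \<Theta>\<close> is \<open>B(H) \<otimes>\<^sub>\<Phi> B(H) \<otimes>\<^sub>\<Theta> H\<close>.\<close>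

type_synonym 'a tens2_vec = "('a \<Rightarrow> 'a) \<times> 'a \<Rightarrow> complex"
type_synonym 'a tens3_vec = "('a \<Rightarrow> 'a) \<times> ('a \<Rightarrow> 'a) \<times> 'a \<Rightarrow> complex"

abbreviation idx2 :: "'a::complex_vector hspace \<Rightarrow> (('a \<Rightarrow> 'a) \<times> 'a) set" where
  "idx2 H \<equiv> bops H \<times> hcarrier H"

abbreviation idx3 :: "'a::complex_vector hspace \<Rightarrow> (('a \<Rightarrow> 'a) \<times> ('a \<Rightarrow> 'a) \<times> 'a) set" where
  "idx3 H \<equiv> bops H \<times> bops H \<times> hcarrier H"

definition kernel2 :: "'a::complex_vector hspace \<Rightarrow> (('a \<Rightarrow> 'a) \<Rightarrow> 'a \<Rightarrow> 'a) \<Rightarrow>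
    (('a \<Rightarrow> 'a) \<times> 'a) \<Rightarrow> (('a \<Rightarrow> 'a) \<times> 'a) \<Rightarrow> complex" where
  "kernel2 H \<Phi> = (\<lambda>(a, h) (b, k). hinner H h (\<Phi> (star H a \<circ> b) k))"

definition kernel3 :: "'a::complex_vector hspace \<Rightarrow> (('a \<Rightarrow> 'a) \<Rightarrow> 'a \<Rightarrow> 'a) \<Rightarrow>
    (('a \<Rightarrow> 'a) \<Rightarrow> 'a \<Rightarrow> 'a) \<Rightarrow>
    (('a \<Rightarrow> 'a) \<times> ('a \<Rightarrow> 'a) \<times> 'a) \<Rightarrow> (('a \<Rightarrow> 'a) \<times> ('a \<Rightarrow> 'a) \<times> 'a) \<Rightarrow> complex" where
  "kernel3 H \<Phi> \<Theta> = (\<lambda>(a, b, h) (c, d, k).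
     hinner H h (\<Theta> (star H b \<circ> \<Phi> (star H a \<circ> c) \<circ> d) k))"

definition tens2 where "tens2 H \<Phi> = completion (idx2 H) (kernel2 H \<Phi>)"

definition elem2 where "elem2 H \<Phi> a h = gen (idx2 H) (kernel2 H \<Phi>) (a, h)"

definition tens3 where "tens3 H \<Phi> \<Theta> = completion (idx3 H) (kernel3 H \<Phi> \<Theta>)"

definition elem3 where "elem3 H \<Phi> \<Theta> a b h = gen (idx3 H) (kernel3 H \<Phi> \<Theta>) (a, b, h)"

definition left_act2 :: "'a::complex_vector hspace \<Rightarrow> (('a \<Rightarrow> 'a) \<Rightarrow> 'a \<Rightarrow> 'a) \<Rightarrow>
    ('a \<Rightarrow> 'a) \<Rightarrow> 'a tens2_vec \<Rightarrow> 'a tens2_vec" where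
  "left_act2 H \<Phi> c = extend_op (tens2 H \<Phi>) (tens2 H \<Phi>) (idx2 H)
     (\<lambda>(a, h). elem2 H \<Phi> a h) (\<lambda>(a, h). elem2 H \<Phi> (c \<circ> a) h)"

definition left_act3 :: "'a::complex_vector hspace \<Rightarrow> (('a \<Rightarrow> 'a) \<Rightarrow> 'a \<Rightarrow> 'a) \<Rightarrow>
    (('a \<Rightarrow> 'a) \<Rightarrow> 'a \<Rightarrow> 'a) \<Rightarrow> ('a \<Rightarrow> 'a) \<Rightarrow> 'a tens3_vec \<Rightarrow> 'a tens3_vec" where
  "left_act3 H \<Phi> \<Theta> c = extend_op (tens3 H \<Phi> \<Theta>) (tens3 H \<Phi> \<Theta>) (idx3 H)
     (\<lambda>(a, b, h). elem3 H \<Phi> \<Theta> a b h) (\<lambda>(a, b, h). elem3 H \<Phi> \<Theta> (c \<circ> a) b h)"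

definition commutation_unitary :: "'a::complex_vector hspace \<Rightarrow> (('a \<Rightarrow> 'a) \<Rightarrow> 'a \<Rightarrow> 'a) \<Rightarrow>
    (('a \<Rightarrow> 'a) \<Rightarrow> 'a \<Rightarrow> 'a) \<Rightarrow> ('a tens3_vec \<Rightarrow> 'a tens3_vec) \<Rightarrow> bool" where
  "commutation_unitary H \<Phi> \<Theta> u \<longleftrightarrow>
     unitary_op (tens3 H \<Phi> \<Theta>) (tens3 H \<Theta> \<Phi>) u \<and>
     (\<forall>a\<in>bops H. \<forall>h\<in>hcarrier H. u (elem3 H \<Phi> \<Theta> a (hid H) h) = elem3 H \<Theta> \<Phi> a (hid H) h) \<and>
     (\<forall>a\<in>bops H. \<forall>b\<in>bops H. \<forall>c\<in>bops H. \<forall>h\<in>hcarrier H.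
        u (elem3 H \<Phi> \<Theta> (c \<circ> a) b h) = left_act3 H \<Theta> \<Phi> c (u (elem3 H \<Phi> \<Theta> a b h)))"

definition strongly_commuting_maps :: "'a::complex_vector hspace \<Rightarrow> (('a \<Rightarrow> 'a) \<Rightarrow> 'a \<Rightarrow> 'a) \<Rightarrow>
    (('a \<Rightarrow> 'a) \<Rightarrow> 'a \<Rightarrow> 'a) \<Rightarrow> bool" where
  "strongly_commuting_maps H \<Phi> \<Theta> \<longleftrightarrow>
     (\<forall>A\<in>bops H. \<Phi> (\<Theta> A) = \<Theta> (\<Phi> A)) \<and> (\<exists>u. commutation_unitary H \<Phi> \<Theta> u)"

definition strongly_commuting :: "'a::complex_vector hspace \<Rightarrow>
    (real \<Rightarrow> ('a \<Rightarrow> 'a) \<Rightarrow> 'a \<Rightarrow> 'a) \<Rightarrow> (real \<Rightarrow> ('a \<Rightarrow> 'a) \<Rightarrow> 'a \<Rightarrow> 'a) \<Rightarrow> bool" where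
  "strongly_commuting H \<phi> \<theta> \<longleftrightarrow>
     (\<forall>s\<ge>0. \<forall>t\<ge>0. strongly_commuting_maps H (\<phi> s) (\<theta> t))"

section \<open>Product systems of Hilbert spaces and their representations\<close>

text \<open>The identification \<open>X(0) = \<complex>\<close> is given by a unit vector \<open>e\<close>, that is \<open>c \<in> \<complex>\<close> is \<open>c *\<^sub>C e\<close>.\<close>

definition product_system :: "'s::comm_monoid_add set \<Rightarrow> ('s \<Rightarrow> 'x::complex_vector hspace) \<Rightarrow>
    ('s \<Rightarrow> 's \<Rightarrow> 'x \<Rightarrow> 'x \<Rightarrow> 'x) \<Rightarrow> 'x \<Rightarrow> bool" where
  "product_system S X m e \<longleftrightarrow>
     0 \<in> S \<and> (\<forall>s\<in>S. \<forall>t\<in>S. s + t \<in> S) \<and>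
     (\<forall>s\<in>S. hilbert_space (X s)) \<and>
     hcarrier (X 0) = range (\<lambda>c. c *\<^sub>C e) \<and> hinner (X 0) e e = 1 \<and>
     (\<forall>s\<in>S. \<forall>t\<in>S. \<exists>U. unitary_op (tensor (X s) (X t)) (X (s + t)) U \<and>
        (\<forall>x\<in>hcarrier (X s). \<forall>y\<in>hcarrier (X t). U (tens (X s) (X t) x y) = m s t x y)) \<and>
     (\<forall>s\<in>S. \<forall>t\<in>S. \<forall>r\<in>S.
        \<forall>x\<in>hcarrier (X s). \<forall>y\<in>hcarrier (X t). \<forall>z\<in>hcarrier (X r).
          m (s + t) r (m s t x y) z = m s (t + r) x (m t r y z)) \<and>
     (\<forall>t\<in>S. \<forall>y\<in>hcarrier (X t). \<forall>c. m 0 t (c *\<^sub>C e) y = c *\<^sub>C y \<and> m t 0 y (c *\<^sub>C e) = c *\<^sub>C y)"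

text \<open>
  A Hilbert space \<open>G\<close> carries the column operator space structure \<open>G = B(\<complex>, G)\<close>: the norm of a
  matrix \<open>x\<close> over \<open>G\<close> is its norm as an operator \<open>\<complex>\<^sup>n \<rightarrow> G\<^sup>n\<close>. A matrix over \<open>B(H)\<close> is
  normed as an operator \<open>H\<^sup>n \<rightarrow> H\<^sup>n\<close>.
\<close>

definition completely_contractive :: "'x::complex_vector hspace \<Rightarrow> 'a::complex_vector hspace \<Rightarrow>
    ('x \<Rightarrow> 'a \<Rightarrow> 'a) \<Rightarrow> bool" where
  "completely_contractive G H T \<longleftrightarrow>
     (\<forall>(n::nat) (x :: nat \<Rightarrow> nat \<Rightarrow> 'x) C. 0 \<le> C \<and> (\<forall>i<n. \<forall>j<n. x i j \<in> hcarrier G) \<and>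
        (\<forall>v. (\<Sum>i<n. (hnorm G (\<Sum>j<n. v j *\<^sub>C x i j))\<^sup>2) \<le> C\<^sup>2 * (\<Sum>j<n. (cmod (v j))\<^sup>2))
        \<longrightarrow>
        (\<forall>h. (\<forall>j<n. h j \<in> hcarrier H) \<longrightarrow>
           (\<Sum>i<n. (hnorm H (\<Sum>j<n. T (x i j) (h j)))\<^sup>2) \<le> C\<^sup>2 * (\<Sum>j<n. (hnorm H (h j))\<^sup>2)))"

definition representation :: "'s::comm_monoid_add set \<Rightarrow> ('s \<Rightarrow> 'x::complex_vector hspace) \<Rightarrow>
    ('s \<Rightarrow> 's \<Rightarrow> 'x \<Rightarrow> 'x \<Rightarrow> 'x) \<Rightarrow> 'x \<Rightarrow> 'a::complex_vector hspace \<Rightarrow>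
    ('s \<Rightarrow> 'x \<Rightarrow> 'a \<Rightarrow> 'a) \<Rightarrow> bool" where
  "representation S X m e H T \<longleftrightarrow>
     (\<forall>s\<in>S. T s ` hcarrier (X s) \<subseteq> bops H \<and>
        (\<forall>x\<in>hcarrier (X s). \<forall>y\<in>hcarrier (X s). T s (x + y) = T s x + T s y) \<and>
        (\<forall>c. \<forall>x\<in>hcarrier (X s). T s (c *\<^sub>C x) = c *\<^sub>C T s x) \<and>
        completely_contractive (X s) H (T s)) \<and>
     (\<forall>c. T 0 (c *\<^sub>C e) = c *\<^sub>C hid H) \<and>
     (\<forall>s\<in>S. \<forall>t\<in>S. \<forall>x\<in>hcarrier (X s). \<forall>y\<in>hcarrier (X t).
        T (s + t) (m s t x y) = T s x \<circ> T t y)"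

definition tilde :: "'x::complex_vector hspace \<Rightarrow> 'a::complex_vector hspace \<Rightarrow> ('x \<Rightarrow> 'a \<Rightarrow> 'a) \<Rightarrow>
    ('x \<times> 'a \<Rightarrow> complex) \<Rightarrow> 'a" where
  "tilde G H T = extend_op (tensor G H) H (hcarrier G \<times> hcarrier H)
     (\<lambda>(x, h). tens G H x h) (\<lambda>(x, h). T x h)"

definition isometric_rep where
  "isometric_rep S X H T \<longleftrightarrow> (\<forall>s\<in>S. isometry_op (tensor (X s) H) H (tilde (X s) H (T s)))"

definition fully_coisometric_rep where
  "fully_coisometric_rep S X H T \<longleftrightarrow>
     (\<forall>s\<in>S. coisometry_op (tensor (X s) H) H (tilde (X s) H (T s)))"

definition amplify :: "'x::complex_vector hspace \<Rightarrow> 'a::complex_vector hspace \<Rightarrow> ('a \<Rightarrow> 'a) \<Rightarrow>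
    ('x \<times> 'a \<Rightarrow> complex) \<Rightarrow> 'x \<times> 'a \<Rightarrow> complex" where
  "amplify G H A = extend_op (tensor G H) (tensor G H) (hcarrier G \<times> hcarrier H)
     (\<lambda>(x, h). tens G H x h) (\<lambda>(x, h). tens G H x (A h))"

definition induced_map :: "'x::complex_vector hspace \<Rightarrow> 'a::complex_vector hspace \<Rightarrow>
    ('x \<Rightarrow> 'a \<Rightarrow> 'a) \<Rightarrow> ('a \<Rightarrow> 'a) \<Rightarrow> 'a \<Rightarrow> 'a" where
  "induced_map G H T A = tilde G H T \<circ> amplify G H A \<circ> adj (tensor G H) H (tilde G H T)"

definition hsubspace :: "'a hspace \<Rightarrow> 'a hspace \<Rightarrow> bool" where
  "hsubspace H K \<longleftrightarrow> hcarrier H \<subseteq> hcarrier K \<and>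
     (\<forall>x\<in>hcarrier H. \<forall>y\<in>hcarrier H. hinner H x y = hinner K x y)"

text \<open>For \<open>H \<subseteq> K\<close> the inclusion is \<^term>\<open>hid H\<close>, and the projection onto \<open>H\<close>, regarded as an
  operator from \<open>K\<close> to \<open>H\<close>, is its adjoint.\<close>

definition proj :: "'a::complex_vector hspace \<Rightarrow> 'a hspace \<Rightarrow> 'a \<Rightarrow> 'a" where
  "proj H K = adj H K (hid H)"

definition compress :: "'a::complex_vector hspace \<Rightarrow> 'a hspace \<Rightarrow> ('a \<Rightarrow> 'a) \<Rightarrow> 'a \<Rightarrow> 'a" where
  "compress H K A = proj H K \<circ> A \<circ> hid H"

definition isometric_dilation :: "'s::comm_monoid_add set \<Rightarrow> ('s \<Rightarrow> 'x::complex_vector hspace) \<Rightarrow>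
    ('s \<Rightarrow> 's \<Rightarrow> 'x \<Rightarrow> 'x \<Rightarrow> 'x) \<Rightarrow> 'x \<Rightarrow> 'a::complex_vector hspace \<Rightarrow>
    ('s \<Rightarrow> 'x \<Rightarrow> 'a \<Rightarrow> 'a) \<Rightarrow> 'a hspace \<Rightarrow> ('s \<Rightarrow> 'x \<Rightarrow> 'a \<Rightarrow> 'a) \<Rightarrow> bool" where
  "isometric_dilation S X m e H T K V \<longleftrightarrow>
     hsubspace H K \<and> representation S X m e K V \<and> isometric_rep S X K V \<and>
     (\<forall>s\<in>S. \<forall>x\<in>hcarrier (X s).
        compress H K (V s x) = T s x \<and>
        (\<forall>k\<in>hcarrier K. (\<forall>h\<in>hcarrier H. hinner K h k = 0) \<longrightarrow> proj H K (V s x k) = 0))"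

definition minimal_dilation :: "'s set \<Rightarrow> ('s \<Rightarrow> 'x hspace) \<Rightarrow> 'a::complex_vector hspace \<Rightarrow>
    'a hspace \<Rightarrow> ('s \<Rightarrow> 'x \<Rightarrow> 'a \<Rightarrow> 'a) \<Rightarrow> bool" where
  "minimal_dilation S X H K V \<longleftrightarrow>
     htopology K closure_of
       (module.span scaleC {V s x h |s x h. s \<in> S \<and> x \<in> hcarrier (X s) \<and> h \<in> hcarrier H})
     = hcarrier K"

section \<open>The Muhly--Solel product system of a semigroup on \<open>B(H)\<close>\<close>

text \<open>
  A partition of \<open>[0,t]\<close> is the finite set of its points. An elementary tensor
  \<open>a\<^sub>1 \<otimes> \<dots> \<otimes> a\<^sub>n \<otimes> h\<close> over \<open>0 = t\<^sub>0 < \<dots> < t\<^sub>n = t\<close> is a pair \<open>(a, h)\<close>, where \<open>a\<close> maps the left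
  endpoint \<open>t\<^sub>i\<^sub>-\<^sub>1\<close> to \<open>a\<^sub>i\<close> and every other real number to the identity. Thus inserting \<open>I\<close>
  right after \<open>a\<^sub>i\<close> when the \<open>i\<close>-th interval is subdivided leaves the pair \<open>(a, h)\<close> unchanged.
\<close>

definition partitions :: "real \<Rightarrow> real set set" where
  "partitions t = {P. finite P \<and> {0, t} \<subseteq> P \<and> P \<subseteq> {0..t}}"

type_synonym 'a ms_idx = "(real \<Rightarrow> 'a \<Rightarrow> 'a) \<times> 'a"
type_synonym 'a ms_part_vec = "'a ms_idx \<Rightarrow> complex"
type_synonym 'a ms_vec = "real set \<times> 'a ms_part_vec \<Rightarrow> complex"

definition ms_idx :: "'a::complex_vector hspace \<Rightarrow> real \<Rightarrow> real set \<Rightarrow> 'a ms_idx set" where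
  "ms_idx H t P = {(a, h). h \<in> hcarrier H \<and>
     (\<forall>r\<in>P - {t}. a r \<in> bops H) \<and> (\<forall>r. r \<notin> P - {t} \<longrightarrow> a r = hid H)}"

fun ms_nest :: "'a::complex_vector hspace \<Rightarrow> (real \<Rightarrow> ('a \<Rightarrow> 'a) \<Rightarrow> 'a \<Rightarrow> 'a) \<Rightarrow>
    (real \<Rightarrow> 'a \<Rightarrow> 'a) \<Rightarrow> (real \<Rightarrow> 'a \<Rightarrow> 'a) \<Rightarrow> real list \<Rightarrow> ('a \<Rightarrow> 'a) \<Rightarrow> 'a \<Rightarrow> 'a" where
  "ms_nest H \<phi> a b (p # q # ps) C =
     ms_nest H \<phi> a b (q # ps) (\<phi> (q - p) (star H (a p) \<circ> C \<circ> b p))"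
| "ms_nest H \<phi> a b _ C = C"

definition ms_kernel :: "'a::complex_vector hspace \<Rightarrow> (real \<Rightarrow> ('a \<Rightarrow> 'a) \<Rightarrow> 'a \<Rightarrow> 'a) \<Rightarrow>
    real set \<Rightarrow> 'a ms_idx \<Rightarrow> 'a ms_idx \<Rightarrow> complex" where
  "ms_kernel H \<phi> P = (\<lambda>(a, h) (b, k).
     hinner H h (ms_nest H \<phi> a b (sorted_list_of_set P) (hid H) k))"

definition ms_part_space :: "'a::complex_vector hspace \<Rightarrow> (real \<Rightarrow> ('a \<Rightarrow> 'a) \<Rightarrow> 'a \<Rightarrow> 'a) \<Rightarrow>
    real \<Rightarrow> real set \<Rightarrow> 'a ms_part_vec hspace" where
  "ms_part_space H \<phi> t P = completion (ms_idx H t P) (ms_kernel H \<phi> P)"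

definition ms_part_elem :: "'a::complex_vector hspace \<Rightarrow> (real \<Rightarrow> ('a \<Rightarrow> 'a) \<Rightarrow> 'a \<Rightarrow> 'a) \<Rightarrow>
    real \<Rightarrow> real set \<Rightarrow> 'a ms_idx \<Rightarrow> 'a ms_part_vec" where
  "ms_part_elem H \<phi> t P = gen (ms_idx H t P) (ms_kernel H \<phi> P)"

definition ms_refine :: "'a::complex_vector hspace \<Rightarrow> (real \<Rightarrow> ('a \<Rightarrow> 'a) \<Rightarrow> 'a \<Rightarrow> 'a) \<Rightarrow>
    real \<Rightarrow> real set \<Rightarrow> real set \<Rightarrow> 'a ms_part_vec \<Rightarrow> 'a ms_part_vec" where
  "ms_refine H \<phi> t P Q = extend_op (ms_part_space H \<phi> t P) (ms_part_space H \<phi> t Q)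
     (ms_idx H t P) (ms_part_elem H \<phi> t P) (ms_part_elem H \<phi> t Q)"

text \<open>The direct limit is the Hausdorff completion of the disjoint union of the spaces of all
  partitions, where inner products are computed in a common refinement.\<close>

definition ms_lim_idx :: "'a::complex_vector hspace \<Rightarrow> (real \<Rightarrow> ('a \<Rightarrow> 'a) \<Rightarrow> 'a \<Rightarrow> 'a) \<Rightarrow>
    real \<Rightarrow> (real set \<times> 'a ms_part_vec) set" where
  "ms_lim_idx H \<phi> t = (SIGMA P:partitions t. hcarrier (ms_part_space H \<phi> t P))"

definition ms_lim_kernel :: "'a::complex_vector hspace \<Rightarrow> (real \<Rightarrow> ('a \<Rightarrow> 'a) \<Rightarrow> 'a \<Rightarrow> 'a) \<Rightarrow>
    real \<Rightarrow> real set \<times> 'a ms_part_vec \<Rightarrow> real set \<times> 'a ms_part_vec \<Rightarrow> complex" where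
  "ms_lim_kernel H \<phi> t = (\<lambda>(P, x) (Q, y).
     hinner (ms_part_space H \<phi> t (P \<union> Q))
       (ms_refine H \<phi> t P (P \<union> Q) x) (ms_refine H \<phi> t Q (P \<union> Q) y))"

definition ms_space :: "'a::complex_vector hspace \<Rightarrow> (real \<Rightarrow> ('a \<Rightarrow> 'a) \<Rightarrow> 'a \<Rightarrow> 'a) \<Rightarrow>
    real \<Rightarrow> 'a ms_vec hspace" where
  "ms_space H \<phi> t = completion (ms_lim_idx H \<phi> t) (ms_lim_kernel H \<phi> t)"

definition ms_elem :: "'a::complex_vector hspace \<Rightarrow> (real \<Rightarrow> ('a \<Rightarrow> 'a) \<Rightarrow> 'a \<Rightarrow> 'a) \<Rightarrow>
    real \<Rightarrow> real set \<Rightarrow> 'a ms_idx \<Rightarrow> 'a ms_vec" where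
  "ms_elem H \<phi> t P i =
     gen (ms_lim_idx H \<phi> t) (ms_lim_kernel H \<phi> t) (P, ms_part_elem H \<phi> t P i)"

definition ms_extend :: "'a::complex_vector hspace \<Rightarrow> (real \<Rightarrow> ('a \<Rightarrow> 'a) \<Rightarrow> 'a \<Rightarrow> 'a) \<Rightarrow>
    real \<Rightarrow> 'b::complex_vector hspace \<Rightarrow> (real set \<Rightarrow> (real \<Rightarrow> 'a \<Rightarrow> 'a) \<Rightarrow> 'a \<Rightarrow> 'b) \<Rightarrow>
    'a ms_vec \<Rightarrow> 'b" where
  "ms_extend H \<phi> t G f = extend_op (ms_space H \<phi> t) G
     (SIGMA P:partitions t. ms_idx H t P)
     (\<lambda>(P, a, h). ms_elem H \<phi> t P (a, h)) (\<lambda>(P, a, h). f P a h)"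

definition ms_act :: "'a::complex_vector hspace \<Rightarrow> (real \<Rightarrow> ('a \<Rightarrow> 'a) \<Rightarrow> 'a \<Rightarrow> 'a) \<Rightarrow>
    real \<Rightarrow> ('a \<Rightarrow> 'a) \<Rightarrow> 'a ms_vec \<Rightarrow> 'a ms_vec" where
  "ms_act H \<phi> t A = ms_extend H \<phi> t (ms_space H \<phi> t)
     (\<lambda>P a h. ms_elem H \<phi> t P (a(0 := A \<circ> a 0), h))"

definition ms_iota :: "'a::complex_vector hspace \<Rightarrow> (real \<Rightarrow> ('a \<Rightarrow> 'a) \<Rightarrow> 'a \<Rightarrow> 'a) \<Rightarrow>
    real \<Rightarrow> 'a \<Rightarrow> 'a ms_vec" where
  "ms_iota H \<phi> t h = (if h \<in> hcarrier H then ms_elem H \<phi> t {0, t} (\<lambda>_. hid H, h) else 0)"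

text \<open>\<open>E(0) = \<complex>\<close> is realised inside the type of the other fibres by the constant functions.\<close>

definition ms_scalar :: "complex \<Rightarrow> 'a \<Rightarrow> 'a ms_vec" where
  "ms_scalar c = (\<lambda>_ _. c)"

definition ms_scalar_val :: "('a \<Rightarrow> 'a ms_vec) \<Rightarrow> complex" where
  "ms_scalar_val X = (THE c. X = ms_scalar c)"

text \<open>For \<open>H = 0\<close> the relation \<open>X\<^sup>*Y = \<langle>X,Y\<rangle>I\<close> does not determine the inner product, which is
  then \<open>0\<close>.\<close>

definition ms_fibre :: "'a::complex_vector hspace \<Rightarrow> (real \<Rightarrow> ('a \<Rightarrow> 'a) \<Rightarrow> 'a \<Rightarrow> 'a) \<Rightarrow>
    real \<Rightarrow> ('a \<Rightarrow> 'a ms_vec) hspace" where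
  "ms_fibre H \<phi> t =
     (if t = 0 then
        \<lparr>hcarrier = range ms_scalar,
         hinner = (\<lambda>X Y. cnj (ms_scalar_val X) * ms_scalar_val Y)\<rparr>
      else
        \<lparr>hcarrier = {X \<in> bop H (ms_space H \<phi> t). \<forall>A\<in>bops H. X \<circ> A = ms_act H \<phi> t A \<circ> X},
         hinner = (\<lambda>X Y. if hcarrier H = {0} then 0
           else THE c. adj H (ms_space H \<phi> t) X \<circ> Y = c *\<^sub>C hid H)\<rparr>)"

text \<open>\<open>ms_prepend H \<phi> s t P a\<close> maps \<open>b\<^sub>1 \<otimes> \<dots> \<otimes> b\<^sub>m \<otimes> g\<close> in \<open>H\<^sub>t\<close> to
  \<open>a\<^sub>1 \<otimes> \<dots> \<otimes> a\<^sub>n \<otimes> b\<^sub>1 \<otimes> \<dots> \<otimes> b\<^sub>m \<otimes> g\<close> in \<open>H\<^sub>s\<^sub>+\<^sub>t\<close>, where \<open>P\<close> partitions \<open>[0,s]\<close>.\<close>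

definition ms_prepend :: "'a::complex_vector hspace \<Rightarrow> (real \<Rightarrow> ('a \<Rightarrow> 'a) \<Rightarrow> 'a \<Rightarrow> 'a) \<Rightarrow>
    real \<Rightarrow> real \<Rightarrow> real set \<Rightarrow> (real \<Rightarrow> 'a \<Rightarrow> 'a) \<Rightarrow> 'a ms_vec \<Rightarrow> 'a ms_vec" where
  "ms_prepend H \<phi> s t P a = ms_extend H \<phi> t (ms_space H \<phi> (s + t))
     (\<lambda>Q b g. ms_elem H \<phi> (s + t) (P \<union> (\<lambda>r. s + r) ` Q)
        (\<lambda>r. if r < s then a r else b (r - s), g))"

definition ms_tensor_left :: "'a::complex_vector hspace \<Rightarrow> (real \<Rightarrow> ('a \<Rightarrow> 'a) \<Rightarrow> 'a \<Rightarrow> 'a) \<Rightarrow>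
    real \<Rightarrow> real \<Rightarrow> ('a \<Rightarrow> 'a ms_vec) \<Rightarrow> 'a ms_vec \<Rightarrow> 'a ms_vec" where
  "ms_tensor_left H \<phi> s t X = ms_extend H \<phi> s (ms_space H \<phi> (s + t))
     (\<lambda>P a h. ms_prepend H \<phi> s t P a (X h))"

definition ms_mult :: "'a::complex_vector hspace \<Rightarrow> (real \<Rightarrow> ('a \<Rightarrow> 'a) \<Rightarrow> 'a \<Rightarrow> 'a) \<Rightarrow>
    real \<Rightarrow> real \<Rightarrow> ('a \<Rightarrow> 'a ms_vec) \<Rightarrow> ('a \<Rightarrow> 'a ms_vec) \<Rightarrow> 'a \<Rightarrow> 'a ms_vec" where
  "ms_mult H \<phi> t s X Y =
     (if t = 0 then ms_scalar_val X *\<^sub>C Y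
      else if s = 0 then ms_scalar_val Y *\<^sub>C X
      else ms_tensor_left H \<phi> s t X \<circ> Y)"

definition ms_rep :: "'a::complex_vector hspace \<Rightarrow> (real \<Rightarrow> ('a \<Rightarrow> 'a) \<Rightarrow> 'a \<Rightarrow> 'a) \<Rightarrow>
    real \<Rightarrow> ('a \<Rightarrow> 'a ms_vec) \<Rightarrow> 'a \<Rightarrow> 'a" where
  "ms_rep H \<phi> t X = (if t = 0 then ms_scalar_val X *\<^sub>C hid H
     else adj H (ms_space H \<phi> t) (ms_iota H \<phi> t) \<circ> X)"

section \<open>Fibres coming from the one-interval partition\<close>

definition intertwiners2 :: "'a::complex_vector hspace \<Rightarrow> (('a \<Rightarrow> 'a) \<Rightarrow> 'a \<Rightarrow> 'a) \<Rightarrow>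
    ('a \<Rightarrow> 'a tens2_vec) set" where
  "intertwiners2 H \<Phi> = {X \<in> bop H (tens2 H \<Phi>). \<forall>A\<in>bops H. X \<circ> A = left_act2 H \<Phi> A \<circ> X}"

definition into_ms_space :: "'a::complex_vector hspace \<Rightarrow> (real \<Rightarrow> ('a \<Rightarrow> 'a) \<Rightarrow> 'a \<Rightarrow> 'a) \<Rightarrow>
    real \<Rightarrow> 'a tens2_vec \<Rightarrow> 'a ms_vec" where
  "into_ms_space H \<phi> t = extend_op (tens2 H (\<phi> t)) (ms_space H \<phi> t) (idx2 H)
     (\<lambda>(a, h). elem2 H (\<phi> t) a h)
     (\<lambda>(a, h). ms_elem H \<phi> t {0, t} ((\<lambda>_. hid H)(0 := a), h))"

text \<open>\<open>tensor_left2 H \<Phi> \<Theta> Y\<close> is the operator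
  \<open>I \<otimes> Y : B(H) \<otimes>\<^sub>\<Phi> H \<rightarrow> B(H) \<otimes>\<^sub>\<Phi> B(H) \<otimes>\<^sub>\<Theta> H\<close> for \<open>Y : H \<rightarrow> B(H) \<otimes>\<^sub>\<Theta> H\<close>.\<close>

definition prepend2 :: "'a::complex_vector hspace \<Rightarrow> (('a \<Rightarrow> 'a) \<Rightarrow> 'a \<Rightarrow> 'a) \<Rightarrow>
    (('a \<Rightarrow> 'a) \<Rightarrow> 'a \<Rightarrow> 'a) \<Rightarrow> ('a \<Rightarrow> 'a) \<Rightarrow> 'a tens2_vec \<Rightarrow> 'a tens3_vec" where
  "prepend2 H \<Phi> \<Theta> a = extend_op (tens2 H \<Theta>) (tens3 H \<Phi> \<Theta>) (idx2 H)
     (\<lambda>(b, g). elem2 H \<Theta> b g) (\<lambda>(b, g). elem3 H \<Phi> \<Theta> a b g)"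

definition tensor_left2 :: "'a::complex_vector hspace \<Rightarrow> (('a \<Rightarrow> 'a) \<Rightarrow> 'a \<Rightarrow> 'a) \<Rightarrow>
    (('a \<Rightarrow> 'a) \<Rightarrow> 'a \<Rightarrow> 'a) \<Rightarrow> ('a \<Rightarrow> 'a tens2_vec) \<Rightarrow> 'a tens2_vec \<Rightarrow> 'a tens3_vec" where
  "tensor_left2 H \<Phi> \<Theta> Y = extend_op (tens2 H \<Phi>) (tens3 H \<Phi> \<Theta>) (idx2 H)
     (\<lambda>(a, h). elem2 H \<Phi> a h) (\<lambda>(a, h). prepend2 H \<Phi> \<Theta> a (Y h))"

section \<open>The product-system \<open>E\<^sub>0\<close>-dilation of a strongly commuting pair\<close>

definition quadrant :: "(real \<times> real) set" where
  "quadrant = {0..} \<times> {0..}"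

type_synonym 'a joint_vec = "('a \<Rightarrow> 'a ms_vec) \<times> ('a \<Rightarrow> 'a ms_vec) \<Rightarrow> complex"

definition joint_fibre :: "'a::complex_vector hspace \<Rightarrow> (real \<Rightarrow> ('a \<Rightarrow> 'a) \<Rightarrow> 'a \<Rightarrow> 'a) \<Rightarrow>
    (real \<Rightarrow> ('a \<Rightarrow> 'a) \<Rightarrow> 'a \<Rightarrow> 'a) \<Rightarrow> real \<times> real \<Rightarrow> 'a joint_vec hspace" where
  "joint_fibre H \<phi> \<theta> = (\<lambda>(s, t). tensor (ms_fibre H \<phi> s) (ms_fibre H \<theta> t))"

definition joint_tens :: "'a::complex_vector hspace \<Rightarrow> (real \<Rightarrow> ('a \<Rightarrow> 'a) \<Rightarrow> 'a \<Rightarrow> 'a) \<Rightarrow>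
    (real \<Rightarrow> ('a \<Rightarrow> 'a) \<Rightarrow> 'a \<Rightarrow> 'a) \<Rightarrow> real \<times> real \<Rightarrow>
    ('a \<Rightarrow> 'a ms_vec) \<Rightarrow> ('a \<Rightarrow> 'a ms_vec) \<Rightarrow> 'a joint_vec" where
  "joint_tens H \<phi> \<theta> = (\<lambda>(s, t). tens (ms_fibre H \<phi> s) (ms_fibre H \<theta> t))"

definition joint_unit :: "'a::complex_vector hspace \<Rightarrow> (real \<Rightarrow> ('a \<Rightarrow> 'a) \<Rightarrow> 'a \<Rightarrow> 'a) \<Rightarrow>
    (real \<Rightarrow> ('a \<Rightarrow> 'a) \<Rightarrow> 'a \<Rightarrow> 'a) \<Rightarrow> 'a joint_vec" where
  "joint_unit H \<phi> \<theta> = joint_tens H \<phi> \<theta> (0, 0) (ms_scalar 1) (ms_scalar 1)"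

text \<open>
  The exchange unitary \<open>F(t) \<otimes> E(s) \<rightarrow> E(s) \<otimes> F(t)\<close> arises from a strong commutation unitary \<open>u\<close>
  as follows. Under \<open>Y \<otimes> X \<mapsto> (I \<otimes> Y)X\<close> and \<open>X \<otimes> Y \<mapsto> (I \<otimes> X)Y\<close>, the tensor products of the
  subspaces of \<open>E(s)\<close> and \<open>F(t)\<close> belonging to the one-interval partitions become the spaces of
  intertwiners from \<open>H\<close> into \<open>B(H) \<otimes>\<^bsub>\<phi>\<^sub>s\<^esub> B(H) \<otimes>\<^bsub>\<theta>\<^sub>t\<^esub> H\<close> and into
  \<open>B(H) \<otimes>\<^bsub>\<theta>\<^sub>t\<^esub> B(H) \<otimes>\<^bsub>\<phi>\<^sub>s\<^esub> H\<close>, with inner product given by \<open>Z\<^sup>*W = \<langle>Z,W\<rangle>I\<close>, and the exchange is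
  \<open>Z \<mapsto> uZ\<close>. Since \<open>uZ\<close> has the norm of \<open>Z\<close>, it is enough to prescribe the inner products with
  elementary tensors \<open>X' \<otimes> Y'\<close>. As products of one-interval elements are total in \<open>E(s)\<close> and \<open>F(t)\<close>,
  associativity determines the exchange unitaries from these values. For \<open>s = 0\<close> or \<open>t = 0\<close> the
  exchange is given by the unit law.
\<close>

definition exchange_from_unitary :: "'a::complex_vector hspace \<Rightarrow>
    (real \<Rightarrow> ('a \<Rightarrow> 'a) \<Rightarrow> 'a \<Rightarrow> 'a) \<Rightarrow> (real \<Rightarrow> ('a \<Rightarrow> 'a) \<Rightarrow> 'a \<Rightarrow> 'a) \<Rightarrow>
    (real \<times> real \<Rightarrow> real \<times> real \<Rightarrow> 'a joint_vec \<Rightarrow> 'a joint_vec \<Rightarrow> 'a joint_vec) \<Rightarrow>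
    real \<Rightarrow> real \<Rightarrow> ('a tens3_vec \<Rightarrow> 'a tens3_vec) \<Rightarrow> bool" where
  "exchange_from_unitary H \<phi> \<theta> m s t u \<longleftrightarrow>
     (\<forall>X\<in>intertwiners2 H (\<phi> s). \<forall>X'\<in>intertwiners2 H (\<phi> s).
      \<forall>Y\<in>intertwiners2 H (\<theta> t). \<forall>Y'\<in>intertwiners2 H (\<theta> t).
      \<forall>h\<in>hcarrier H. \<forall>k\<in>hcarrier H.
        hinner (joint_fibre H \<phi> \<theta> (s, t))
          (joint_tens H \<phi> \<theta> (s, t) (into_ms_space H \<phi> s \<circ> X') (into_ms_space H \<theta> t \<circ> Y'))
          (m (0, t) (s, 0)
             (joint_tens H \<phi> \<theta> (0, t) (ms_scalar 1) (into_ms_space H \<theta> t \<circ> Y))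
             (joint_tens H \<phi> \<theta> (s, 0) (into_ms_space H \<phi> s \<circ> X) (ms_scalar 1)))
        * hinner H h k =
        hinner (tens3 H (\<theta> t) (\<phi> s))
          (tensor_left2 H (\<theta> t) (\<phi> s) X' (Y' h))
          (u (tensor_left2 H (\<phi> s) (\<theta> t) Y (X k))))"

locale product_system_e0_dilation =
  fixes H K :: "'a::complex_vector hspace"
    and \<phi> \<theta> :: "real \<Rightarrow> ('a \<Rightarrow> 'a) \<Rightarrow> 'a \<Rightarrow> 'a"
    and m :: "real \<times> real \<Rightarrow> real \<times> real \<Rightarrow> 'a joint_vec \<Rightarrow> 'a joint_vec \<Rightarrow> 'a joint_vec"
    and T V :: "real \<times> real \<Rightarrow> 'a joint_vec \<Rightarrow> 'a \<Rightarrow> 'a"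
    and \<alpha> \<beta> :: "real \<Rightarrow> ('a \<Rightarrow> 'a) \<Rightarrow> 'a \<Rightarrow> 'a"
  assumes product_system_X:
      "product_system quadrant (joint_fibre H \<phi> \<theta>) m (joint_unit H \<phi> \<theta>)"
    and mult_E: "\<And>s s' x x'. \<lbrakk>0 \<le> s; 0 \<le> s'; x \<in> hcarrier (ms_fibre H \<phi> s);
        x' \<in> hcarrier (ms_fibre H \<phi> s')\<rbrakk> \<Longrightarrow>
        m (s, 0) (s', 0) (joint_tens H \<phi> \<theta> (s, 0) x (ms_scalar 1))
            (joint_tens H \<phi> \<theta> (s', 0) x' (ms_scalar 1))
          = joint_tens H \<phi> \<theta> (s + s', 0) (ms_mult H \<phi> s s' x x') (ms_scalar 1)"
    and mult_F: "\<And>t t' y y'. \<lbrakk>0 \<le> t; 0 \<le> t'; y \<in> hcarrier (ms_fibre H \<theta> t);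
        y' \<in> hcarrier (ms_fibre H \<theta> t')\<rbrakk> \<Longrightarrow>
        m (0, t) (0, t') (joint_tens H \<phi> \<theta> (0, t) (ms_scalar 1) y)
            (joint_tens H \<phi> \<theta> (0, t') (ms_scalar 1) y')
          = joint_tens H \<phi> \<theta> (0, t + t') (ms_scalar 1) (ms_mult H \<theta> t t' y y')"
    and mult_EF: "\<And>s t x y. \<lbrakk>0 \<le> s; 0 \<le> t; x \<in> hcarrier (ms_fibre H \<phi> s);
        y \<in> hcarrier (ms_fibre H \<theta> t)\<rbrakk> \<Longrightarrow>
        m (s, 0) (0, t) (joint_tens H \<phi> \<theta> (s, 0) x (ms_scalar 1))
            (joint_tens H \<phi> \<theta> (0, t) (ms_scalar 1) y)
          = joint_tens H \<phi> \<theta> (s, t) x y"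
    and mult_FE: "\<And>s t. \<lbrakk>0 < s; 0 < t\<rbrakk> \<Longrightarrow>
        \<exists>u. commutation_unitary H (\<phi> s) (\<theta> t) u \<and> exchange_from_unitary H \<phi> \<theta> m s t u"
    and rep_T: "representation quadrant (joint_fibre H \<phi> \<theta>) m (joint_unit H \<phi> \<theta>) H T"
    and coisometric_T: "fully_coisometric_rep quadrant (joint_fibre H \<phi> \<theta>) H T"
    and T_tens: "\<And>s t x y. \<lbrakk>0 \<le> s; 0 \<le> t; x \<in> hcarrier (ms_fibre H \<phi> s);
        y \<in> hcarrier (ms_fibre H \<theta> t)\<rbrakk> \<Longrightarrow>
        T (s, t) (joint_tens H \<phi> \<theta> (s, t) x y) = ms_rep H \<phi> s x \<circ> ms_rep H \<theta> t y"
    and hilbert_K: "hilbert_space K"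
    and separable_K: "separable_space (htopology K)"
    and dilation_V: "isometric_dilation quadrant (joint_fibre H \<phi> \<theta>) m (joint_unit H \<phi> \<theta>) H T K V"
    and coisometric_V: "fully_coisometric_rep quadrant (joint_fibre H \<phi> \<theta>) K V"
    and minimal_V: "minimal_dilation quadrant (joint_fibre H \<phi> \<theta>) H K V"
    and alpha_eq: "\<And>t A. \<lbrakk>0 \<le> t; A \<in> bops K\<rbrakk> \<Longrightarrow>
        \<alpha> t A = induced_map (ms_fibre H \<phi> t) K
          (\<lambda>x. V (t, 0) (joint_tens H \<phi> \<theta> (t, 0) x (ms_scalar 1))) A"
    and beta_eq: "\<And>t A. \<lbrakk>0 \<le> t; A \<in> bops K\<rbrakk> \<Longrightarrow>
        \<beta> t A = induced_map (ms_fibre H \<theta> t) K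
          (\<lambda>y. V (0, t) (joint_tens H \<phi> \<theta> (0, t) (ms_scalar 1) y)) A"
    and e0_alpha: "e0_semigroup K \<alpha>"
    and e0_beta: "e0_semigroup K \<beta>"
    and alpha_beta_commute: "\<And>s t A. \<lbrakk>0 \<le> s; 0 \<le> t; A \<in> bops K\<rbrakk> \<Longrightarrow>
        \<alpha> s (\<beta> t A) = \<beta> t (\<alpha> s A)"
    and dilation_eq: "\<And>s t A. \<lbrakk>0 \<le> s; 0 \<le> t; A \<in> bops K\<rbrakk> \<Longrightarrow>
        \<phi> s (\<theta> t (compress H K A)) = compress H K (\<alpha> s (\<beta> t A))"

end

theory Submission
  imports Defs
begin

text \<open>
  When every \<open>\<phi>\<^sub>t\<close> is an endomorphism, the elementary tensor \<open>a\<^sub>1 \<otimes> \<dots> \<otimes> a\<^sub>n \<otimes> h\<close> equals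
  \<open>I \<otimes> \<dots> \<otimes> I \<otimes> wh\<close> for a product \<open>w\<close> of operators \<open>\<phi>\<^sub>r(a\<^sub>i)\<close>. Hence \<open>\<iota>\<^sub>t\<close> is unitary and \<open>E(t)\<close> becomes
  the space of \<open>X \<in> B(H)\<close> with \<open>XA = \<phi>\<^sub>t(A)X\<close>. For such \<open>X\<close> and \<open>Y\<close> the operator \<open>XY\<^sup>*\<close> commutes with
  \<open>\<phi>\<^sub>t(B(H)) = B(H)\<close> and is a scalar, so \<open>E(t)\<close> is at most one-dimensional. If it is spanned by a unit
  vector \<open>y\<close>, then \<open>\<alpha>\<^sub>t(A) = UAU\<^sup>*\<close> with \<open>U = V\<^sup>E\<^sub>t(y)\<close>, and \<open>U\<close> is unitary because \<open>V\<close> is isometric and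
  fully coisometric. If \<open>E(t) = 0\<close>, then full coisometry of \<open>V\<close> forces \<open>K = 0\<close>.
\<close>

section \<open>Hilbert spaces on explicit carriers\<close>

text \<open>The obstacle is that every space is a completion and every operator a definite
  description, so nothing can be computed directly. The completions that matter have a kernel
  \<open><v_i, v_j>\<close> with vectors \<open>v_i\<close> of a known Hilbert space, and these
  vectors exhaust that space instead of being merely total. Hence the completion is a copy of the
  known space, and an operator is fixed by its values on generators with no density argument. This
  device handles \<open>H_P\<close>, the direct limit \<open>H_t\<close>,
  \<open>E(t) \<otimes> \<complex>\<close> and tensor products with \<open>K\<close>. That
  automorphisms of \<open>B(H)\<close> are implemented by unitaries would supply a nonzero element
  of \<open>E(t)\<close>. The case split on \<open>E(t) = 0\<close> replaces that theorem: only an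
  upper bound for the dimension is proved, and the zero case is settled on the side of
  \<open>K\<close>. One more gap has to be bridged: \<alpha> is formed from \<open>E(t)\<close>,
  while isometry and coisometry of \<open>V\<close> concern the fibre
  \<open>X(t,0) = E(t) \<otimes> \<complex>\<close>.\<close>

interpretation cv: vector_space "scaleC :: complex \<Rightarrow> 'a::complex_vector \<Rightarrow> 'a"
  by unfold_locales (simp_all add: scaleC_add_right scaleC_add_left scaleC_scaleC scaleC_one)

lemma scaleC_apply: "(c *\<^sub>C f) x = c *\<^sub>C f x"
  by (simp add: scaleC_fun_def)

section \<open>Geometry of an inner product on a carrier\<close>

locale hilbert =
  fixes H :: "'a::complex_vector hspace"
  assumes hilbert_space: "hilbert_space H"
begin

lemma subspace: "cv.subspace (hcarrier H)"
  using hilbert_space by (simp add: hilbert_space_def)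

lemma zero_closed [simp, intro]: "0 \<in> hcarrier H"
  by (rule cv.subspace_0[OF subspace])

lemma add_closed [simp, intro]: "x \<in> hcarrier H \<Longrightarrow> y \<in> hcarrier H \<Longrightarrow> x + y \<in> hcarrier H"
  by (rule cv.subspace_add[OF subspace])

lemma scale_closed [simp, intro]: "x \<in> hcarrier H \<Longrightarrow> c *\<^sub>C x \<in> hcarrier H"
  by (rule cv.subspace_scale[OF subspace])

lemma diff_closed [simp, intro]: "x \<in> hcarrier H \<Longrightarrow> y \<in> hcarrier H \<Longrightarrow> x - y \<in> hcarrier H"
  by (rule cv.subspace_diff[OF subspace])

lemma sum_closed: "(\<And>i. i \<in> A \<Longrightarrow> f i \<in> hcarrier H) \<Longrightarrow> sum f A \<in> hcarrier H"
  by (rule cv.subspace_sum[OF subspace])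

lemma
  shows inner_commute: "x \<in> hcarrier H \<Longrightarrow> y \<in> hcarrier H \<Longrightarrow> hinner H x y = cnj (hinner H y x)"
    and inner_add_right: "x \<in> hcarrier H \<Longrightarrow> y \<in> hcarrier H \<Longrightarrow> z \<in> hcarrier H \<Longrightarrow>
      hinner H x (y + z) = hinner H x y + hinner H x z"
    and inner_scale_right: "x \<in> hcarrier H \<Longrightarrow> y \<in> hcarrier H \<Longrightarrow>
      hinner H x (c *\<^sub>C y) = c * hinner H x y"
    and inner_self_nonneg: "x \<in> hcarrier H \<Longrightarrow> hinner H x x \<in> \<real>\<^sub>\<ge>\<^sub>0"
    and inner_self_eq_0: "x \<in> hcarrier H \<Longrightarrow> hinner H x x = 0 \<Longrightarrow> x = 0"
    and complete: "Metric_space.mcomplete (hcarrier H) (hdist H)"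
  apply (rule hilbert_space[unfolded hilbert_space_def, THEN conjunct2, THEN conjunct1, rule_format]; assumption)
  apply (rule hilbert_space[unfolded hilbert_space_def, THEN conjunct2, THEN conjunct2, THEN conjunct1, rule_format]; assumption)
  apply (rule hilbert_space[unfolded hilbert_space_def, THEN conjunct2, THEN conjunct2, THEN conjunct2, THEN conjunct1, rule_format]; assumption)
  apply (rule hilbert_space[unfolded hilbert_space_def, THEN conjunct2, THEN conjunct2, THEN conjunct2, THEN conjunct2, THEN conjunct1, rule_format]; assumption)
  apply (rule hilbert_space[unfolded hilbert_space_def, THEN conjunct2, THEN conjunct2, THEN conjunct2, THEN conjunct2, THEN conjunct2, THEN conjunct1, rule_format]; assumption)
  apply (rule hilbert_space[unfolded hilbert_space_def, THEN conjunct2, THEN conjunct2, THEN conjunct2, THEN conjunct2, THEN conjunct2, THEN conjunct2, rule_format])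
  done

lemma inner_add_left:
  "x \<in> hcarrier H \<Longrightarrow> y \<in> hcarrier H \<Longrightarrow> z \<in> hcarrier H \<Longrightarrow>
    hinner H (x + y) z = hinner H x z + hinner H y z"
  by (metis add_closed complex_cnj_add inner_add_right inner_commute)

lemma inner_scale_left:
  "x \<in> hcarrier H \<Longrightarrow> y \<in> hcarrier H \<Longrightarrow> hinner H (c *\<^sub>C x) y = cnj c * hinner H x y"
  by (metis complex_cnj_mult inner_commute inner_scale_right scale_closed)

lemma inner_zero_right [simp]: "x \<in> hcarrier H \<Longrightarrow> hinner H x 0 = 0"
  using inner_scale_right[of x x 0] by simp

lemma inner_zero_left [simp]: "x \<in> hcarrier H \<Longrightarrow> hinner H 0 x = 0"
  using inner_scale_left[of x x 0] by simp

lemma inner_diff_right: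
  assumes "x \<in> hcarrier H" "y \<in> hcarrier H" "z \<in> hcarrier H"
  shows "hinner H x (y - z) = hinner H x y - hinner H x z"
  using inner_add_right[of x "y - z" z] assms by simp

lemma inner_diff_left:
  assumes "x \<in> hcarrier H" "y \<in> hcarrier H" "z \<in> hcarrier H"
  shows "hinner H (x - y) z = hinner H x z - hinner H y z"
  using inner_add_left[of "x - y" y z] assms by simp

lemma inner_sum_right:
  assumes "x \<in> hcarrier H" "\<And>i. i \<in> A \<Longrightarrow> f i \<in> hcarrier H"
  shows "hinner H x (sum f A) = (\<Sum>i\<in>A. hinner H x (f i))"
  using assms(2)
proof (induction A rule: infinite_finite_induct)
  case (insert i A)
  then show ?case using assms(1) by (simp add: inner_add_right sum_closed)
qed (use assms(1) in auto)

lemma inner_sum_left: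
  assumes "x \<in> hcarrier H" "\<And>i. i \<in> A \<Longrightarrow> f i \<in> hcarrier H"
  shows "hinner H (sum f A) x = (\<Sum>i\<in>A. hinner H (f i) x)"
  using assms(2)
proof (induction A rule: infinite_finite_induct)
  case (insert i A)
  then show ?case using assms(1) by (simp add: inner_add_left sum_closed)
qed (use assms(1) in auto)

lemma eq_if_inner_eq:
  assumes "x \<in> hcarrier H" "y \<in> hcarrier H" "\<And>z. z \<in> hcarrier H \<Longrightarrow> hinner H z x = hinner H z y"
  shows "x = y"
proof -
  have "hinner H (x - y) (x - y) = 0"
    using assms by (simp add: inner_diff_right)
  then show ?thesis using inner_self_eq_0[of "x - y"] assms by simp
qed

lemma norm_nonneg [simp]: "x \<in> hcarrier H \<Longrightarrow> 0 \<le> hnorm H x"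
  using inner_self_nonneg[of x] by (auto simp: hnorm_def complex_nonneg_Reals_iff)

lemma inner_self: "x \<in> hcarrier H \<Longrightarrow> hinner H x x = complex_of_real ((hnorm H x)\<^sup>2)"
  using inner_self_nonneg[of x]
  by (auto simp: hnorm_def complex_nonneg_Reals_iff complex_eq_iff)

lemma norm_eq_0 [simp]: "x \<in> hcarrier H \<Longrightarrow> hnorm H x = 0 \<longleftrightarrow> x = 0"
  using inner_self[of x] inner_self_eq_0[of x] by (auto simp: hnorm_def)

lemma norm_zero [simp]: "hnorm H 0 = 0"
  by simp

lemma norm_scale:
  assumes "x \<in> hcarrier H"
  shows "hnorm H (c *\<^sub>C x) = cmod c * hnorm H x"
proof -
  have "complex_of_real ((hnorm H (c *\<^sub>C x))\<^sup>2) = cnj c * (c * hinner H x x)"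
    using assms inner_self[of "c *\<^sub>C x", symmetric]
    by (simp add: inner_scale_left inner_scale_right)
  also have "\<dots> = complex_of_real ((cmod c * hnorm H x)\<^sup>2)"
    by (simp only: inner_self[OF assms] power_mult_distrib of_real_mult complex_norm_square)
      (simp add: mult_ac)
  finally have "(hnorm H (c *\<^sub>C x))\<^sup>2 = (cmod c * hnorm H x)\<^sup>2" by (simp only: of_real_eq_iff)
  then show ?thesis using assms by (simp add: power2_eq_iff_nonneg)
qed

lemma norm_minus_commute:
  assumes "x \<in> hcarrier H" "y \<in> hcarrier H"
  shows "hnorm H (x - y) = hnorm H (y - x)"
proof -
  have "y - x = (-1) *\<^sub>C (x - y)" by (simp add: cv.scale_right_diff_distrib)
  then show ?thesis using norm_scale[of "x - y" "-1"] assms by simp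
qed

lemma norm_add_sq:
  assumes "x \<in> hcarrier H" "y \<in> hcarrier H"
  shows "(hnorm H (x + y))\<^sup>2 = (hnorm H x)\<^sup>2 + 2 * Re (hinner H x y) + (hnorm H y)\<^sup>2"
proof -
  have "complex_of_real ((hnorm H (x + y))\<^sup>2) =
      hinner H x x + hinner H x y + (cnj (hinner H x y) + hinner H y y)"
    unfolding inner_self[symmetric, OF add_closed[OF assms]] inner_commute[OF assms, symmetric]
    using assms inner_commute[of y x]
    by (simp add: inner_add_left inner_add_right)
  then have "Re (complex_of_real ((hnorm H (x + y))\<^sup>2)) =
      Re (hinner H x x + hinner H x y + (cnj (hinner H x y) + hinner H y y))"
    by (rule arg_cong)
  then show ?thesis using assms by (simp add: inner_self del: of_real_power)
qed

lemma cauchy_schwarz: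
  assumes "x \<in> hcarrier H" "y \<in> hcarrier H"
  shows "cmod (hinner H x y) \<le> hnorm H x * hnorm H y"
proof (cases "y = 0")
  case True
  then show ?thesis using assms by simp
next
  case False
  let ?n = "(hnorm H y)\<^sup>2" and ?b = "hinner H x y"
  have n: "?n > 0" using False assms by simp
  \<comment> \<open>This coefficient makes \<open>x + c y\<close> orthogonal to \<open>y\<close>, so
    the square below equals \<open>|x|^2 - |b|^2 / |y|^2\<close>.\<close>
  define c where "c = - cnj ?b / ?n"
  have "0 \<le> (hnorm H (x + c *\<^sub>C y))\<^sup>2" by simp
  also have "\<dots> = (hnorm H x)\<^sup>2 + 2 * Re (c * ?b) + (cmod c)\<^sup>2 * ?n"
    using assms by (simp add: norm_add_sq inner_scale_right norm_scale power_mult_distrib)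
  also have "c * ?b = - complex_of_real ((cmod ?b)\<^sup>2 / ?n)"
    unfolding c_def of_real_divide complex_norm_square by (simp add: mult.commute)
  also have "(cmod c)\<^sup>2 * ?n = (cmod ?b)\<^sup>2 / ?n"
    using n by (simp add: c_def norm_divide norm_mult power_divide power2_eq_square)
  finally have "(cmod ?b)\<^sup>2 / ?n \<le> (hnorm H x)\<^sup>2" by simp
  then have "(cmod ?b)\<^sup>2 \<le> (hnorm H x * hnorm H y)\<^sup>2"
    using n by (simp add: pos_divide_le_eq power_mult_distrib)
  then show ?thesis using power2_le_imp_le assms by simp
qed

lemma norm_triangle:
  assumes "x \<in> hcarrier H" "y \<in> hcarrier H"
  shows "hnorm H (x + y) \<le> hnorm H x + hnorm H y"
proof (rule power2_le_imp_le)
  have "Re (hinner H x y) \<le> hnorm H x * hnorm H y"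
    using cauchy_schwarz[OF assms] complex_Re_le_cmod order_trans by blast
  then show "(hnorm H (x + y))\<^sup>2 \<le> (hnorm H x + hnorm H y)\<^sup>2"
    unfolding norm_add_sq[OF assms] by (simp add: power2_sum)
qed (use assms in simp)

lemma Metric_space: "Metric_space (hcarrier H) (hdist H)"
proof
  fix x y z assume "x \<in> hcarrier H" "y \<in> hcarrier H" "z \<in> hcarrier H"
  then show "hdist H x z \<le> hdist H x y + hdist H y z"
    using norm_triangle[of "x - y" "y - z"] by (simp add: hdist_def)
qed (auto simp: hdist_def norm_minus_commute)

section \<open>Norm limits and the Riesz representation theorem\<close>

definition hlim :: "(nat \<Rightarrow> 'a) \<Rightarrow> 'a \<Rightarrow> bool" where
  "hlim x l \<longleftrightarrow> (\<forall>n. x n \<in> hcarrier H) \<and> l \<in> hcarrier H \<and> (\<lambda>n. hnorm H (x n - l)) \<longlonglongrightarrow> 0"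

lemma cauchy_hlim:
  assumes "\<And>n. x n \<in> hcarrier H"
    and "\<And>\<epsilon>. \<epsilon> > 0 \<Longrightarrow> \<exists>N. \<forall>m\<ge>N. \<forall>n\<ge>N. hnorm H (x m - x n) < \<epsilon>"
  obtains l where "hlim x l"
proof -
  interpret Metric_space "hcarrier H" "hdist H" by (rule Metric_space)
  have "MCauchy x"
    unfolding MCauchy_def using assms by (auto simp: hdist_def)
  then obtain l where "limitin mtopology x l sequentially"
    using complete unfolding mcomplete_def by blast
  then have l: "l \<in> hcarrier H" "\<forall>\<epsilon>>0. \<forall>\<^sub>F n in sequentially. hdist H (x n) l < \<epsilon>"
    unfolding limitin_metric by (auto elim: eventually_mono)
  have "(\<lambda>n. hnorm H (x n - l)) \<longlonglongrightarrow> 0"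
    unfolding tendsto_iff using l assms(1) by (simp add: hdist_def)
  then show ?thesis using that[of l] l assms(1) by (simp add: hlim_def)
qed

lemma hlim_inner_right:
  assumes "hlim x l" "z \<in> hcarrier H"
  shows "(\<lambda>n. hinner H z (x n)) \<longlonglongrightarrow> hinner H z l"
proof -
  have "(\<lambda>n. hinner H z (x n) - hinner H z l) \<longlonglongrightarrow> 0"
  proof (rule Lim_null_comparison)
    show "\<forall>\<^sub>F n in sequentially. norm (hinner H z (x n) - hinner H z l)
        \<le> hnorm H z * hnorm H (x n - l)"
      using assms cauchy_schwarz[of z] by (simp add: hlim_def inner_diff_right[symmetric])
    show "(\<lambda>n. hnorm H z * hnorm H (x n - l)) \<longlonglongrightarrow> 0"
      using assms by (auto simp: hlim_def intro: tendsto_mult_right_zero)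
  qed
  then show ?thesis by (simp add: LIM_zero_iff)
qed

lemma hlim_norm:
  assumes "hlim x l"
  shows "(\<lambda>n. hnorm H (x n)) \<longlonglongrightarrow> hnorm H l"
proof -
  have "(\<lambda>n. hnorm H (x n) - hnorm H l) \<longlonglongrightarrow> 0"
  proof (rule Lim_null_comparison)
    show "\<forall>\<^sub>F n in sequentially. norm (hnorm H (x n) - hnorm H l) \<le> hnorm H (x n - l)"
    proof (intro always_eventually allI)
      fix n
      show "norm (hnorm H (x n) - hnorm H l) \<le> hnorm H (x n - l)"
        using assms norm_triangle[of "x n - l" l] norm_triangle[of "l - x n" "x n"]
          norm_minus_commute[of l "x n"] by (auto simp: hlim_def)
    qed
    show "(\<lambda>n. hnorm H (x n - l)) \<longlonglongrightarrow> 0" using assms by (simp add: hlim_def)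
  qed
  then show ?thesis by (simp add: LIM_zero_iff)
qed

lemma hlim_inner:
  assumes "hlim x l" "hlim y l'"
  shows "(\<lambda>n. hinner H (x n) (y n)) \<longlonglongrightarrow> hinner H l l'"
proof -
  have "(\<lambda>n. hinner H (x n) (y n) - hinner H l (y n)) \<longlonglongrightarrow> 0"
  proof (rule Lim_null_comparison)
    show "\<forall>\<^sub>F n in sequentially. norm (hinner H (x n) (y n) - hinner H l (y n))
        \<le> hnorm H (x n - l) * hnorm H (y n)"
      using assms cauchy_schwarz by (simp add: hlim_def inner_diff_left[symmetric])
    show "(\<lambda>n. hnorm H (x n - l) * hnorm H (y n)) \<longlonglongrightarrow> 0"
      using tendsto_mult[of "\<lambda>n. hnorm H (x n - l)" 0 sequentially] hlim_norm[OF assms(2)] assms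
      by (force simp: hlim_def)
  qed
  moreover have "(\<lambda>n. hinner H l (y n)) \<longlonglongrightarrow> hinner H l l'"
    using assms by (intro hlim_inner_right) (auto simp: hlim_def)
  ultimately show ?thesis
    using tendsto_add by force
qed

text \<open>The representing vector minimises \<open>\<parallel>x\<parallel>\<^sup>2 - 2 Re (f x)\<close>; minimising sequences are Cauchy by the
  parallelogram law.\<close>

lemma riesz:
  assumes add: "\<And>x y. x \<in> hcarrier H \<Longrightarrow> y \<in> hcarrier H \<Longrightarrow> f (x + y) = f x + f y"
    and scale: "\<And>c x. x \<in> hcarrier H \<Longrightarrow> f (c *\<^sub>C x) = c * f x"
    and bound: "\<And>x. x \<in> hcarrier H \<Longrightarrow> cmod (f x) \<le> C * hnorm H x"
  obtains y where "y \<in> hcarrier H" "\<And>x. x \<in> hcarrier H \<Longrightarrow> f x = hinner H y x"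
proof -
  define q where "q x = (hnorm H x)\<^sup>2 - 2 * Re (f x)" for x
  \<comment> \<open>Completing the square in the norm of \<open>x\<close>.\<close>
  have q_lower: "- C\<^sup>2 \<le> q x" if "x \<in> hcarrier H" for x
  proof -
    have "Re (f x) \<le> C * hnorm H x"
      using bound[OF that] complex_Re_le_cmod order_trans by blast
    moreover have "0 \<le> (hnorm H x - C)\<^sup>2" by simp
    ultimately show ?thesis by (simp add: q_def power2_diff mult.commute)
  qed
  define d where "d = Inf (q ` hcarrier H)"
  have bdd: "bdd_below (q ` hcarrier H)" using q_lower by (auto simp: bdd_below_def)
  have d_le: "d \<le> q x" if "x \<in> hcarrier H" for x
    unfolding d_def using bdd that by (simp add: cInf_lower)
  define r where "r n = 1 / real (Suc n)" for n
  have "\<exists>x\<in>hcarrier H. q x < d + r n" for n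
    using cInf_lessD[of "q ` hcarrier H" "d + r n"] by (auto simp: d_def r_def)
  then obtain x where x: "\<And>n. x n \<in> hcarrier H" "\<And>n. q (x n) < d + r n"
    by metis
  have para: "(hnorm H (u - v))\<^sup>2 \<le> 2 * (q u - d) + 2 * (q v - d)"
    if uv: "u \<in> hcarrier H" "v \<in> hcarrier H" for u v
  proof -
    \<comment> \<open>The midpoint competes with \<open>u\<close> and \<open>v\<close>:
      \<open>d \<le> q w\<close> bounds the parallelogram defect, and the linear parts of
      \<open>q\<close> cancel.\<close>
    define w where "w = (1/2::complex) *\<^sub>C (u + v)"
    have w: "w \<in> hcarrier H" using uv by (simp add: w_def)
    have e: "u - v = u + (-1) *\<^sub>C v" by simp
    have "(hnorm H (u - v))\<^sup>2 = (hnorm H u)\<^sup>2 - 2 * Re (hinner H u v) + (hnorm H v)\<^sup>2"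
      unfolding e using norm_add_sq[of u "(-1) *\<^sub>C v"] uv norm_scale[of v "-1"]
      by (simp add: inner_scale_right del: cv.scale_minus_left)
    moreover have "(hnorm H (u + v))\<^sup>2 = (hnorm H u)\<^sup>2 + 2 * Re (hinner H u v) + (hnorm H v)\<^sup>2"
      using uv by (rule norm_add_sq)
    moreover have "(hnorm H w)\<^sup>2 = (hnorm H (u + v))\<^sup>2 / 4"
      using uv by (simp add: w_def norm_scale power_mult_distrib power_divide norm_divide)
    moreover have "Re (2 * f w) = Re (f u + f v)"
      using uv scale[of "u + v" "1/2"] by (intro arg_cong[where f = Re]) (simp add: w_def add mult.commute)
    ultimately show ?thesis
      using d_le[OF w] by (simp add: q_def)
  qed
  have "\<exists>l. hlim x l"
  proof (rule cauchy_hlim[of x])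
    fix \<epsilon> :: real assume "\<epsilon> > 0"
    then obtain N where N: "4 * r N < \<epsilon>\<^sup>2"
      using reals_Archimedean[of "\<epsilon>\<^sup>2 / 4"] by (auto simp: r_def field_simps)
    have "hnorm H (x m - x n) < \<epsilon>" if "m \<ge> N" "n \<ge> N" for m n
    proof (rule power2_less_imp_less)
      have "r m \<le> r N" "r n \<le> r N"
        using that by (simp_all add: r_def frac_le)
      then show "(hnorm H (x m - x n))\<^sup>2 < \<epsilon>\<^sup>2"
        using para[OF x(1)[of m] x(1)[of n]] x(2)[of m] x(2)[of n] N by argo
    qed (use \<open>\<epsilon> > 0\<close> in simp)
    then show "\<exists>N. \<forall>m\<ge>N. \<forall>n\<ge>N. hnorm H (x m - x n) < \<epsilon>" by blast
  qed (use x in auto)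
  then obtain l where l: "hlim x l" by blast
  then have lH: "l \<in> hcarrier H" by (simp add: hlim_def)
  have f_diff: "f (u - v) = f u - f v" if "u \<in> hcarrier H" "v \<in> hcarrier H" for u v
    using add[of "u - v" v] that by simp
  have "(\<lambda>n. f (x n) - f l) \<longlonglongrightarrow> 0"
  proof (rule Lim_null_comparison)
    show "\<forall>\<^sub>F n in sequentially. norm (f (x n) - f l) \<le> C * hnorm H (x n - l)"
      using x lH bound by (simp add: f_diff[symmetric])
    show "(\<lambda>n. C * hnorm H (x n - l)) \<longlonglongrightarrow> 0"
      using l by (auto simp: hlim_def intro: tendsto_mult_right_zero)
  qed
  then have "(\<lambda>n. f (x n)) \<longlonglongrightarrow> f l" by (simp add: LIM_zero_iff)
  then have "(\<lambda>n. q (x n)) \<longlonglongrightarrow> q l"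
    unfolding q_def using hlim_norm[OF l] by (intro tendsto_intros)
  moreover have "(\<lambda>n. d + r n) \<longlonglongrightarrow> d + 0"
    unfolding r_def by (intro tendsto_intros LIMSEQ_Suc[OF lim_1_over_n])
  ultimately have "q l \<le> d + 0"
    by (rule LIMSEQ_le) (use x in \<open>auto intro: less_imp_le\<close>)
  then have min: "q l \<le> q z" if "z \<in> hcarrier H" for z
    using d_le[OF that] by simp
  have "f z = hinner H l z" if z: "z \<in> hcarrier H" for z
  proof -
    define g where "g = hinner H l z - f z"
    have *: "0 \<le> - 2 * s * (cmod g)\<^sup>2 + s\<^sup>2 * ((cmod g)\<^sup>2 * (hnorm H z)\<^sup>2)" for s :: real
    proof -
      \<comment> \<open>First variation at the minimiser; the factor \<open>cnj g\<close> makes the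
        linear term real, namely \<open>-2 s |g|^2\<close>.\<close>
      define c where "c = - (of_real s * cnj g)"
      have "q l \<le> q (l + c *\<^sub>C z)" using lH z by (intro min) auto
      also have "\<dots> = q l + 2 * Re (c * g) + (cmod c)\<^sup>2 * (hnorm H z)\<^sup>2"
        using lH z by (simp add: q_def norm_add_sq inner_scale_right add scale norm_scale
            power_mult_distrib g_def right_diff_distrib)
      also have "c * g = - complex_of_real (s * (cmod g)\<^sup>2)"
        by (simp only: c_def of_real_mult complex_norm_square) (simp add: mult_ac)
      also have "(cmod c)\<^sup>2 = s\<^sup>2 * (cmod g)\<^sup>2"
        by (simp add: c_def norm_mult power_mult_distrib)
      finally show ?thesis by simp
    qed
    \<comment> \<open>For small positive \<open>s\<close> the linear term beats the quadratic one.
      This value satisfies \<open>s (|z|^2 + 1) = 1\<close> and avoids dividing by the norm of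
      \<open>z\<close>.\<close>
    define s where "s = 1 / ((hnorm H z)\<^sup>2 + 1)"
    have pos: "(hnorm H z)\<^sup>2 + 1 > 0" using zero_le_power2[of "hnorm H z"] by linarith
    then have s: "s > 0" "s * (hnorm H z)\<^sup>2 = 1 - s" by (simp_all add: s_def field_simps)
    have "s\<^sup>2 * ((cmod g)\<^sup>2 * (hnorm H z)\<^sup>2) = s * (cmod g)\<^sup>2 * (s * (hnorm H z)\<^sup>2)"
      by (simp add: power2_eq_square)
    then have "(s + s\<^sup>2) * (cmod g)\<^sup>2 \<le> 0"
      using *[of s] by (simp only: s(2)) (simp add: power2_eq_square algebra_simps)
    moreover have "s + s\<^sup>2 > 0" using s(1) by (simp add: add_pos_pos)
    ultimately have "(cmod g)\<^sup>2 \<le> 0" by (simp add: mult_le_0_iff)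
    then show ?thesis by (simp add: g_def)
  qed
  then show ?thesis using that lH by blast
qed

end

subsection \<open>Bounded operators and adjoints\<close>

lemma
  assumes "A \<in> bop G K"
  shows bop_closed: "x \<in> hcarrier G \<Longrightarrow> A x \<in> hcarrier K"
    and bop_off: "x \<notin> hcarrier G \<Longrightarrow> A x = 0"
    and bop_add: "x \<in> hcarrier G \<Longrightarrow> y \<in> hcarrier G \<Longrightarrow> A (x + y) = A x + A y"
    and bop_scale: "x \<in> hcarrier G \<Longrightarrow> A (c *\<^sub>C x) = c *\<^sub>C A x"
    and bop_bound: "\<exists>C. \<forall>x\<in>hcarrier G. hnorm K (A x) \<le> C * hnorm G x"
  using assms unfolding bop_def by auto

lemma bop_zero: "A \<in> bop G K \<Longrightarrow> A 0 = 0"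
  using bop_scale[of A G K 0 0] bop_off[of A G K 0] by (cases "0 \<in> hcarrier G") auto

lemma bopI:
  assumes "\<And>x. x \<in> hcarrier G \<Longrightarrow> A x \<in> hcarrier K"
    and "\<And>x. x \<notin> hcarrier G \<Longrightarrow> A x = 0"
    and "\<And>x y. x \<in> hcarrier G \<Longrightarrow> y \<in> hcarrier G \<Longrightarrow> A (x + y) = A x + A y"
    and "\<And>c x. x \<in> hcarrier G \<Longrightarrow> A (c *\<^sub>C x) = c *\<^sub>C A x"
    and "\<And>x. x \<in> hcarrier G \<Longrightarrow> hnorm K (A x) \<le> C * hnorm G x"
  shows "A \<in> bop G K"
  using assms unfolding bop_def by (auto intro: exI[of _ C])

lemma bop_eqI:
  assumes "A \<in> bop G K" "B \<in> bop G K" "\<And>x. x \<in> hcarrier G \<Longrightarrow> A x = B x"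
  shows "A = B"
  using assms bop_off by (metis ext)

lemma bop_comp:
  assumes A: "A \<in> bop G K" and B: "B \<in> bop F G"
    and G: "hilbert_space G" and K: "hilbert_space K"
  shows "A \<circ> B \<in> bop F K"
proof -
  interpret G: hilbert G by unfold_locales (rule G)
  interpret K: hilbert K by unfold_locales (rule K)
  obtain C where C: "\<And>x. x \<in> hcarrier G \<Longrightarrow> hnorm K (A x) \<le> C * hnorm G x"
    using bop_bound[OF A] by blast
  obtain D where D: "\<And>x. x \<in> hcarrier F \<Longrightarrow> hnorm G (B x) \<le> D * hnorm F x"
    using bop_bound[OF B] by blast
  show ?thesis
  proof (rule bopI[where C = "\<bar>C\<bar> * D"])
    fix x assume x: "x \<in> hcarrier F"
    then have Bx: "B x \<in> hcarrier G" by (rule bop_closed[OF B])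
    then have "hnorm K (A (B x)) \<le> C * hnorm G (B x)" by (rule C)
    also have "\<dots> \<le> \<bar>C\<bar> * hnorm G (B x)" using Bx by (intro mult_right_mono) auto
    also have "\<dots> \<le> \<bar>C\<bar> * (D * hnorm F x)" using D[OF x] by (intro mult_left_mono) auto
    finally show "hnorm K ((A \<circ> B) x) \<le> \<bar>C\<bar> * D * hnorm F x" by (simp add: mult.assoc)
  qed (simp_all add: bop_closed[OF A] bop_closed[OF B] bop_off[OF B] bop_add[OF A] bop_add[OF B]
      bop_scale[OF A] bop_scale[OF B] bop_zero[OF A])
qed

lemma (in hilbert) hid_bop [simp]: "hid H \<in> bops H"
  by (rule bopI[where C = 1]) (simp_all add: hid_def)

lemma comp_hid: "A \<in> bop G K \<Longrightarrow> A \<circ> hid G = A"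
  by (rule ext) (auto simp: hid_def bop_zero bop_off)

lemma hid_comp:
  assumes "hilbert_space K" "A \<in> bop G K"
  shows "hid K \<circ> A = A"
proof -
  interpret K: hilbert K by unfold_locales (rule assms)
  have "A x \<in> hcarrier K" for x
    using bop_closed[OF assms(2)] bop_off[OF assms(2)] by (cases "x \<in> hcarrier G") auto
  then show ?thesis by (simp add: fun_eq_iff hid_def)
qed

text \<open>Since \<open>adj\<close> is a definite description, exhibiting an operator with the
  adjoint relation suffices once uniqueness is known, and uniqueness follows by testing against
  vectors of \<open>G\<close>.\<close>

lemma adj_eqI:
  assumes G: "hilbert_space G" and B: "B \<in> bop K G"
    and eq: "\<And>x y. x \<in> hcarrier G \<Longrightarrow> y \<in> hcarrier K \<Longrightarrow> hinner K (A x) y = hinner G x (B y)"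
  shows "adj G K A = B"
  unfolding adj_def
proof (rule the_equality)
  interpret G: hilbert G by unfold_locales (rule G)
  fix B' assume B': "B' \<in> bop K G \<and>
    (\<forall>x\<in>hcarrier G. \<forall>y\<in>hcarrier K. hinner K (A x) y = hinner G x (B' y))"
  show "B' = B"
  proof (rule bop_eqI)
    fix y assume y: "y \<in> hcarrier K"
    have "hinner G z (B' y) = hinner G z (B y)" if "z \<in> hcarrier G" for z
      using B' eq that y by metis
    then show "B' y = B y"
      using B' B y by (intro G.eq_if_inner_eq) (auto intro: bop_closed)
  qed (use B B' in auto)
qed (use B eq in auto)

context
  fixes G :: "'a::complex_vector hspace" and K :: "'b::complex_vector hspace"
  assumes G: "hilbert_space G" and K: "hilbert_space K"
begin

interpretation G: hilbert G by unfold_locales (rule G)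
interpretation K: hilbert K by unfold_locales (rule K)

text \<open>Riesz gives each value of the adjoint; linearity follows by testing against
  \<open>G\<close>, and the bound from \<open>|B y|^2 = <A (B y), y>\<close>.\<close>

lemma ex_adjoint:
  assumes A: "A \<in> bop G K"
  shows "\<exists>B\<in>bop K G. \<forall>x\<in>hcarrier G. \<forall>y\<in>hcarrier K. hinner K (A x) y = hinner G x (B y)"
proof -
  obtain C0 where C0: "\<And>x. x \<in> hcarrier G \<Longrightarrow> hnorm K (A x) \<le> C0 * hnorm G x"
    using bop_bound[OF A] by blast
  \<comment> \<open>The constant in \<open>bop\<close> may be negative; the bound at vectors with
    \<open>B y = 0\<close> needs a nonnegative one.\<close>
  define C where "C = \<bar>C0\<bar>"
  have C: "hnorm K (A x) \<le> C * hnorm G x" if x: "x \<in> hcarrier G" for x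
  proof -
    have "C0 * hnorm G x \<le> C * hnorm G x"
      using x by (intro mult_right_mono) (auto simp: C_def)
    then show ?thesis using C0[OF x] by linarith
  qed
  have "\<exists>b\<in>hcarrier G. \<forall>x\<in>hcarrier G. hinner K y (A x) = hinner G b x" if y: "y \<in> hcarrier K" for y
  proof (rule G.riesz[of "\<lambda>x. hinner K y (A x)" "hnorm K y * C"])
    fix x assume x: "x \<in> hcarrier G"
    have "cmod (hinner K y (A x)) \<le> hnorm K y * hnorm K (A x)"
      using x y bop_closed[OF A] by (intro K.cauchy_schwarz) auto
    also have "\<dots> \<le> hnorm K y * (C * hnorm G x)"
      using C[OF x] y by (intro mult_left_mono) auto
    finally show "cmod (hinner K y (A x)) \<le> hnorm K y * C * hnorm G x" by (simp add: mult.assoc)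
  qed (use y in \<open>auto simp: bop_add[OF A] bop_scale[OF A] bop_closed[OF A] K.inner_add_right
      K.inner_scale_right\<close>)
  then obtain b where b: "\<And>y. y \<in> hcarrier K \<Longrightarrow> b y \<in> hcarrier G"
    "\<And>y x. y \<in> hcarrier K \<Longrightarrow> x \<in> hcarrier G \<Longrightarrow> hinner K y (A x) = hinner G (b y) x"
    by metis
  define B where "B y = (if y \<in> hcarrier K then b y else 0)" for y
  have B: "hinner K (A x) y = hinner G x (B y)" if "x \<in> hcarrier G" "y \<in> hcarrier K" for x y
    using b(1)[OF that(2)] b(2)[OF that(2,1)] that bop_closed[OF A that(1)]
      K.inner_commute[of "A x" y] G.inner_commute[of x "b y"] by (simp add: B_def)
  have Bc: "B y \<in> hcarrier G" if "y \<in> hcarrier K" for y using that b by (simp add: B_def)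
  have "B \<in> bop K G"
  proof (rule bopI[where C = C])
    fix y y' assume "y \<in> hcarrier K" "y' \<in> hcarrier K"
    then show "B (y + y') = B y + B y'"
      by (intro G.eq_if_inner_eq)
        (auto simp: Bc B[symmetric] G.inner_add_right K.inner_add_right bop_closed[OF A])
  next
    fix c y assume "y \<in> hcarrier K"
    then show "B (c *\<^sub>C y) = c *\<^sub>C B y"
      by (intro G.eq_if_inner_eq)
        (auto simp: Bc B[symmetric] G.inner_scale_right K.inner_scale_right bop_closed[OF A])
  next
    fix y assume y: "y \<in> hcarrier K"
    have "hinner G (B y) (B y) = hinner K (A (B y)) y" using y by (simp add: B Bc)
    then have "cmod (hinner G (B y) (B y)) \<le> hnorm K (A (B y)) * hnorm K y"
      using y by (simp add: K.cauchy_schwarz bop_closed[OF A] Bc)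
    also have "\<dots> \<le> C * hnorm G (B y) * hnorm K y"
      using y by (intro mult_right_mono C) (auto simp: Bc)
    finally have "hnorm G (B y) * hnorm G (B y) \<le> hnorm G (B y) * (C * hnorm K y)"
      using y by (simp add: G.inner_self[OF Bc] power2_eq_square norm_mult mult_ac)
    then show "hnorm G (B y) \<le> C * hnorm K y"
      using y Bc[OF y] G.norm_nonneg[OF Bc[OF y]]
      by (cases "hnorm G (B y) = 0") (auto simp: C_def)
  qed (auto simp: Bc, simp add: B_def)
  then show ?thesis using B by blast
qed

lemma
  assumes A: "A \<in> bop G K"
  shows adj_bop: "adj G K A \<in> bop K G"
    and inner_adj_right:
      "x \<in> hcarrier G \<Longrightarrow> y \<in> hcarrier K \<Longrightarrow> hinner G x (adj G K A y) = hinner K (A x) y"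
  using ex_adjoint[OF A] adj_eqI[OF G] by metis+

lemma inner_adj_left:
  assumes A: "A \<in> bop G K" and "x \<in> hcarrier G" "y \<in> hcarrier K"
  shows "hinner G (adj G K A y) x = hinner K y (A x)"
  using inner_adj_right[OF assms] G.inner_commute K.inner_commute adj_bop[OF A] bop_closed assms
  by metis

end

lemma (in hilbert) star_hid: "star H (hid H) = hid H"
  by (rule adj_eqI[OF hilbert_space]) (simp_all add: hid_def)

lemma (in hilbert) star_star:
  assumes "A \<in> bops H"
  shows "star H (star H A) = A"
  by (rule adj_eqI[OF hilbert_space assms])
    (simp add: inner_adj_left[OF hilbert_space hilbert_space assms])

lemma (in hilbert) bops_comp: "A \<in> bops H \<Longrightarrow> B \<in> bops H \<Longrightarrow> A \<circ> B \<in> bops H"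
  by (rule bop_comp[OF _ _ hilbert_space hilbert_space])

lemma (in hilbert) star_bop: "A \<in> bops H \<Longrightarrow> star H A \<in> bops H"
  by (rule adj_bop[OF hilbert_space hilbert_space])

lemma (in hilbert) star_comp:
  assumes A: "A \<in> bops H" and B: "B \<in> bops H"
  shows "star H (A \<circ> B) = star H B \<circ> star H A"
  by (rule adj_eqI[OF hilbert_space bops_comp[OF star_bop[OF B] star_bop[OF A]]])
    (simp add: inner_adj_right[OF hilbert_space hilbert_space] A B bop_closed[OF B]
      bop_closed[OF star_bop[OF A]])

text \<open>The rank-one operators \<open>x \<mapsto> <e, x> h\<close> suffice: evaluating the
  commutation relation at \<open>e\<close> gives \<open><e, e> B h = <e, B e> h\<close>, with the
  same factor for every \<open>h\<close>.\<close>

lemma (in hilbert) commutant_scalar: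
  assumes B: "B \<in> bops H" and comm: "\<And>A. A \<in> bops H \<Longrightarrow> B \<circ> A = A \<circ> B"
  obtains c where "B = c *\<^sub>C hid H"
proof (cases "hcarrier H = {0}")
  case True
  have "B x = 0" for x using True bop_zero[OF B] bop_off[OF B] by (cases "x = 0") auto
  then have "B = 0 *\<^sub>C hid H" by (auto simp: fun_eq_iff scaleC_apply)
  then show ?thesis by (rule that)
next
  case False
  then obtain e where e: "e \<in> hcarrier H" "e \<noteq> 0" using zero_closed by blast
  have ne: "hinner H e e \<noteq> 0" using e inner_self_eq_0 by blast
  have "B h = (hinner H e (B e) / hinner H e e) *\<^sub>C h" if h: "h \<in> hcarrier H" for h
  proof -
    define A where "A x = (if x \<in> hcarrier H then hinner H e x *\<^sub>C h else 0)" for x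
    have "A \<in> bops H"
    proof (rule bopI[where C = "hnorm H e * hnorm H h"])
      fix x assume x: "x \<in> hcarrier H"
      have "cmod (hinner H e x) * hnorm H h \<le> (hnorm H e * hnorm H x) * hnorm H h"
        using e h x by (intro mult_right_mono cauchy_schwarz) auto
      then show "hnorm H (A x) \<le> hnorm H e * hnorm H h * hnorm H x"
        using x h by (simp add: A_def norm_scale mult_ac)
    qed (use e h in \<open>auto simp: A_def inner_add_right inner_scale_right scaleC_add_left
          scaleC_scaleC\<close>)
    then have "B (A e) = A (B e)" using comm by (metis comp_apply)
    then have "hinner H e e *\<^sub>C B h = hinner H e (B e) *\<^sub>C h"
      using e h by (simp add: A_def bop_closed[OF B] bop_scale[OF B])
    then have "(1 / hinner H e e) *\<^sub>C hinner H e e *\<^sub>C B h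
        = (1 / hinner H e e) *\<^sub>C hinner H e (B e) *\<^sub>C h" by (rule arg_cong)
    then show ?thesis using ne by (simp only: scaleC_scaleC) (simp add: scaleC_one)
  qed
  then have "B = (hinner H e (B e) / hinner H e e) *\<^sub>C hid H"
    using bop_off[OF B] by (auto simp: fun_eq_iff scaleC_apply hid_def)
  then show ?thesis by (rule that)
qed

text \<open>The generators are required to hit every vector of the domain, so uniqueness is
  immediate and involves neither density nor continuity.\<close>

lemma extend_op_eqI:
  assumes "B \<in> bop G K" "e ` I = hcarrier G" "\<And>i. i \<in> I \<Longrightarrow> B (e i) = f i"
  shows "extend_op G K I e f = B"
  unfolding extend_op_def
proof (rule the_equality)
  fix A assume "A \<in> bop G K \<and> (\<forall>i\<in>I. A (e i) = f i)"
  then show "A = B" using assms by (intro bop_eqI) (auto simp flip: assms(2))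
qed (use assms in auto)

subsection \<open>Unitary identifications and completions of Gram kernels\<close>

text \<open>\<open>M\<close> is a bare record: its vector space, inner product and completeness laws
  are consequences of the identification. This is how completions below are shown to be Hilbert
  spaces.\<close>

locale hiso = hilbert H
  for H :: "'a::complex_vector hspace" +
  fixes M :: "'b::complex_vector hspace" and J :: "'a \<Rightarrow> 'b"
  assumes image: "J ` hcarrier H = hcarrier M"
    and J_add: "\<And>x y. x \<in> hcarrier H \<Longrightarrow> y \<in> hcarrier H \<Longrightarrow> J (x + y) = J x + J y"
    and J_scale: "\<And>c x. x \<in> hcarrier H \<Longrightarrow> J (c *\<^sub>C x) = c *\<^sub>C J x"
    and J_inner: "\<And>x y. x \<in> hcarrier H \<Longrightarrow> y \<in> hcarrier H \<Longrightarrow> hinner M (J x) (J y) = hinner H x y"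
begin

lemma J_closed [simp]: "x \<in> hcarrier H \<Longrightarrow> J x \<in> hcarrier M"
  using image by blast

lemma J_zero [simp]: "J 0 = 0"
  using J_scale[of 0 0] by simp

lemma J_diff: "x \<in> hcarrier H \<Longrightarrow> y \<in> hcarrier H \<Longrightarrow> J (x - y) = J x - J y"
  using J_add[of "x - y" y] by (simp add: algebra_simps)

lemma J_eqD:
  assumes "x \<in> hcarrier H" "y \<in> hcarrier H" "J x = J y"
  shows "x = y"
  using assms J_inner by (intro eq_if_inner_eq) metis+

lemma norm_J: "x \<in> hcarrier H \<Longrightarrow> hnorm M (J x) = hnorm H x"
  by (simp add: hnorm_def J_inner)

definition Ji :: "'b \<Rightarrow> 'a" where "Ji = inv_into (hcarrier H) J"

lemma Ji_J [simp]: "x \<in> hcarrier H \<Longrightarrow> Ji (J x) = x"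
  unfolding Ji_def by (meson J_eqD inj_onI inv_into_f_f)

lemma Ji_closed [simp]: "z \<in> hcarrier M \<Longrightarrow> Ji z \<in> hcarrier H"
  unfolding Ji_def by (rule inv_into_into) (simp add: image)

lemma J_Ji [simp]: "z \<in> hcarrier M \<Longrightarrow> J (Ji z) = z"
  unfolding Ji_def by (rule f_inv_into_f) (simp add: image)

lemma dist_J: "x \<in> hcarrier H \<Longrightarrow> y \<in> hcarrier H \<Longrightarrow> hdist M (J x) (J y) = hdist H x y"
  by (simp add: hdist_def norm_J flip: J_diff)

lemma ball_image: "(\<forall>z\<in>hcarrier M. P z) \<longleftrightarrow> (\<forall>x\<in>hcarrier H. P (J x))"
  by (simp flip: image)

lemma hilbert_space_image: "hilbert_space M"
proof -
  have sub: "cv.subspace (hcarrier M)"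
  proof (rule cv.subspaceI)
    show "0 \<in> hcarrier M" using J_closed[of 0] by simp
    show "x + y \<in> hcarrier M" if "x \<in> hcarrier M" "y \<in> hcarrier M" for x y
      using J_closed[of "Ji x + Ji y"] that by (simp add: J_add)
    show "c *\<^sub>C x \<in> hcarrier M" if "x \<in> hcarrier M" for c x
      using J_closed[of "c *\<^sub>C Ji x"] that by (simp add: J_scale)
  qed
  have norm: "0 \<le> hnorm M z" if "z \<in> hcarrier M" for z
    using norm_J[of "Ji z"] that norm_nonneg by simp
  have norm0: "hnorm M z = 0 \<longleftrightarrow> z = 0" if z: "z \<in> hcarrier M" for z
  proof -
    have "hnorm M z = 0 \<longleftrightarrow> Ji z = 0" using norm_J[of "Ji z"] z by simp
    also have "\<dots> \<longleftrightarrow> z = 0"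
    proof
      show "z = 0" if "Ji z = 0" using J_Ji[OF z] that by (simp only: J_zero)
      show "Ji z = 0" if "z = 0" using Ji_J[OF zero_closed] that by (simp only: J_zero)
    qed
    finally show ?thesis .
  qed
  have comm: "hnorm M (x - y) = hnorm M (y - x)" if "x \<in> hcarrier M" "y \<in> hcarrier M" for x y
    using norm_J[of "Ji x - Ji y"] norm_J[of "Ji y - Ji x"] that
    by (simp add: J_diff norm_minus_commute)
  interpret M: Metric_space "hcarrier M" "hdist M"
  proof
    fix x y z assume "x \<in> hcarrier M" "y \<in> hcarrier M" "z \<in> hcarrier M"
    moreover then have "hdist H (Ji x) (Ji z) \<le> hdist H (Ji x) (Ji y) + hdist H (Ji y) (Ji z)"
      using Metric_space Metric_space.triangle by fastforce
    ultimately show "hdist M x z \<le> hdist M x y + hdist M y z"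
      using dist_J[of "Ji x" "Ji z"] dist_J[of "Ji x" "Ji y"] dist_J[of "Ji y" "Ji z"] by simp
  qed (use cv.subspace_diff[OF sub] in \<open>auto simp: hdist_def norm norm0 comm\<close>)
  have "M.mcomplete"
    unfolding M.mcomplete_def
  proof (intro allI impI)
    fix \<sigma> assume \<sigma>: "M.MCauchy \<sigma>"
    then have c: "\<sigma> n \<in> hcarrier M" for n by (auto simp: M.MCauchy_def)
    have "\<exists>l. hlim (\<lambda>n. Ji (\<sigma> n)) l"
    proof (rule cauchy_hlim[of "\<lambda>n. Ji (\<sigma> n)"])
      fix \<epsilon> :: real assume "\<epsilon> > 0"
      then obtain N where "\<forall>n n'. N \<le> n \<longrightarrow> N \<le> n' \<longrightarrow> hdist M (\<sigma> n) (\<sigma> n') < \<epsilon>"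
        using \<sigma> unfolding M.MCauchy_def by blast
      then show "\<exists>N. \<forall>m\<ge>N. \<forall>n\<ge>N. hnorm H (Ji (\<sigma> m) - Ji (\<sigma> n)) < \<epsilon>"
        using dist_J[of "Ji (\<sigma> _)" "Ji (\<sigma> _)"] c by (auto simp: hdist_def)
    qed (use c in auto)
    then obtain l where l: "hlim (\<lambda>n. Ji (\<sigma> n)) l" by blast
    then have "l \<in> hcarrier H" and lim: "(\<lambda>n. hnorm H (Ji (\<sigma> n) - l)) \<longlonglongrightarrow> 0"
      by (simp_all add: hlim_def)
    moreover have "hdist M (\<sigma> n) (J l) = hnorm H (Ji (\<sigma> n) - l)" for n
      using dist_J[of "Ji (\<sigma> n)" l] c \<open>l \<in> hcarrier H\<close> by (simp add: hdist_def)
    ultimately have "limitin M.mtopology \<sigma> (J l) sequentially"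
      using lim c unfolding M.limitin_metric tendsto_iff by simp
    then show "\<exists>x. limitin M.mtopology \<sigma> x sequentially" by blast
  qed
  moreover have "\<forall>x\<in>hcarrier M. \<forall>y\<in>hcarrier M. hinner M x y = cnj (hinner M y x)"
    unfolding ball_image by (simp add: J_inner inner_commute[symmetric])
  moreover have "\<forall>x\<in>hcarrier M. \<forall>y\<in>hcarrier M. \<forall>z\<in>hcarrier M.
      hinner M x (y + z) = hinner M x y + hinner M x z"
    unfolding ball_image by (simp add: J_inner inner_add_right flip: J_add)
  moreover have "\<forall>c. \<forall>x\<in>hcarrier M. \<forall>y\<in>hcarrier M. hinner M x (c *\<^sub>C y) = c * hinner M x y"
    unfolding ball_image by (simp add: J_inner inner_scale_right flip: J_scale)
  moreover have "\<forall>x\<in>hcarrier M. hinner M x x \<in> \<real>\<^sub>\<ge>\<^sub>0"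
    unfolding ball_image by (simp add: J_inner inner_self_nonneg)
  moreover have "\<forall>x\<in>hcarrier M. hinner M x x = 0 \<longrightarrow> x = 0"
    unfolding ball_image by (auto simp: J_inner dest: inner_self_eq_0)
  ultimately show ?thesis using sub by (simp only: hilbert_space_def simp_thms)
qed

end

lemma transported_op:
  assumes "hiso H M J" "hiso H' N L" "A \<in> bop H H'"
  obtains B where "B \<in> bop M N" "\<And>x. x \<in> hcarrier H \<Longrightarrow> B (J x) = L (A x)"
proof -
  interpret J: hiso H M J by fact
  interpret L: hiso H' N L by fact
  interpret M: hilbert M by unfold_locales (rule J.hilbert_space_image)
  obtain C where C: "\<And>x. x \<in> hcarrier H \<Longrightarrow> hnorm H' (A x) \<le> C * hnorm H x"
    using bop_bound[OF assms(3)] by blast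
  define B where "B z = (if z \<in> hcarrier M then L (A (J.Ji z)) else 0)" for z
  have BJ: "B (J x) = L (A x)" if "x \<in> hcarrier H" for x using that by (simp add: B_def)
  note Ac = bop_closed[OF assms(3)]
  have "B \<in> bop M N"
  proof (rule bopI[where C = C])
    show "B z = 0" if "z \<notin> hcarrier M" for z using that by (simp add: B_def)
    show "B z \<in> hcarrier N" if "z \<in> hcarrier M" for z using that by (simp add: B_def Ac)
    fix x assume "x \<in> hcarrier M"
    then obtain x' where x': "x = J x'" "x' \<in> hcarrier H" using J.image by blast
    then show "hnorm N (B x) \<le> C * hnorm M x" by (simp add: BJ L.norm_J J.norm_J Ac C)
    show "B (c *\<^sub>C x) = c *\<^sub>C B x" for c
      using x' by (simp add: BJ bop_scale[OF assms(3)] L.J_scale Ac flip: J.J_scale)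
    fix y assume "y \<in> hcarrier M"
    then obtain y' where "y = J y'" "y' \<in> hcarrier H" using J.image by blast
    then show "B (x + y) = B x + B y"
      using x' by (simp add: BJ bop_add[OF assms(3)] L.J_add Ac flip: J.J_add)
  qed
  then show ?thesis using BJ that by blast
qed

text \<open>This computes operators given on generators: in the coordinates \<open>J\<close> and
  \<open>L\<close> the prescription reads \<open>v i \<mapsto> A (v i)\<close>, and since the
  \<open>v i\<close> exhaust \<open>H\<close>, the described operator can only be
  \<open>L A J^{-1}\<close>.\<close>

lemma extend_op_transported:
  assumes J: "hiso H M J" and L: "hiso H' N L" and A: "A \<in> bop H H'"
    and v: "v ` I = hcarrier H"
    and e: "\<And>i. i \<in> I \<Longrightarrow> e i = J (v i)"
    and f: "\<And>i. i \<in> I \<Longrightarrow> f i = L (A (v i))"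
  shows "extend_op M N I e f \<in> bop M N"
    and "x \<in> hcarrier H \<Longrightarrow> extend_op M N I e f (J x) = L (A x)"
proof -
  obtain B where B: "B \<in> bop M N" "\<And>x. x \<in> hcarrier H \<Longrightarrow> B (J x) = L (A x)"
    using transported_op[OF J L A] by blast
  have "extend_op M N I e f = B"
  proof (rule extend_op_eqI[OF B(1)])
    have "e ` I = J ` v ` I" using e by (auto simp: image_comp)
    then show "e ` I = hcarrier M" using hiso.image[OF J] v by simp
    show "B (e i) = f i" if "i \<in> I" for i
      using that v B(2)[of "v i"] by (auto simp: e f)
  qed
  then show "extend_op M N I e f \<in> bop M N"
    "x \<in> hcarrier H \<Longrightarrow> extend_op M N I e f (J x) = L (A x)" using B by auto
qed

lemma hiso_id:
  assumes "hilbert_space H"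
  shows "hiso H H (\<lambda>x. x)"
proof -
  interpret hilbert H by unfold_locales (rule assms)
  show ?thesis by unfold_locales auto
qed

text \<open>This is the function by which \<open>completion\<close> represents a class: a sequence
  of combinations converging to \<open>x\<close> has the limits \<open><v_i, x>\<close> on the
  generators.\<close>

definition coords :: "'a hspace \<Rightarrow> 'i set \<Rightarrow> ('i \<Rightarrow> 'a) \<Rightarrow> 'a \<Rightarrow> 'i \<Rightarrow> complex" where
  "coords H I v x = (\<lambda>i. if i \<in> I then hinner H (v i) x else 0)"

context hilbert
begin

context
  fixes I :: "'i set" and k :: "'i \<Rightarrow> 'i \<Rightarrow> complex" and v :: "'i \<Rightarrow> 'a"
  assumes v: "v ` I = hcarrier H"
    and k: "\<And>i j. i \<in> I \<Longrightarrow> j \<in> I \<Longrightarrow> k i j = hinner H (v i) (v j)"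
begin

definition lin_comb :: "('i \<Rightarrow>\<^sub>0 complex) \<Rightarrow> 'a" where
  "lin_comb c = (\<Sum>i\<in>Poly_Mapping.keys c. Poly_Mapping.lookup c i *\<^sub>C v i)"

lemma v_closed: "i \<in> I \<Longrightarrow> v i \<in> hcarrier H"
  using v by blast

lemma lin_comb_closed [simp]: "Poly_Mapping.keys c \<subseteq> I \<Longrightarrow> lin_comb c \<in> hcarrier H"
  unfolding lin_comb_def by (intro sum_closed) (auto intro: v_closed)

lemma lin_comb_superset:
  assumes "finite A" "Poly_Mapping.keys c \<subseteq> A"
  shows "lin_comb c = (\<Sum>i\<in>A. Poly_Mapping.lookup c i *\<^sub>C v i)"
  unfolding lin_comb_def using assms by (intro sum.mono_neutral_left) (auto simp: in_keys_iff)

lemma lin_comb_diff: "lin_comb (c - d) = lin_comb c - lin_comb d"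
proof -
  let ?A = "Poly_Mapping.keys c \<union> Poly_Mapping.keys d"
  have "Poly_Mapping.keys (c - d) \<subseteq> ?A" by (rule keys_diff)
  then show ?thesis
    using lin_comb_superset[of ?A c] lin_comb_superset[of ?A d] lin_comb_superset[of ?A "c - d"]
    by (simp add: lookup_minus cv.scale_left_diff_distrib sum_subtractf)
qed

lemma lin_comb_single [simp]: "lin_comb (Poly_Mapping.single i 1) = v i"
  by (simp add: lin_comb_def scaleC_one)

lemma gram_eq:
  assumes "Poly_Mapping.keys c \<subseteq> I" "Poly_Mapping.keys d \<subseteq> I"
  shows "gram k c d = hinner H (lin_comb c) (lin_comb d)"
proof -
  have "hinner H (lin_comb c) (lin_comb d) =
      (\<Sum>i\<in>Poly_Mapping.keys c. \<Sum>j\<in>Poly_Mapping.keys d.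
        hinner H (Poly_Mapping.lookup c i *\<^sub>C v i) (Poly_Mapping.lookup d j *\<^sub>C v j))"
    unfolding lin_comb_def using assms
    by (subst inner_sum_left) (auto simp: subset_iff v_closed intro!: sum_closed sum.cong inner_sum_right)
  also have "\<dots> = gram k c d"
    unfolding gram_def using assms
    by (intro sum.cong refl) (auto simp: subset_iff k v_closed inner_scale_left inner_scale_right)
  finally show ?thesis by simp
qed

text \<open>The Gram seminorm of a combination is the norm of its realisation in \<open>H\<close>,
  so Cauchy sequences converge there by completeness, and the limit determines the class.\<close>

lemma gram_cauchy_hlim:
  assumes "gram_cauchy I k s"
  obtains l where "hlim (\<lambda>n. lin_comb (s n)) l" "cauchy_class I k s = coords H I v l"
proof -
  have keys: "Poly_Mapping.keys (s n) \<subseteq> I" for n using assms by (simp add: gram_cauchy_def)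
  have keys': "Poly_Mapping.keys (s m - s n) \<subseteq> I" for m n
    using keys_diff[of "s m" "s n"] keys[of m] keys[of n] by blast
  have "\<exists>l. hlim (\<lambda>n. lin_comb (s n)) l"
  proof (rule cauchy_hlim[of "\<lambda>n. lin_comb (s n)"])
    fix \<epsilon> :: real assume "\<epsilon> > 0"
    then show "\<exists>N. \<forall>m\<ge>N. \<forall>n\<ge>N. hnorm H (lin_comb (s m) - lin_comb (s n)) < \<epsilon>"
      using assms by (simp add: gram_cauchy_def gram_eq keys' lin_comb_diff hnorm_def)
  qed (auto simp: keys)
  then obtain l where l: "hlim (\<lambda>n. lin_comb (s n)) l" by blast
  have "lim (\<lambda>n. gram k (Poly_Mapping.single i 1) (s n)) = hinner H (v i) l" if "i \<in> I" for i
    using hlim_inner_right[OF l, of "v i"] that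
    by (intro limI) (simp add: gram_eq keys v_closed)
  then have "cauchy_class I k s = coords H I v l"
    by (auto simp: cauchy_class_def coords_def)
  with l show ?thesis by (rule that)
qed

lemma coords_eqD:
  assumes "x \<in> hcarrier H" "y \<in> hcarrier H" "coords H I v x = coords H I v y"
  shows "x = y"
proof (rule eq_if_inner_eq)
  fix z assume "z \<in> hcarrier H"
  then obtain i where "i \<in> I" "z = v i" using v by blast
  then show "hinner H z x = hinner H z y"
    using fun_cong[OF assms(3), of i] by (simp add: coords_def)
qed (use assms in auto)

lemma
  assumes "i \<in> I"
  shows gram_cauchy_const: "gram_cauchy I k (\<lambda>_. Poly_Mapping.single i 1)"
    and gen_eq_coords: "gen I k i = coords H I v (v i)"
proof -
  show *: "gram_cauchy I k (\<lambda>_. Poly_Mapping.single i 1)"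
    using assms by (simp add: gram_cauchy_def gram_def)
  show "gen I k i = coords H I v (v i)"
    unfolding gen_def cauchy_class_def coords_def
    using assms by (intro ext) (simp add: gram_eq)
qed

text \<open>\<open>completion\<close> picks representatives by choice. Any representative of the
  class of \<open>x\<close> converges in \<open>H\<close>, and only to \<open>x\<close> because
  coordinates separate vectors, so the choice does not affect the inner product.\<close>

lemma hinner_completion:
  assumes "x \<in> hcarrier H" "y \<in> hcarrier H"
  shows "hinner (completion I k) (coords H I v x) (coords H I v y) = hinner H x y"
proof -
  have "hlim (\<lambda>n. lin_comb (cauchy_rep I k (coords H I v x) n)) x \<and>
      (\<forall>n. Poly_Mapping.keys (cauchy_rep I k (coords H I v x) n) \<subseteq> I)"
    if x: "x \<in> hcarrier H" for x
  proof -
    have "x \<in> v ` I" using x v by simp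
    then obtain i where i: "i \<in> I" "x = v i" by (elim imageE)
    let ?s = "cauchy_rep I k (coords H I v x)"
    have "\<exists>s. gram_cauchy I k s \<and> cauchy_class I k s = coords H I v x"
      using gram_cauchy_const[OF i(1)] gen_eq_coords[OF i(1)] i(2) unfolding gen_def by blast
    then have s: "gram_cauchy I k ?s \<and> cauchy_class I k ?s = coords H I v x"
      unfolding cauchy_rep_def by (rule someI_ex)
    then obtain l where l: "hlim (\<lambda>n. lin_comb (?s n)) l" "cauchy_class I k ?s = coords H I v l"
      using gram_cauchy_hlim by blast
    then have "l = x" using s x by (intro coords_eqD) (auto simp: hlim_def)
    then show ?thesis using l s by (auto simp: gram_cauchy_def)
  qed
  note * = this[OF assms(1)] this[OF assms(2)]
  show ?thesis
    unfolding completion_def hspace.simps using * by (intro limI) (simp add: gram_eq hlim_inner)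
qed

text \<open>Constant sequences of generators already reach every vector of \<open>H\<close>, and
  completeness of \<open>H\<close> shows that other Cauchy sequences add nothing.\<close>

lemma hiso_completion: "hiso H (completion I k) (coords H I v)"
proof
  show "coords H I v ` hcarrier H = hcarrier (completion I k)"
  proof (intro subset_antisym subsetI)
    fix f assume "f \<in> coords H I v ` hcarrier H"
    then have "f \<in> coords H I v ` v ` I" using v by simp
    then obtain i where i: "i \<in> I" "f = coords H I v (v i)" by (elim imageE) simp
    show "f \<in> hcarrier (completion I k)"
      unfolding completion_def hspace.simps i(2) gen_eq_coords[OF i(1), symmetric] gen_def
      using gram_cauchy_const[OF i(1)] by (intro imageI) simp
  next
    fix f assume "f \<in> hcarrier (completion I k)"
    then obtain s where "f = cauchy_class I k s" "gram_cauchy I k s"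
      by (auto simp: completion_def)
    then show "f \<in> coords H I v ` hcarrier H"
      using gram_cauchy_hlim[of s] by (metis hlim_def imageI)
  qed
  fix x y assume xy: "x \<in> hcarrier H" "y \<in> hcarrier H"
  show "coords H I v (x + y) = coords H I v x + coords H I v y"
    using xy by (simp add: coords_def fun_eq_iff inner_add_right v_closed)
  show "hinner (completion I k) (coords H I v x) (coords H I v y) = hinner H x y"
    using xy by (rule hinner_completion)
next
  fix c x assume "x \<in> hcarrier H"
  then show "coords H I v (c *\<^sub>C x) = c *\<^sub>C coords H I v x"
    by (simp add: coords_def fun_eq_iff scaleC_apply scaleC_complex_def inner_scale_right v_closed)
qed

end

end

section \<open>The Muhly--Solel spaces of a semigroup of endomorphisms\<close>

lemma sorted_le_last: "sorted xs \<Longrightarrow> x \<in> set xs \<Longrightarrow> x \<le> last xs"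
  by (induction xs) (auto dest: last_in_set)

locale endo_semigroup = hilbert H
  for H :: "'a::complex_vector hspace" +
  fixes \<phi> :: "real \<Rightarrow> ('a \<Rightarrow> 'a) \<Rightarrow> 'a \<Rightarrow> 'a"
  assumes cp0: "cp0_semigroup H \<phi>"
    and endo: "\<And>t. 0 \<le> t \<Longrightarrow> star_endomorphism H (\<phi> t)"
begin

lemma phi_bop [simp]: "0 \<le> t \<Longrightarrow> A \<in> bops H \<Longrightarrow> \<phi> t A \<in> bops H"
  using endo[of t] unfolding star_endomorphism_def linear_on_bops_def by blast

lemma phi_comp: "0 \<le> t \<Longrightarrow> A \<in> bops H \<Longrightarrow> B \<in> bops H \<Longrightarrow> \<phi> t (A \<circ> B) = \<phi> t A \<circ> \<phi> t B"
  using endo[of t] unfolding star_endomorphism_def by blast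

lemma phi_star: "0 \<le> t \<Longrightarrow> A \<in> bops H \<Longrightarrow> \<phi> t (star H A) = star H (\<phi> t A)"
  using endo[of t] unfolding star_endomorphism_def by blast

lemma phi_hid [simp]: "0 \<le> t \<Longrightarrow> \<phi> t (hid H) = hid H"
  using cp0 unfolding cp0_semigroup_def cp_map_def by blast

lemma phi_0: "A \<in> bops H \<Longrightarrow> \<phi> 0 A = A"
  using cp0 unfolding cp0_semigroup_def by blast

lemma phi_add: "0 \<le> s \<Longrightarrow> 0 \<le> t \<Longrightarrow> A \<in> bops H \<Longrightarrow> \<phi> (s + t) A = \<phi> s (\<phi> t A)"
  using cp0 unfolding cp0_semigroup_def by blast

lemma hid_comp_bops [simp]: "A \<in> bops H \<Longrightarrow> hid H \<circ> A = A"
  by (rule hid_comp[OF hilbert_space])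

text \<open>For endomorphisms, \<open>a\<^sub>1 \<otimes> \<dots> \<otimes> a\<^sub>n \<otimes> h\<close> equals \<open>I \<otimes> \<dots> \<otimes> I \<otimes> wh\<close> with
  \<open>w = \<phi>\<^bsub>t-t\<^sub>0\<^esub>(a\<^sub>1) \<dots> \<phi>\<^bsub>t-t\<^sub>n\<^sub>-\<^sub>1\<^esub>(a\<^sub>n)\<close>.\<close>

primrec word :: "real \<Rightarrow> (real \<Rightarrow> 'a \<Rightarrow> 'a) \<Rightarrow> real list \<Rightarrow> 'a \<Rightarrow> 'a" where
  "word t a [] = hid H"
| "word t a (p # ps) = \<phi> (t - p) (a p) \<circ> word t a ps"

lemma word_bop:
  "(\<And>p. p \<in> set ps \<Longrightarrow> p \<le> t) \<Longrightarrow> (\<And>r. a r \<in> bops H) \<Longrightarrow> word t a ps \<in> bops H"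
  by (induction ps) (simp_all add: bops_comp)

lemma word_cong: "(\<And>p. p \<in> set ps \<Longrightarrow> a p = b p) \<Longrightarrow> word t a ps = word t b ps"
  by (induction ps) simp_all

text \<open>Points carrying the identity contribute a factor \<open>I\<close>; this makes words
  insensitive to refinement of the partition.\<close>

lemma word_filter:
  assumes "\<And>p. p \<in> set ps \<Longrightarrow> p \<le> t" "\<And>r. a r \<in> bops H"
    and "\<And>p. p \<in> set ps \<Longrightarrow> \<not> Q p \<Longrightarrow> a p = hid H"
  shows "word t a (filter Q ps) = word t a ps"
  using assms by (induction ps) (simp_all add: word_bop)

lemma word_hid: "(\<And>p. p \<in> set ps \<Longrightarrow> p \<le> t) \<Longrightarrow> word t (\<lambda>_. hid H) ps = hid H"
  by (induction ps) simp_all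

text \<open>Multiplicativity splits the image of \<open>a^* C b\<close>, and the semigroup law
  merges consecutive time steps into \<open>t - p\<close>. The operator \<open>C\<close> is general
  because each recursive call of \<open>ms_nest\<close> puts the part already evaluated in its
  place.\<close>

lemma nest_eq_word:
  assumes "sorted ps" "ps \<noteq> []" "last ps = t" "\<And>r. a r \<in> bops H" "\<And>r. b r \<in> bops H"
    and "a t = hid H" "b t = hid H" "C \<in> bops H"
  shows "ms_nest H \<phi> a b ps C = star H (word t a ps) \<circ> \<phi> (t - hd ps) C \<circ> word t b ps"
  using assms(1-3,8)
proof (induction ps arbitrary: C)
  case (Cons p ps)
  note C = \<open>C \<in> bops H\<close>
  show ?case
  proof (cases ps)
    case Nil
    \<comment> \<open>\<open>ms_nest\<close> ignores the last point while \<open>word\<close>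
      includes it; the two agree because the letter at \<open>t\<close> is the identity.\<close>
    with Cons.prems have "p = t" by simp
    then show ?thesis
      using Nil C comp_hid[OF C] by (simp add: phi_0 assms(6,7) star_hid)
  next
    case (Cons q qs)
    have le: "r \<le> t" if "r \<in> set (p # ps)" for r
      using sorted_le_last[OF Cons.prems(1) that] Cons.prems(3) by simp
    have pq: "p \<le> q" "q \<le> t" using Cons.prems(1) le Cons by auto
    let ?D = "star H (a p) \<circ> C \<circ> b p"
    have D: "?D \<in> bops H" by (simp add: bops_comp star_bop C assms(4,5))
    have "ms_nest H \<phi> a b (p # ps) C = ms_nest H \<phi> a b ps (\<phi> (q - p) ?D)"
      by (simp add: Cons)
    also have "\<dots> = star H (word t a ps) \<circ> \<phi> (t - hd ps) (\<phi> (q - p) ?D) \<circ> word t b ps"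
      using Cons.prems Cons pq D by (intro Cons.IH) auto
    also have "\<phi> (t - hd ps) (\<phi> (q - p) ?D) = \<phi> (t - p) ?D"
      using phi_add[of "t - q" "q - p" ?D] pq D by (simp add: Cons)
    also have "\<dots> = star H (\<phi> (t - p) (a p)) \<circ> \<phi> (t - p) C \<circ> \<phi> (t - p) (b p)"
      using pq by (simp add: phi_comp phi_star bops_comp star_bop C assms(4,5))
    also have "star H (word t a ps) \<circ> (star H (\<phi> (t - p) (a p)) \<circ> \<phi> (t - p) C \<circ> \<phi> (t - p) (b p))
        \<circ> word t b ps = star H (\<phi> (t - p) (a p) \<circ> word t a ps) \<circ> \<phi> (t - p) C \<circ> word t b (p # ps)"
      using pq le by (simp add: star_comp word_bop assms(4,5) comp_assoc)
    finally show ?thesis by (simp only: word.simps list.sel)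
  qed
qed simp

section \<open>Partition spaces and their direct limit identified with \<open>H\<close>\<close>

definition part_vec :: "real \<Rightarrow> real set \<Rightarrow> 'a ms_idx \<Rightarrow> 'a" where
  "part_vec t P = (\<lambda>(a, h). word t a (sorted_list_of_set P) h)"

definition part_map :: "real \<Rightarrow> real set \<Rightarrow> 'a \<Rightarrow> 'a ms_part_vec" where
  "part_map t P = coords H (ms_idx H t P) (part_vec t P)"

definition lim_vec :: "real \<Rightarrow> real set \<times> 'a ms_part_vec \<Rightarrow> 'a" where
  "lim_vec t = (\<lambda>(P, z). hiso.Ji H (part_map t P) z)"

text \<open>On \<open>H\<close> this is \<iota>_t, since
  \<open>I \<otimes> \<dots> \<otimes> I \<otimes> h\<close> is realised by \<open>h\<close>; that
  it maps onto \<open>H_t\<close> is the unitarity of \<iota>_t.\<close>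

definition space_map :: "real \<Rightarrow> 'a \<Rightarrow> 'a ms_vec" where
  "space_map t = coords H (ms_lim_idx H \<phi> t) (lim_vec t)"

lemma ms_idx_bops: "(a, h) \<in> ms_idx H t P \<Longrightarrow> a r \<in> bops H"
  by (cases "r \<in> P - {t}") (auto simp: ms_idx_def)

lemma ms_idx_h: "(a, h) \<in> ms_idx H t P \<Longrightarrow> h \<in> hcarrier H"
  by (simp add: ms_idx_def)

lemma hid_in_ms_idx: "h \<in> hcarrier H \<Longrightarrow> (\<lambda>_. hid H, h) \<in> ms_idx H t P"
  by (simp add: ms_idx_def)

context
  fixes t :: real
  assumes t: "0 < t"
begin

lemma partitions_set:
  assumes "P \<in> partitions t"
  shows "set (sorted_list_of_set P) = P" "\<And>p. p \<in> P \<Longrightarrow> 0 \<le> p \<and> p \<le> t" "0 \<in> P" "t \<in> P" "finite P"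
  using assms by (auto simp: partitions_def)

lemma partitions_list:
  assumes "P \<in> partitions t"
  shows "sorted_list_of_set P \<noteq> []" "hd (sorted_list_of_set P) = 0" "last (sorted_list_of_set P) = t"
proof -
  note P = partitions_set[OF assms]
  show ne: "sorted_list_of_set P \<noteq> []" using P by auto
  have "Min P = 0" using P by (intro Min_eqI) auto
  then show "hd (sorted_list_of_set P) = 0"
    using sorted_list_of_set_nonempty[of P] P(3,5) by force
  have "p \<le> last (sorted_list_of_set P)" if "p \<in> P" for p
    using P that by (intro sorted_le_last) auto
  moreover have "last (sorted_list_of_set P) \<in> P" using last_in_set[OF ne] P by simp
  ultimately show "last (sorted_list_of_set P) = t" using P by force
qed

lemma word_partition_bop:
  assumes "P \<in> partitions t" "(a, h) \<in> ms_idx H t P"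
  shows "word t a (sorted_list_of_set P) \<in> bops H"
  using partitions_set[OF assms(1)] ms_idx_bops[OF assms(2)] by (intro word_bop) auto

lemma part_vec_hid:
  assumes "P \<in> partitions t" "h \<in> hcarrier H"
  shows "part_vec t P (\<lambda>_. hid H, h) = h"
proof -
  have "word t (\<lambda>_. hid H) (sorted_list_of_set P) = hid H"
    using partitions_set[OF assms(1)] by (intro word_hid) auto
  then show ?thesis using assms(2) by (simp add: part_vec_def hid_def)
qed

lemma part_vec_image:
  assumes P: "P \<in> partitions t"
  shows "part_vec t P ` ms_idx H t P = hcarrier H"
proof (intro subset_antisym subsetI)
  fix x assume "x \<in> part_vec t P ` ms_idx H t P"
  then show "x \<in> hcarrier H"
    by (auto simp: part_vec_def ms_idx_h intro!: bop_closed[OF word_partition_bop[OF P]])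
next
  fix h assume "h \<in> hcarrier H"
  then show "h \<in> part_vec t P ` ms_idx H t P"
    using part_vec_hid[OF P] hid_in_ms_idx by (metis imageI)
qed

lemma part_vec_closed: "P \<in> partitions t \<Longrightarrow> i \<in> ms_idx H t P \<Longrightarrow> part_vec t P i \<in> hcarrier H"
  using part_vec_image by (metis imageI)

text \<open>The middle factor \<phi>_t(I) = I drops out of the nested product, which leaves the
  inner product of two words applied to vectors of \<open>H\<close>.\<close>

lemma ms_kernel_eq:
  assumes P: "P \<in> partitions t" and i: "i \<in> ms_idx H t P" and j: "j \<in> ms_idx H t P"
  shows "ms_kernel H \<phi> P i j = hinner H (part_vec t P i) (part_vec t P j)"
proof -
  obtain a h b k where ij: "i = (a, h)" "j = (b, k)" by (meson surj_pair)
  note a = i[unfolded ij] and b = j[unfolded ij]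
  have "a t = hid H" "b t = hid H" using a b by (auto simp: ms_idx_def)
  then have "ms_nest H \<phi> a b (sorted_list_of_set P) (hid H) =
      star H (word t a (sorted_list_of_set P)) \<circ> \<phi> t (hid H) \<circ> word t b (sorted_list_of_set P)"
    using nest_eq_word[of "sorted_list_of_set P" t a b "hid H"] partitions_list[OF P]
      ms_idx_bops[OF a] ms_idx_bops[OF b] by simp
  also have "\<dots> = star H (word t a (sorted_list_of_set P)) \<circ> word t b (sorted_list_of_set P)"
    using t by (simp add: comp_hid[OF star_bop] word_partition_bop[OF P a])
  finally show ?thesis
    using word_partition_bop[OF P a] word_partition_bop[OF P b] a b
    by (simp add: ij ms_kernel_def part_vec_def ms_idx_h bop_closed
        inner_adj_right[OF hilbert_space hilbert_space])
qed

lemma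
  assumes P: "P \<in> partitions t"
  shows hiso_part: "hiso H (ms_part_space H \<phi> t P) (part_map t P)"
    and part_elem_eq: "i \<in> ms_idx H t P \<Longrightarrow> ms_part_elem H \<phi> t P i = part_map t P (part_vec t P i)"
  unfolding ms_part_space_def part_map_def ms_part_elem_def
  using hiso_completion[OF part_vec_image[OF P] ms_kernel_eq[OF P]]
    gen_eq_coords[OF part_vec_image[OF P] ms_kernel_eq[OF P]] by blast+

lemma ms_idx_mono:
  assumes "P \<subseteq> Q" "i \<in> ms_idx H t P"
  shows "i \<in> ms_idx H t Q"
proof -
  obtain a h where i: "i = (a, h)" by (cases i)
  note a = assms(2)[unfolded i]
  have "a r = hid H" if "r \<notin> Q - {t}" for r
  proof -
    have "r \<notin> P - {t}" using that assms(1) by blast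
    then show ?thesis using a unfolding ms_idx_def by simp
  qed
  then show ?thesis using ms_idx_bops[OF a] ms_idx_h[OF a] by (simp add: i ms_idx_def)
qed

text \<open>A point added by refinement carries the identity. Hence the refinement maps become the
  identity of \<open>H\<close>.\<close>

lemma part_vec_mono:
  assumes P: "P \<in> partitions t" and Q: "Q \<in> partitions t" and "P \<subseteq> Q" and i: "i \<in> ms_idx H t P"
  shows "part_vec t Q i = part_vec t P i"
proof -
  obtain a h where ah: "i = (a, h)" by (cases i)
  have "sorted_list_of_set P = filter (\<lambda>p. p \<in> P) (sorted_list_of_set Q)"
    using partitions_set[OF P] partitions_set[OF Q] \<open>P \<subseteq> Q\<close>
    by (intro sorted_distinct_set_unique) (auto intro: sorted_wrt_filter)
  moreover have "a p = hid H" if "p \<notin> P" for p using i that by (auto simp: ah ms_idx_def)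
  ultimately have "word t a (sorted_list_of_set P) = word t a (sorted_list_of_set Q)"
    using word_filter[of "sorted_list_of_set Q" t a "\<lambda>p. p \<in> P"] partitions_set[OF Q]
      ms_idx_bops[OF i[unfolded ah]] by simp
  then show ?thesis by (simp add: ah part_vec_def)
qed

lemma refine_eq:
  assumes P: "P \<in> partitions t" and Q: "Q \<in> partitions t" and PQ: "P \<subseteq> Q" and x: "x \<in> hcarrier H"
  shows "ms_refine H \<phi> t P Q (part_map t P x) = part_map t Q x"
proof -
  \<comment> \<open>\<open>hid H\<close> serves as the identity because operators vanish off their
    carrier.\<close>
  have "ms_refine H \<phi> t P Q (part_map t P x) = part_map t Q (hid H x)"
    unfolding ms_refine_def
  proof (rule extend_op_transported(2)[OF hiso_part[OF P] hiso_part[OF Q] hid_bop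
        part_vec_image[OF P] part_elem_eq[OF P] _ x])
    fix i assume i: "i \<in> ms_idx H t P"
    then have "part_vec t P i \<in> hcarrier H" by (rule part_vec_closed[OF P])
    then show "ms_part_elem H \<phi> t Q i = part_map t Q (hid H (part_vec t P i))"
      using part_elem_eq[OF Q, of i] part_vec_mono[OF P Q PQ i] ms_idx_mono[OF PQ i]
      by (simp add: hid_def)
  qed
  then show ?thesis using x by (simp add: hid_def)
qed

lemma lim_vec_part_map:
  assumes "P \<in> partitions t" "x \<in> hcarrier H"
  shows "lim_vec t (P, part_map t P x) = x"
  using hiso.Ji_J[OF hiso_part[OF assms(1)] assms(2)] by (simp add: lim_vec_def)

lemma ms_lim_idx_cases:
  assumes "i \<in> ms_lim_idx H \<phi> t"
  obtains P x where "P \<in> partitions t" "x \<in> hcarrier H" "i = (P, part_map t P x)"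
  using assms hiso.image[OF hiso_part] unfolding ms_lim_idx_def by blast

lemma part_map_in_ms_lim_idx:
  "P \<in> partitions t \<Longrightarrow> x \<in> hcarrier H \<Longrightarrow> (P, part_map t P x) \<in> ms_lim_idx H \<phi> t"
  using hiso.J_closed[OF hiso_part] by (auto simp: ms_lim_idx_def)

lemma partitions_union: "P \<in> partitions t \<Longrightarrow> Q \<in> partitions t \<Longrightarrow> P \<union> Q \<in> partitions t"
  by (auto simp: partitions_def)

lemma trivial_partition: "{0, t} \<in> partitions t"
  using t by (auto simp: partitions_def)

lemma lim_vec_image: "lim_vec t ` ms_lim_idx H \<phi> t = hcarrier H"
proof (intro subset_antisym subsetI)
  fix x assume "x \<in> lim_vec t ` ms_lim_idx H \<phi> t"
  then show "x \<in> hcarrier H" by (auto simp: lim_vec_part_map elim!: ms_lim_idx_cases)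
next
  fix x assume "x \<in> hcarrier H"
  then show "x \<in> lim_vec t ` ms_lim_idx H \<phi> t"
    using lim_vec_part_map[OF trivial_partition] part_map_in_ms_lim_idx[OF trivial_partition]
    by (metis imageI)
qed

text \<open>Once refinements act as identities, the inner product taken in the common refinement is
  that of \<open>H\<close>, whatever the two partitions are.\<close>

lemma ms_lim_kernel_eq:
  assumes "i \<in> ms_lim_idx H \<phi> t" "j \<in> ms_lim_idx H \<phi> t"
  shows "ms_lim_kernel H \<phi> t i j = hinner H (lim_vec t i) (lim_vec t j)"
proof -
  obtain P x where P: "P \<in> partitions t" "x \<in> hcarrier H" "i = (P, part_map t P x)"
    using assms(1) by (rule ms_lim_idx_cases)
  obtain Q y where Q: "Q \<in> partitions t" "y \<in> hcarrier H" "j = (Q, part_map t Q y)"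
    using assms(2) by (rule ms_lim_idx_cases)
  show ?thesis
    using hiso.J_inner[OF hiso_part[OF partitions_union[OF P(1) Q(1)]] P(2) Q(2)]
    by (simp add: P Q ms_lim_kernel_def refine_eq partitions_union lim_vec_part_map)
qed

lemma hiso_space: "hiso H (ms_space H \<phi> t) (space_map t)"
  unfolding ms_space_def space_map_def by (rule hiso_completion[OF lim_vec_image ms_lim_kernel_eq])

lemma ms_elem_eq:
  assumes P: "P \<in> partitions t" and i: "i \<in> ms_idx H t P"
  shows "ms_elem H \<phi> t P i = space_map t (part_vec t P i)"
proof -
  have x: "part_vec t P i \<in> hcarrier H" using P i by (rule part_vec_closed)
  have "ms_elem H \<phi> t P i = space_map t (lim_vec t (P, part_map t P (part_vec t P i)))"
    unfolding ms_elem_def space_map_def part_elem_eq[OF P i]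
    by (rule gen_eq_coords[OF lim_vec_image ms_lim_kernel_eq part_map_in_ms_lim_idx[OF P x]])
  then show ?thesis by (simp only: lim_vec_part_map[OF P x])
qed

text \<open>The letter at 0 is the leftmost one and travels the full time \<open>t\<close>, so left
  multiplication of the first factor by \<open>A\<close> turns into \<phi>_t(A).\<close>

lemma part_vec_act:
  assumes P: "P \<in> partitions t" and i: "(a, h) \<in> ms_idx H t P" and A: "A \<in> bops H"
  shows "(a(0 := A \<circ> a 0), h) \<in> ms_idx H t P"
    and "part_vec t P (a(0 := A \<circ> a 0), h) = \<phi> t A (part_vec t P (a, h))"
proof -
  note P' = partitions_set[OF P] partitions_list[OF P]
  show "(a(0 := A \<circ> a 0), h) \<in> ms_idx H t P"
    using i t P' ms_idx_bops[OF i, of 0] A by (auto simp: ms_idx_def bops_comp)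
  obtain ps where ps: "sorted_list_of_set P = 0 # ps"
    using P' by (metis list.collapse)
  then have "0 \<notin> set ps" using distinct_sorted_list_of_set[of P] by simp
  then have "word t (a(0 := A \<circ> a 0)) ps = word t a ps" by (intro word_cong) auto
  then show "part_vec t P (a(0 := A \<circ> a 0), h) = \<phi> t A (part_vec t P (a, h))"
    using t A ms_idx_bops[OF i, of 0] by (simp add: part_vec_def ps phi_comp)
qed

lemma act_eq:
  assumes A: "A \<in> bops H" and x: "x \<in> hcarrier H"
  shows "ms_act H \<phi> t A (space_map t x) = space_map t (\<phi> t A x)"
  unfolding ms_act_def ms_extend_def
proof (rule extend_op_transported(2)[OF hiso_space hiso_space _ _ _ _ x,
      where v = "\<lambda>(P, i). part_vec t P i"])
  show "\<phi> t A \<in> bops H" using t A by simp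
  show "(\<lambda>(P, i). part_vec t P i) ` (SIGMA P:partitions t. ms_idx H t P) = hcarrier H"
  proof (intro subset_antisym subsetI)
    fix y assume "y \<in> hcarrier H"
    then show "y \<in> (\<lambda>(P, i). part_vec t P i) ` (SIGMA P:partitions t. ms_idx H t P)"
      using trivial_partition hid_in_ms_idx part_vec_hid[OF trivial_partition]
      by (intro image_eqI[where x = "({0, t}, \<lambda>_. hid H, y)"]) auto
  qed (auto intro: part_vec_closed)
next
  fix i assume "i \<in> (SIGMA P:partitions t. ms_idx H t P)"
  then obtain P a h where P: "P \<in> partitions t" and a: "(a, h) \<in> ms_idx H t P"
    and i: "i = (P, a, h)" by auto
  show "(\<lambda>(P, a, h). ms_elem H \<phi> t P (a, h)) i = space_map t ((\<lambda>(P, i). part_vec t P i) i)"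
    by (simp only: i case_prod_conv ms_elem_eq[OF P a])
  show "(\<lambda>(P, a, h). ms_elem H \<phi> t P (a(0 := A \<circ> a 0), h)) i
      = space_map t (\<phi> t A ((\<lambda>(P, i). part_vec t P i) i))"
    by (simp only: i case_prod_conv part_vec_act(2)[OF P a A]
        ms_elem_eq[OF P part_vec_act(1)[OF P a A]])
qed

end

end

section \<open>One-dimensional fibres\<close>

text \<open>A one-dimensional Hilbert space with unit vector \<open>y\<close>, stated through
  multiples of \<open>y\<close> only, so that it can be checked for \<open>E(t)\<close> without
  first proving vector space laws or completeness.\<close>

definition unit_line :: "'a::complex_vector hspace \<Rightarrow> 'a \<Rightarrow> bool" where
  "unit_line G y \<longleftrightarrow> hcarrier G = range (\<lambda>c. c *\<^sub>C y) \<and>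
     (\<forall>c d. hinner G (c *\<^sub>C y) (d *\<^sub>C y) = cnj c * d)"

lemma unit_line_carrier: "unit_line G y \<Longrightarrow> hcarrier G = range (\<lambda>c. c *\<^sub>C y)"
  by (simp add: unit_line_def)

lemma unit_line_inner: "unit_line G y \<Longrightarrow> hinner G (c *\<^sub>C y) (d *\<^sub>C y) = cnj c * d"
  by (simp add: unit_line_def)

lemma unit_line_coord: "unit_line G y \<Longrightarrow> hinner G y (c *\<^sub>C y) = c"
  using unit_line_inner[of G y 1 c] by (simp add: scaleC_one)

lemma unit_line_inner_coords:
  assumes "unit_line G y" "x \<in> hcarrier G" "x' \<in> hcarrier G"
  shows "hinner G x x' = cnj (hinner G y x) * hinner G y x'"
  using assms(2,3) unit_line_inner[OF assms(1)] unit_line_coord[OF assms(1)]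
  by (auto simp: unit_line_carrier[OF assms(1)])

lemma unit_line_closed:
  assumes "unit_line G y"
  shows "y \<in> hcarrier G"
proof -
  have "1 *\<^sub>C y \<in> hcarrier G" unfolding unit_line_carrier[OF assms] by (rule rangeI)
  then show ?thesis by (simp only: scaleC_one)
qed

section \<open>Tensor products with a one-dimensional factor\<close>

definition complex_hspace :: "complex hspace" where
  "complex_hspace = \<lparr>hcarrier = UNIV, hinner = (\<lambda>x y. cnj x * y)\<rparr>"

lemma hilbert_complex: "hilbert complex_hspace"
proof
  have norm: "hnorm complex_hspace x = norm x" for x
    by (simp add: hnorm_def complex_hspace_def cmod_def power2_eq_square)
  have "hdist complex_hspace = dist"
    by (simp add: fun_eq_iff hdist_def norm dist_norm) (simp add: complex_hspace_def)
  then have "Metric_space.mcomplete (hcarrier complex_hspace) (hdist complex_hspace)"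
    by (simp add: complex_hspace_def complete_UNIV)
  then show "hilbert_space complex_hspace"
    unfolding hilbert_space_def
    by (auto simp: complex_hspace_def scaleC_complex_def algebra_simps complex_nonneg_Reals_iff
        cv.subspace_def)
qed

text \<open>The products \<open><y, x> <y', x'>\<close> realise the tensor kernel as a Gram kernel
  in \<complex>. The second claim serves to compare \<open>E(t)\<close> with
  \<open>X(t,0)\<close>.\<close>

lemma tensor_unit_lines:
  assumes G: "unit_line G y" and G': "unit_line G' y'"
  shows "unit_line (tensor G G') (tens G G' y y')"
    and "x \<in> hcarrier G \<Longrightarrow> tens G G' x y' = hinner G y x *\<^sub>C tens G G' y y'"
proof -
  interpret hilbert complex_hspace by (rule hilbert_complex)
  let ?I = "hcarrier G \<times> hcarrier G'"
  define v where "v = (\<lambda>(x, x'). hinner G y x * hinner G' y' x')"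
  have v: "v ` ?I = hcarrier complex_hspace"
  proof -
    have "c \<in> v ` ?I" for c
      using unit_line_coord[OF G, of c] unit_line_coord[OF G', of 1] unit_line_closed[OF G']
      by (intro image_eqI[where x = "(c *\<^sub>C y, y')"])
        (auto simp: v_def unit_line_carrier[OF G])
    then show ?thesis by (auto simp: complex_hspace_def)
  qed
  have k: "tensor_kernel G G' i j = hinner complex_hspace (v i) (v j)"
    if "i \<in> ?I" "j \<in> ?I" for i j
    using that unit_line_inner_coords[OF G] unit_line_inner_coords[OF G']
    by (auto simp: tensor_kernel_def v_def complex_hspace_def)
  define L where "L = coords complex_hspace ?I v"
  interpret L: hiso complex_hspace "tensor G G'" L
    unfolding tensor_def L_def using v k by (rule hiso_completion)
  have tens: "tens G G' x x' = L (v (x, x'))" if "x \<in> hcarrier G" "x' \<in> hcarrier G'" for x x'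
    unfolding tens_def L_def using v k that by (intro gen_eq_coords) auto
  have v1: "v (x, y') = hinner G y x" for x
    using unit_line_coord[OF G', of 1] by (simp add: v_def scaleC_one)
  have "hinner G y y = 1" using unit_line_coord[OF G, of 1] by (simp add: scaleC_one)
  then have y: "tens G G' y y' = L 1"
    using tens[OF unit_line_closed[OF G] unit_line_closed[OF G']] v1[of y] by simp
  have L: "L c = c *\<^sub>C L 1" for c
    using L.J_scale[of 1 c] by (simp add: complex_hspace_def scaleC_complex_def)
  show "unit_line (tensor G G') (tens G G' y y')"
    unfolding unit_line_def y L[symmetric] L.image[symmetric]
    using L.J_inner by (simp add: complex_hspace_def)
  show "tens G G' x y' = hinner G y x *\<^sub>C tens G G' y y'" if "x \<in> hcarrier G"
    using tens[OF that unit_line_closed[OF G']] L[of "hinner G y x"] by (simp add: y v1)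
qed

text \<open>For a unit vector \<open>y\<close> spanning \<open>G\<close> this is the unitary
  \<open>k \<mapsto> y \<otimes> k\<close>; the tensor \<open>x \<otimes> k\<close> is realised by
  \<open><y, x> k\<close> in \<open>K\<close>.\<close>

definition line_map :: "'x::complex_vector hspace \<Rightarrow> 'x \<Rightarrow> 'a::complex_vector hspace \<Rightarrow>
    'a \<Rightarrow> 'x \<times> 'a \<Rightarrow> complex" where
  "line_map G y K = coords K (hcarrier G \<times> hcarrier K) (\<lambda>(x, k). hinner G y x *\<^sub>C k)"

locale line_tensor = hilbert K
  for K :: "'a::complex_vector hspace" +
  fixes G :: "'x::complex_vector hspace" and y :: 'x
  assumes line: "unit_line G y"
begin

abbreviation "I \<equiv> hcarrier G \<times> hcarrier K"
abbreviation "v \<equiv> \<lambda>(x, k). hinner G y x *\<^sub>C k"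
abbreviation "L \<equiv> line_map G y K"

lemma v_image: "v ` I = hcarrier K"
proof (intro subset_antisym subsetI)
  fix k assume "k \<in> hcarrier K"
  then show "k \<in> v ` I"
    using unit_line_coord[OF line, of 1] unit_line_closed[OF line]
    by (intro image_eqI[where x = "(y, k)"]) (auto simp: scaleC_one)
qed auto

lemma kernel_v: "i \<in> I \<Longrightarrow> j \<in> I \<Longrightarrow> tensor_kernel G K i j = hinner K (v i) (v j)"
  by (auto simp: tensor_kernel_def inner_scale_left inner_scale_right
      unit_line_inner_coords[OF line])

lemma hiso_L: "hiso K (tensor G K) L"
  unfolding tensor_def line_map_def by (rule hiso_completion[OF v_image kernel_v])

lemma tens_eq: "i \<in> I \<Longrightarrow> (\<lambda>(x, k). tens G K x k) i = L (v i)"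
  unfolding tens_def line_map_def
  by (cases i) (simp only: case_prod_conv gen_eq_coords[OF v_image kernel_v])

lemma
  assumes A: "A \<in> bops K"
  shows amplify_bop: "amplify G K A \<in> bops (tensor G K)"
    and amplify_L: "k \<in> hcarrier K \<Longrightarrow> amplify G K A (L k) = L (A k)"
proof -
  have f: "(\<lambda>(x, k). tens G K x (A k)) i = L (A (v i))" if "i \<in> I" for i
  proof -
    obtain x k where i: "i = (x, k)" by (cases i)
    then have "(x, A k) \<in> I" using that bop_closed[OF A] by simp
    then show ?thesis using tens_eq[of "(x, A k)"] that by (simp add: i bop_scale[OF A])
  qed
  note * = extend_op_transported[OF hiso_L hiso_L A v_image tens_eq f]
  show "amplify G K A \<in> bops (tensor G K)" unfolding amplify_def by (rule *(1))
  show "k \<in> hcarrier K \<Longrightarrow> amplify G K A (L k) = L (A k)" unfolding amplify_def by (rule *(2))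
qed

context
  fixes T :: "'x \<Rightarrow> 'a \<Rightarrow> 'a" and U :: "'a \<Rightarrow> 'a"
  assumes U: "U \<in> bops K" and T: "\<And>x. x \<in> hcarrier G \<Longrightarrow> T x = hinner G y x *\<^sub>C U"
begin

text \<open>On a line \<open>T\<close> is determined by \<open>U = T y\<close>, so
  \<open>x \<otimes> k \<mapsto> T x k\<close> is \<open>U\<close> once \<open>y \<otimes> k\<close>
  is identified with \<open>k\<close>.\<close>

lemma
  shows tilde_bop: "tilde G K T \<in> bop (tensor G K) K"
    and tilde_L: "k \<in> hcarrier K \<Longrightarrow> tilde G K T (L k) = U k"
proof -
  have f: "(\<lambda>(x, k). T x k) i = U (v i)" if "i \<in> I" for i
    using that by (cases i) (simp add: T scaleC_apply bop_scale[OF U])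
  note * = extend_op_transported[OF hiso_L hiso_id[OF hilbert_space] U v_image tens_eq f]
  show "tilde G K T \<in> bop (tensor G K) K" unfolding tilde_def by (rule *(1))
  show "k \<in> hcarrier K \<Longrightarrow> tilde G K T (L k) = U k" unfolding tilde_def by (rule *(2))
qed

interpretation L: hiso K "tensor G K" L by (rule hiso_L)
interpretation tensor: hilbert "tensor G K" by unfold_locales (rule L.hilbert_space_image)

lemma adj_tilde:
  assumes k: "k \<in> hcarrier K"
  shows "adj (tensor G K) K (tilde G K T) k = L (star K U k)"
proof (rule tensor.eq_if_inner_eq)
  have U'k: "star K U k \<in> hcarrier K" using bop_closed[OF star_bop[OF U] k] .
  then show "L (star K U k) \<in> hcarrier (tensor G K)" by simp
  show "adj (tensor G K) K (tilde G K T) k \<in> hcarrier (tensor G K)"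
    using adj_bop[OF L.hilbert_space_image hilbert_space tilde_bop] k by (rule bop_closed)
  fix z assume z: "z \<in> hcarrier (tensor G K)"
  then obtain x where x: "x \<in> hcarrier K" "z = L x" using L.image by (metis imageE)
  have "hinner (tensor G K) z (adj (tensor G K) K (tilde G K T) k) = hinner K (U x) k"
    using inner_adj_right[OF L.hilbert_space_image hilbert_space tilde_bop z k]
    by (simp add: x tilde_L)
  also have "\<dots> = hinner (tensor G K) z (L (star K U k))"
    using x U'k k by (simp add: L.J_inner inner_adj_right[OF hilbert_space hilbert_space U])
  finally show "hinner (tensor G K) z (adj (tensor G K) K (tilde G K T) k)
      = hinner (tensor G K) z (L (star K U k))" .
qed

text \<open>Under \<open>y \<otimes> k \<mapsto> k\<close> the three factors of the induced map
  become \<open>U\<close>, \<open>A\<close> and the adjoint of \<open>U\<close>.\<close>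

lemma induced_map_eq:
  assumes A: "A \<in> bops K"
  shows "induced_map G K T A = U \<circ> A \<circ> star K U"
proof (rule bop_eqI)
  show "induced_map G K T A \<in> bops K"
    unfolding induced_map_def
    by (intro bop_comp[OF bop_comp[OF tilde_bop amplify_bop[OF A]]] adj_bop tilde_bop
        hilbert_space L.hilbert_space_image)
  show "U \<circ> A \<circ> star K U \<in> bops K"
    by (intro bops_comp star_bop A U)
  fix k assume k: "k \<in> hcarrier K"
  have "star K U k \<in> hcarrier K" using bop_closed[OF star_bop[OF U] k] .
  then show "induced_map G K T A k = (U \<circ> A \<circ> star K U) k"
    by (simp add: induced_map_def adj_tilde[OF k] amplify_L[OF A] tilde_L bop_closed[OF A])
qed

lemma isometric_tilde:
  assumes "isometry_op (tensor G K) K (tilde G K T)"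
  shows "star K U \<circ> U = hid K"
proof (rule bop_eqI)
  fix k assume k: "k \<in> hcarrier K"
  have "adj (tensor G K) K (tilde G K T) (tilde G K T (L k)) = hid (tensor G K) (L k)"
    using assms unfolding isometry_op_def by (metis comp_apply)
  then have "L (star K U (U k)) = L k"
    using k bop_closed[OF U k] by (simp add: tilde_L adj_tilde hid_def)
  then have "star K U (U k) = k"
    using k bop_closed[OF star_bop[OF U] bop_closed[OF U k]] by (intro L.J_eqD) auto
  then show "(star K U \<circ> U) k = hid K k" using k by (simp add: hid_def)
qed (auto intro: bops_comp star_bop U)

lemma coisometric_tilde:
  assumes "coisometry_op (tensor G K) K (tilde G K T)"
  shows "U \<circ> star K U = hid K"
proof (rule bop_eqI)
  fix k assume k: "k \<in> hcarrier K"
  have "tilde G K T (adj (tensor G K) K (tilde G K T) k) = hid K k"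
    using assms unfolding coisometry_op_def by (metis comp_apply)
  then show "(U \<circ> star K U) k = hid K k"
    using bop_closed[OF star_bop[OF U] k] by (simp add: adj_tilde[OF k] tilde_L)
qed (auto intro: bops_comp star_bop U)

end

end

lemma (in hilbert) bij_betw_conj:
  assumes U: "U \<in> bops H" "star H U \<circ> U = hid H" "U \<circ> star H U = hid H"
  shows "bij_betw (\<lambda>A. U \<circ> A \<circ> star H U) (bops H) (bops H)"
proof (rule bij_betwI[where g = "\<lambda>A. star H U \<circ> A \<circ> U"])
  fix A assume A: "A \<in> bops H"
  have "star H U \<circ> (U \<circ> A \<circ> star H U) \<circ> U = (star H U \<circ> U) \<circ> A \<circ> (star H U \<circ> U)"
    by (simp only: comp_assoc)
  then show "star H U \<circ> (U \<circ> A \<circ> star H U) \<circ> U = A"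
    unfolding U(2) using hid_comp[OF hilbert_space A] comp_hid[OF A] by metis
  have "U \<circ> (star H U \<circ> A \<circ> U) \<circ> star H U = (U \<circ> star H U) \<circ> A \<circ> (U \<circ> star H U)"
    by (simp only: comp_assoc)
  then show "U \<circ> (star H U \<circ> A \<circ> U) \<circ> star H U = A"
    unfolding U(3) using hid_comp[OF hilbert_space A] comp_hid[OF A] by metis
qed (use U(1) in \<open>auto intro: bops_comp star_bop\<close>)

text \<open>Elements of a completion are functions recording limits of inner products with
  generators, so they vanish with the kernel.\<close>

lemma completion_zero_kernel:
  assumes "\<And>i j. i \<in> I \<Longrightarrow> j \<in> I \<Longrightarrow> k i j = 0"
  shows "hcarrier (completion I k) \<subseteq> {0}"
proof
  fix f assume "f \<in> hcarrier (completion I k)"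
  then obtain s where f: "f = cauchy_class I k s" and s: "\<And>n. Poly_Mapping.keys (s n) \<subseteq> I"
    by (auto simp: completion_def gram_cauchy_def)
  have "gram k (Poly_Mapping.single i 1) (s n) = 0" if "i \<in> I" for i n
    unfolding gram_def using that s[of n] assms by (intro sum.neutral ballI) auto
  then show "f \<in> {0}" by (simp add: f cauchy_class_def fun_eq_iff)
qed

section \<open>The fibre \<open>E(t)\<close> when \<phi>_t is onto\<close>

context endo_semigroup
begin

context
  fixes t :: real
  assumes t: "0 < t" and surj: "\<phi> t ` bops H = bops H"
begin

interpretation J: hiso H "ms_space H \<phi> t" "space_map t" by (rule hiso_space[OF t])
interpretation M: hilbert "ms_space H \<phi> t" by unfold_locales (rule J.hilbert_space_image)

abbreviation "M \<equiv> ms_space H \<phi> t"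
abbreviation "E \<equiv> ms_fibre H \<phi> t"

lemma fibre_carrier:
  "hcarrier E = {X \<in> bop H M. \<forall>A\<in>bops H. X \<circ> A = ms_act H \<phi> t A \<circ> X}"
  using t by (simp add: ms_fibre_def)

text \<open>This is \<open>T^E_t(X)\<close>: since \<iota>_t is unitary, its adjoint is its
  inverse.\<close>

definition pull :: "('a \<Rightarrow> 'a ms_vec) \<Rightarrow> 'a \<Rightarrow> 'a" where
  "pull X h = J.Ji (X h)"

context
  fixes X assumes X: "X \<in> hcarrier E"
begin

lemma fibre_bop: "X \<in> bop H M"
  using X by (simp add: fibre_carrier)

lemma fibre_all_closed: "X h \<in> hcarrier M"
  using bop_closed[OF fibre_bop] bop_off[OF fibre_bop] by (cases "h \<in> hcarrier H") auto

lemma pull_closed: "pull X h \<in> hcarrier H"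
  by (simp add: pull_def fibre_all_closed)

lemma space_map_pull: "space_map t (pull X h) = X h"
  by (simp add: pull_def fibre_all_closed)

lemma pull_bop: "pull X \<in> bops H"
proof -
  obtain C where C: "\<And>x. x \<in> hcarrier H \<Longrightarrow> hnorm M (X x) \<le> C * hnorm H x"
    using bop_bound[OF fibre_bop] by blast
  show ?thesis
  proof (rule bopI[where C = C])
    fix x y assume xy: "x \<in> hcarrier H" "y \<in> hcarrier H"
    show "pull X (x + y) = pull X x + pull X y"
      using xy by (intro J.J_eqD)
        (simp_all add: pull_closed J.J_add space_map_pull bop_add[OF fibre_bop])
  next
    fix c x assume x: "x \<in> hcarrier H"
    show "pull X (c *\<^sub>C x) = c *\<^sub>C pull X x"
      using x by (intro J.J_eqD)
        (simp_all add: pull_closed J.J_scale space_map_pull bop_scale[OF fibre_bop])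
  next
    fix x assume "x \<notin> hcarrier H"
    then have "space_map t (pull X x) = space_map t 0"
      by (simp add: space_map_pull bop_off[OF fibre_bop])
    then show "pull X x = 0" by (rule J.J_eqD[OF pull_closed zero_closed])
  next
    fix x assume "x \<in> hcarrier H"
    then show "hnorm H (pull X x) \<le> C * hnorm H x"
      using C[of x] J.norm_J[OF pull_closed, of x] by (simp add: space_map_pull)
  qed (rule pull_closed)
qed

lemma pull_intertwines:
  assumes A: "A \<in> bops H"
  shows "pull X \<circ> A = \<phi> t A \<circ> pull X"
proof
  fix h
  have "X (A h) = ms_act H \<phi> t A (X h)"
    using X A unfolding fibre_carrier mem_Collect_eq by (metis comp_apply)
  then have "space_map t (pull X (A h)) = space_map t (\<phi> t A (pull X h))"
    using act_eq[OF t A pull_closed, of h] by (simp add: space_map_pull)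
  then have "pull X (A h) = \<phi> t A (pull X h)"
    using t A by (intro J.J_eqD) (simp_all add: pull_closed bop_closed[of "\<phi> t A" H H])
  then show "(pull X \<circ> A) h = (\<phi> t A \<circ> pull X) h" by simp
qed

lemma star_pull_intertwines:
  assumes A: "A \<in> bops H"
  shows "star H (pull X) \<circ> \<phi> t A = A \<circ> star H (pull X)"
proof -
  have "star H (\<phi> t (star H A) \<circ> pull X) = star H (pull X \<circ> star H A)"
    using pull_intertwines[OF star_bop[OF A]] by simp
  then show ?thesis
    using t A by (simp only: star_comp pull_bop star_bop phi_bop less_imp_le phi_star star_star)
qed

end

text \<open>The two intertwining relations carry \<open>A\<close> across the product, which
  therefore commutes with all of \<open>B(H)\<close>. The scalar is the inner product of
  \<open>E(t)\<close>.\<close>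

lemma star_pull_pull_scalar:
  assumes X: "X \<in> hcarrier E" and Y: "Y \<in> hcarrier E"
  obtains c where "star H (pull X) \<circ> pull Y = c *\<^sub>C hid H"
proof (rule commutant_scalar)
  show "star H (pull X) \<circ> pull Y \<in> bops H"
    by (intro bops_comp star_bop pull_bop X Y)
  fix A assume A: "A \<in> bops H"
  have "star H (pull X) \<circ> pull Y \<circ> A = star H (pull X) \<circ> \<phi> t A \<circ> pull Y"
    by (simp only: comp_assoc pull_intertwines[OF Y A])
  then show "star H (pull X) \<circ> pull Y \<circ> A = A \<circ> (star H (pull X) \<circ> pull Y)"
    by (simp only: comp_assoc star_pull_intertwines[OF X A])
qed

text \<open>Surjectivity of \<open>\<phi>\<^sub>t\<close> enters here.\<close>

lemma pull_star_pull_scalar: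
  assumes X: "X \<in> hcarrier E" and Y: "Y \<in> hcarrier E"
  obtains c where "pull X \<circ> star H (pull Y) = c *\<^sub>C hid H"
proof (rule commutant_scalar)
  show "pull X \<circ> star H (pull Y) \<in> bops H"
    by (intro bops_comp star_bop pull_bop X Y)
  fix B assume "B \<in> bops H"
  then have "B \<in> \<phi> t ` bops H" by (simp only: surj)
  then obtain A where A: "A \<in> bops H" and B: "B = \<phi> t A" by (elim imageE)
  have "pull X \<circ> star H (pull Y) \<circ> B = pull X \<circ> A \<circ> star H (pull Y)"
    by (simp only: B comp_assoc star_pull_intertwines[OF Y A])
  then show "pull X \<circ> star H (pull Y) \<circ> B = B \<circ> (pull X \<circ> star H (pull Y))"
    by (simp only: B comp_assoc pull_intertwines[OF X A])
qed

text \<open>The inner product of \<open>E(t)\<close> is defined through adjoints of maps into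
  \<open>H_t\<close>; this replaces them by adjoints on \<open>H\<close>.\<close>

lemma adj_comp_fibre:
  assumes X: "X \<in> hcarrier E" and Y: "Y \<in> hcarrier E"
  shows "adj H M X \<circ> Y = star H (pull X) \<circ> pull Y"
proof (rule bop_eqI)
  note adjX = adj_bop[OF hilbert_space J.hilbert_space_image fibre_bop[OF X]]
  show "adj H M X \<circ> Y \<in> bops H"
    by (rule bop_comp[OF adjX fibre_bop[OF Y] J.hilbert_space_image hilbert_space])
  show "star H (pull X) \<circ> pull Y \<in> bops H"
    by (intro bops_comp star_bop pull_bop X Y)
  fix h assume h: "h \<in> hcarrier H"
  show "(adj H M X \<circ> Y) h = (star H (pull X) \<circ> pull Y) h"
  proof (rule eq_if_inner_eq)
    fix x assume x: "x \<in> hcarrier H"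
    have "hinner H x (adj H M X (Y h)) = hinner M (X x) (Y h)"
      by (rule inner_adj_right[OF hilbert_space J.hilbert_space_image fibre_bop[OF X] x
            fibre_all_closed[OF Y]])
    also have "\<dots> = hinner H (pull X x) (pull Y h)"
      using J.J_inner[OF pull_closed[OF X] pull_closed[OF Y], of x h]
      by (simp add: space_map_pull X Y)
    also have "\<dots> = hinner H x (star H (pull X) (pull Y h))"
      by (rule inner_adj_right[OF hilbert_space hilbert_space pull_bop[OF X] x
            pull_closed[OF Y], symmetric])
    finally show "hinner H x ((adj H M X \<circ> Y) h) = hinner H x ((star H (pull X) \<circ> pull Y) h)"
      by simp
  qed (simp_all add: bop_closed[OF adjX] fibre_all_closed[OF Y] pull_closed[OF Y]
      bop_closed[OF star_bop[OF pull_bop[OF X]]])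
qed

context
  assumes nonzero: "hcarrier H \<noteq> {0}"
begin

text \<open>On a zero space all multiples of the identity coincide; the scalar that defines the
  inner product of \<open>E(t)\<close> is unique only because \<open>H\<close> is nonzero.\<close>

lemma scalar_hid_eqD: "c *\<^sub>C hid H = d *\<^sub>C hid H \<Longrightarrow> c = d"
proof -
  assume eq: "c *\<^sub>C hid H = d *\<^sub>C hid H"
  obtain e where e: "e \<in> hcarrier H" "e \<noteq> 0" using nonzero zero_closed by blast
  have "c *\<^sub>C e = d *\<^sub>C e" using fun_cong[OF eq, of e] e by (simp add: scaleC_apply hid_def)
  then show ?thesis using e by simp
qed

lemma star_pull_pull:
  assumes X: "X \<in> hcarrier E" and Y: "Y \<in> hcarrier E"
  shows "star H (pull X) \<circ> pull Y = hinner E X Y *\<^sub>C hid H"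
proof -
  obtain c where c: "star H (pull X) \<circ> pull Y = c *\<^sub>C hid H"
    using star_pull_pull_scalar[OF X Y] by blast
  have "hinner E X Y = (THE c. adj H M X \<circ> Y = c *\<^sub>C hid H)"
    using t nonzero by (simp add: ms_fibre_def)
  also have "\<dots> = c"
    unfolding adj_comp_fibre[OF X Y] c by (rule the_equality[where a = c], rule refl, rule scalar_hid_eqD, rule sym)
  finally show ?thesis using c by simp
qed

lemma inner_fibre:
  assumes X: "X \<in> hcarrier E" and Y: "Y \<in> hcarrier E" and "h \<in> hcarrier H" "k \<in> hcarrier H"
  shows "hinner M (X h) (Y k) = hinner E X Y * hinner H h k"
proof -
  have "hinner M (X h) (Y k) = hinner H (pull X h) (pull Y k)"
    using J.J_inner[OF pull_closed[OF X] pull_closed[OF Y], of h k]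
    by (simp add: space_map_pull X Y)
  also have "\<dots> = hinner H h ((star H (pull X) \<circ> pull Y) k)"
    using inner_adj_right[OF hilbert_space hilbert_space pull_bop[OF X] assms(3)
        pull_closed[OF Y], of k] by simp
  also have "\<dots> = hinner E X Y * hinner H h k"
    using assms by (simp add: star_pull_pull[OF X Y] scaleC_apply hid_def inner_scale_right)
  finally show ?thesis .
qed

text \<open>With \<open>X\<close> and \<open>Y\<close> read as operators on \<open>H\<close>,
  multiply the scalar \<open>X Y^*\<close> by \<open>Y\<close> on the right: as
  \<open>Y^* Y = <Y, Y> I\<close>, associativity gives the relation. Leaving it undivided lets it
  hold for every \<open>Y\<close>.\<close>

lemma fibre_proportional:
  assumes X: "X \<in> hcarrier E" and Y: "Y \<in> hcarrier E"
  obtains c where "hinner E Y Y *\<^sub>C X = c *\<^sub>C Y"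
proof -
  obtain c where c: "pull X \<circ> star H (pull Y) = c *\<^sub>C hid H"
    using pull_star_pull_scalar[OF X Y] by blast
  have "hinner E Y Y *\<^sub>C X h = c *\<^sub>C Y h" for h
  proof (cases "h \<in> hcarrier H")
    case True
    have "pull X (star H (pull Y) (pull Y h)) = c *\<^sub>C pull Y h"
      using fun_cong[OF c, of "pull Y h"] pull_closed[OF Y] by (simp add: scaleC_apply hid_def)
    moreover have "star H (pull Y) (pull Y h) = hinner E Y Y *\<^sub>C h"
      using fun_cong[OF star_pull_pull[OF Y Y], of h] True by (simp add: scaleC_apply hid_def)
    ultimately have "hinner E Y Y *\<^sub>C pull X h = c *\<^sub>C pull Y h"
      using True by (simp add: bop_scale[OF pull_bop[OF X]])
    then have "space_map t (hinner E Y Y *\<^sub>C pull X h) = space_map t (c *\<^sub>C pull Y h)" by simp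
    then show ?thesis
      by (simp only: J.J_scale pull_closed[OF X] pull_closed[OF Y] space_map_pull X Y)
  qed (simp add: bop_off[OF fibre_bop[OF X]] bop_off[OF fibre_bop[OF Y]])
  then have "hinner E Y Y *\<^sub>C X = c *\<^sub>C Y" by (intro ext) (simp only: scaleC_apply)
  then show ?thesis by (rule that)
qed

end

text \<open>Homogeneity is inherited from \<phi>_t(A), to which the action corresponds; it makes
  \<open>E(t)\<close> closed under scalars.\<close>

lemma act_scale:
  assumes A: "A \<in> bops H" and z: "z \<in> hcarrier M"
  shows "ms_act H \<phi> t A (c *\<^sub>C z) = c *\<^sub>C ms_act H \<phi> t A z"
proof -
  have x: "J.Ji z \<in> hcarrier H" "z = space_map t (J.Ji z)" using z by simp_all
  have A': "\<phi> t A \<in> bops H" using t A by simp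
  have "ms_act H \<phi> t A (c *\<^sub>C z) = ms_act H \<phi> t A (space_map t (c *\<^sub>C J.Ji z))"
    by (simp only: J.J_scale[OF x(1)] x(2)[symmetric])
  also have "\<dots> = c *\<^sub>C ms_act H \<phi> t A (space_map t (J.Ji z))"
    by (simp only: act_eq[OF t A scale_closed[OF x(1)]] act_eq[OF t A x(1)] bop_scale[OF A' x(1)]
        J.J_scale[OF bop_closed[OF A' x(1)]])
  finally show ?thesis by (simp only: x(2)[symmetric])
qed

lemma zero_fibre: "0 \<in> hcarrier E"
proof -
  have "0 \<in> bop H M" by (rule bopI[where C = 0]) simp_all
  moreover have "0 \<circ> A = ms_act H \<phi> t A \<circ> 0" if "A \<in> bops H" for A
    using act_scale[OF that M.zero_closed, of 0] by (simp add: fun_eq_iff)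
  ultimately show ?thesis by (simp add: fibre_carrier)
qed

lemma scale_fibre:
  assumes X: "X \<in> hcarrier E"
  shows "c *\<^sub>C X \<in> hcarrier E"
proof -
  obtain C where C: "\<And>x. x \<in> hcarrier H \<Longrightarrow> hnorm M (X x) \<le> C * hnorm H x"
    using bop_bound[OF fibre_bop[OF X]] by blast
  have "c *\<^sub>C X \<in> bop H M"
  proof (rule bopI[where C = "cmod c * C"])
    show "hnorm M ((c *\<^sub>C X) x) \<le> cmod c * C * hnorm H x" if "x \<in> hcarrier H" for x
      using mult_left_mono[OF C[OF that], of "cmod c"]
      by (simp add: scaleC_apply M.norm_scale fibre_all_closed[OF X] mult.assoc)
  qed (simp_all add: scaleC_apply fibre_all_closed[OF X] bop_off[OF fibre_bop[OF X]]
      bop_add[OF fibre_bop[OF X]] bop_scale[OF fibre_bop[OF X]] scaleC_add_right scaleC_scaleC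
      mult.commute)
  moreover have "c *\<^sub>C X \<circ> A = ms_act H \<phi> t A \<circ> c *\<^sub>C X" if A: "A \<in> bops H" for A
  proof
    fix h
    have "X (A h) = ms_act H \<phi> t A (X h)"
      using X A unfolding fibre_carrier mem_Collect_eq by (metis comp_apply)
    then show "(c *\<^sub>C X \<circ> A) h = (ms_act H \<phi> t A \<circ> c *\<^sub>C X) h"
      by (simp add: scaleC_apply act_scale[OF A fibre_all_closed[OF X]])
  qed
  ultimately show ?thesis by (simp add: fibre_carrier)
qed

lemma inner_fibre_zero: "hinner E 0 0 = 0"
proof (cases "hcarrier H = {0}")
  case True
  then show ?thesis using t by (simp add: ms_fibre_def)
next
  case False
  then obtain e where e: "e \<in> hcarrier H" "e \<noteq> 0" using zero_closed by blast
  then have "hinner H e e \<noteq> 0" using inner_self_eq_0 by blast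
  then show ?thesis using inner_fibre[OF False zero_fibre zero_fibre e(1) e(1)] by simp
qed

text \<open>The value of the inner product at zero is recorded in the first case because it makes
  the tensor kernel of \<open>X(t,0)\<close> vanish.\<close>

lemma fibre_line:
  obtains "hcarrier E = {0}" "hinner E 0 0 = 0" | Y where "unit_line E Y"
proof (cases "hcarrier E = {0}")
  case True
  then show ?thesis using that(1) inner_fibre_zero by blast
next
  case False
  then obtain X where X: "X \<in> hcarrier E" "X \<noteq> 0" using zero_fibre by blast
  \<comment> \<open>Such a vector forces \<open>H\<close> to be nonzero, so the inner product of
    \<open>E(t)\<close> can be computed by evaluating at \<open>e\<close>.\<close>
  then obtain e where "X e \<noteq> 0" by (auto simp: fun_eq_iff)
  then have e: "e \<in> hcarrier H" "pull X e \<noteq> 0"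
    using bop_off[OF fibre_bop[OF X(1)]] space_map_pull[OF X(1), of e] by auto
  then have "e \<noteq> 0" using bop_zero[OF pull_bop[OF X(1)]] by auto
  then have nonzero: "hcarrier H \<noteq> {0}" using e by blast
  \<comment> \<open>This is \<open><X, X>\<close>, read off from
    \<open><X e, X e> = <X, X> <e, e>\<close>; being a positive real, it allows \<open>X\<close> to
    be normalised.\<close>
  define n where "n = (hnorm M (X e) / hnorm H e)\<^sup>2"
  have "hnorm H e \<noteq> 0" "hnorm M (X e) \<noteq> 0"
    using e(1) \<open>e \<noteq> 0\<close> \<open>X e \<noteq> 0\<close> fibre_all_closed[OF X(1)] by simp_all
  then have n: "n > 0" by (simp add: n_def)
  have "complex_of_real ((hnorm M (X e))\<^sup>2) = hinner E X X * complex_of_real ((hnorm H e)\<^sup>2)"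
    using inner_fibre[OF nonzero X(1) X(1) e(1) e(1)] M.inner_self[OF fibre_all_closed[OF X(1)]]
      inner_self[OF e(1)] by simp
  then have XX: "hinner E X X = complex_of_real n"
    using \<open>hnorm H e \<noteq> 0\<close> by (simp add: n_def field_simps)
  define Y where "Y = complex_of_real (1 / sqrt n) *\<^sub>C X"
  have Y: "Y \<in> hcarrier E" unfolding Y_def by (rule scale_fibre[OF X(1)])
  have inner: "hinner E (c *\<^sub>C X) (d *\<^sub>C X) = cnj c * d * n" for c d
  proof -
    have "hinner E (c *\<^sub>C X) (d *\<^sub>C X) * hinner H e e = cnj c * d * n * hinner H e e"
      using inner_fibre[OF nonzero scale_fibre[OF X(1)] scale_fibre[OF X(1)] e(1) e(1), of c d]
        inner_fibre[OF nonzero X(1) X(1) e(1) e(1)]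
      by (auto simp: XX scaleC_apply M.inner_scale_left M.inner_scale_right
          fibre_all_closed[OF X(1)] mult_ac)
    then show ?thesis using inner_self_eq_0[OF e(1)] \<open>e \<noteq> 0\<close> by auto
  qed
  have "hinner E (c *\<^sub>C Y) (d *\<^sub>C Y) = cnj c * d" for c d
  proof -
    have "complex_of_real (1 / sqrt n) * complex_of_real (1 / sqrt n) * complex_of_real n = 1"
      unfolding of_real_mult[symmetric] using n by (simp flip: real_sqrt_mult)
    then show ?thesis unfolding Y_def scaleC_scaleC inner by (simp add: mult_ac)
  qed
  moreover have "hcarrier E = range (\<lambda>c. c *\<^sub>C Y)"
  proof (intro subset_antisym subsetI)
    fix Z assume Z: "Z \<in> hcarrier E"
    obtain c where "hinner E Y Y *\<^sub>C Z = c *\<^sub>C Y"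
      using fibre_proportional[OF nonzero Z Y] by blast
    moreover have "hinner E Y Y = 1"
      using calculation(1) \<open>\<And>c d. hinner E (c *\<^sub>C Y) (d *\<^sub>C Y) = cnj c * d\<close>[of 1 1]
      by (simp add: scaleC_one)
    ultimately show "Z \<in> range (\<lambda>c. c *\<^sub>C Y)" by auto
  qed (auto intro: scale_fibre[OF Y])
  ultimately show ?thesis using that(2) unfolding unit_line_def by blast
qed

end

end

section \<open>The fibre at time zero and the semigroup \<alpha>\<close>

lemma ms_scalar_val: "ms_scalar_val (ms_scalar c) = c"
  by (simp add: ms_scalar_val_def) (simp add: ms_scalar_def fun_eq_iff)

lemma scaleC_ms_scalar: "c *\<^sub>C ms_scalar d = ms_scalar (c * d)"
  by (simp add: ms_scalar_def fun_eq_iff scaleC_apply scaleC_complex_def)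

lemma unit_line_ms_fibre_0: "unit_line (ms_fibre H \<theta> 0) (ms_scalar 1)"
  by (simp add: unit_line_def scaleC_ms_scalar ms_fibre_def ms_scalar_val)

context product_system_e0_dilation
begin

interpretation K: hilbert K by unfold_locales (rule hilbert_K)

lemma alpha_endo: "0 \<le> t \<Longrightarrow> star_endomorphism K (\<alpha> t)"
  using e0_alpha by (simp add: e0_semigroup_def)

lemma quadrant_t0: "0 \<le> t \<Longrightarrow> (t, 0) \<in> quadrant"
  by (simp add: quadrant_def)

text \<open>The operator \<open>U\<close> given by \<open>y \<otimes> 1\<close> governs two maps:
  the one over \<open>E(t)\<close> that defines \<alpha>_t, and the one over \<open>X(t,0)\<close>
  whose isometry and coisometry make \<open>U\<close> unitary.\<close>

lemma alpha_bij_unit_line: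
  assumes t: "0 \<le> t" and line: "unit_line (ms_fibre H \<phi> t) y"
  shows "bij_betw (\<alpha> t) (bops K) (bops K)"
proof -
  let ?G = "ms_fibre H \<phi> t" and ?G' = "ms_fibre H \<theta> 0" and ?X = "joint_fibre H \<phi> \<theta> (t, 0)"
  let ?T = "\<lambda>x. V (t, 0) (joint_tens H \<phi> \<theta> (t, 0) x (ms_scalar 1))"
  define z where "z = tens ?G ?G' y (ms_scalar 1)"
  define U where "U = V (t, 0) z"
  have X: "?X = tensor ?G ?G'" by (simp add: joint_fibre_def)
  have line_X: "unit_line ?X z"
    unfolding X z_def by (rule tensor_unit_lines(1)[OF line unit_line_ms_fibre_0])
  have "representation quadrant (joint_fibre H \<phi> \<theta>) m (joint_unit H \<phi> \<theta>) K V"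
    using dilation_V by (simp add: isometric_dilation_def)
  then have V: "V (t, 0) x \<in> bops K" "V (t, 0) (c *\<^sub>C x) = c *\<^sub>C V (t, 0) x"
    if "x \<in> hcarrier ?X" for c x
    using quadrant_t0[OF t] that unfolding representation_def by blast+
  have U: "U \<in> bops K" unfolding U_def by (rule V(1)[OF unit_line_closed[OF line_X]])
  interpret joint: line_tensor K ?X z by unfold_locales (rule line_X)
  interpret E: line_tensor K ?G y by unfold_locales (rule line)
  have V_eq: "V (t, 0) x = hinner ?X z x *\<^sub>C U" if x: "x \<in> hcarrier ?X" for x
  proof -
    obtain c where "x = c *\<^sub>C z" using x by (auto simp: unit_line_carrier[OF line_X])
    then show ?thesis
      using V(2)[OF unit_line_closed[OF line_X]] unit_line_coord[OF line_X] by (simp add: U_def)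
  qed
  have T_eq: "?T x = hinner ?G y x *\<^sub>C U" if x: "x \<in> hcarrier ?G" for x
  proof -
    have "joint_tens H \<phi> \<theta> (t, 0) x (ms_scalar 1) = hinner ?G y x *\<^sub>C z"
      unfolding z_def joint_tens_def case_prod_conv
      by (rule tensor_unit_lines(2)[OF line unit_line_ms_fibre_0 x])
    then show ?thesis using V(2)[OF unit_line_closed[OF line_X]] by (simp add: U_def)
  qed
  have "isometry_op (tensor ?X K) K (tilde ?X K (V (t, 0)))"
    using dilation_V quadrant_t0[OF t] by (simp add: isometric_dilation_def isometric_rep_def)
  then have U1: "star K U \<circ> U = hid K"
    by (rule joint.isometric_tilde[OF U, rotated]) (rule V_eq)
  have "coisometry_op (tensor ?X K) K (tilde ?X K (V (t, 0)))"
    using coisometric_V quadrant_t0[OF t] by (simp add: fully_coisometric_rep_def)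
  then have U2: "U \<circ> star K U = hid K"
    by (rule joint.coisometric_tilde[OF U, rotated]) (rule V_eq)
  have "\<alpha> t A = U \<circ> A \<circ> star K U" if "A \<in> bops K" for A
    unfolding alpha_eq[OF t that] by (rule E.induced_map_eq[OF U _ that]) (rule T_eq)
  then show ?thesis
    using K.bij_betw_conj[OF U U1 U2] by (simp cong: bij_betw_cong)
qed

lemma alpha_bij_zero_fibre:
  assumes t: "0 \<le> t" and zero: "hcarrier (ms_fibre H \<phi> t) = {0}" "hinner (ms_fibre H \<phi> t) 0 0 = 0"
  shows "bij_betw (\<alpha> t) (bops K) (bops K)"
proof -
  let ?X = "joint_fibre H \<phi> \<theta> (t, 0)"
  have "hcarrier ?X \<subseteq> {0}"
    unfolding joint_fibre_def case_prod_conv tensor_def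
    by (rule completion_zero_kernel) (auto simp: zero tensor_kernel_def)
  \<comment> \<open>As a fibre of a product system \<open>X(t,0)\<close> is a Hilbert space, so its
    inner product vanishes at 0, and with it the kernel of the tensor product with
    \<open>K\<close>.\<close>
  moreover have "hilbert_space ?X"
    using product_system_X quadrant_t0[OF t] by (simp add: product_system_def)
  then interpret X: hilbert ?X by unfold_locales
  have "hinner ?X 0 0 = 0" by simp
  ultimately have "hcarrier (tensor ?X K) \<subseteq> {0}"
    unfolding tensor_def by (intro completion_zero_kernel) (auto simp: tensor_kernel_def)
  moreover have tilde: "coisometry_op (tensor ?X K) K (tilde ?X K (V (t, 0)))"
    using coisometric_V quadrant_t0[OF t] by (simp add: fully_coisometric_rep_def)
  then have bop: "tilde ?X K (V (t, 0)) \<in> bop (tensor ?X K) K" by (simp add: coisometry_op_def)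
  ultimately have "tilde ?X K (V (t, 0)) z = 0" for z
    using bop_zero[OF bop] bop_off[OF bop] by (cases "z = 0") blast+
  then have "hid K k = 0" for k
    using tilde unfolding coisometry_op_def by (metis comp_apply)
  then have K0: "k = 0" if "k \<in> hcarrier K" for k
    using that unfolding hid_def by metis
  have eq: "A = B" if "A \<in> bops K" "B \<in> bops K" for A B
    using that by (intro bop_eqI) (auto dest!: K0 simp: bop_zero)
  have closed: "\<alpha> t A \<in> bops K" if "A \<in> bops K" for A
    using alpha_endo[OF t] that unfolding star_endomorphism_def linear_on_bops_def by blast
  \<comment> \<open>\<open>B(K)\<close> has a single element, so \<alpha>_t serves as its own
    inverse.\<close>
  show ?thesis
    by (rule bij_betw_byWitness[where f' = "\<alpha> t"]) (use closed eq in blast)+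
qed

lemma alpha_automorphism:
  assumes H: "endo_semigroup H \<phi>" and surj: "\<And>t. 0 \<le> t \<Longrightarrow> \<phi> t ` bops H = bops H" and t: "0 \<le> t"
  shows "star_automorphism K (\<alpha> t)"
proof -
  interpret endo_semigroup H \<phi> by (rule H)
  have "bij_betw (\<alpha> t) (bops K) (bops K)"
  proof (cases "t = 0")
    \<comment> \<open>\<open>E(0)\<close> is \<complex> by convention and not a space of
      intertwiners, so time zero is settled by \<alpha>_0 = id.\<close>
    case True
    have "\<alpha> 0 A = A" if "A \<in> bops K" for A
      using e0_alpha that by (simp add: e0_semigroup_def cp0_semigroup_def)
    then show ?thesis using True by (simp add: bij_betw_def inj_on_def)
  next
    case False
    with t have t': "0 < t" by simp
    show ?thesis
      by (rule fibre_line[OF t' surj[OF t]])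
        (rule alpha_bij_zero_fibre[OF t] alpha_bij_unit_line[OF t], assumption+)+
  qed
  then show ?thesis using alpha_endo[OF t] by (simp add: star_automorphism_def)
qed

end

theorem theorem4p1:
  fixes H K :: "'a::complex_vector hspace"
    and \<phi> \<theta> \<alpha> \<beta> :: "real \<Rightarrow> ('a \<Rightarrow> 'a) \<Rightarrow> 'a \<Rightarrow> 'a"
    and m :: "real \<times> real \<Rightarrow> real \<times> real \<Rightarrow> 'a joint_vec \<Rightarrow> 'a joint_vec \<Rightarrow> 'a joint_vec"
    and T V :: "real \<times> real \<Rightarrow> 'a joint_vec \<Rightarrow> 'a \<Rightarrow> 'a"
  assumes "hilbert_space H" and "separable_space (htopology H)"
    and "cp0_semigroup H \<phi>" and "cp0_semigroup H \<theta>"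
    and "strongly_commuting H \<phi> \<theta>"
    and "product_system_e0_dilation H K \<phi> \<theta> m T V \<alpha> \<beta>"
    and "\<forall>t\<ge>0. star_automorphism H (\<phi> t)"
  shows "\<forall>t\<ge>0. star_automorphism K (\<alpha> t)"
proof (intro allI impI)
  fix t :: real assume t: "0 \<le> t"
  have \<phi>: "star_endomorphism H (\<phi> s) \<and> \<phi> s ` bops H = bops H" if "0 \<le> s" for s
    using assms(7) that by (auto simp: star_automorphism_def bij_betw_def)
  then have "endo_semigroup H \<phi>"
    using assms(1,3) by unfold_locales auto
  then show "star_automorphism K (\<alpha> t)"
    using product_system_e0_dilation.alpha_automorphism[OF assms(6)] \<phi> t by blast
qed

end
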